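(* Let $P(n)$ be the probability that a uniformly random partition of $n$ is graphical. Then for all sufficiently large $n$, \[ P(n)\le \exp\left(-\frac{0.11\log n}{\log\log n}\right). \]
   Context: A partition of $n$ is a weakly decreasing sequence of positive integers summing to $n$; the random partition is chosen uniformly among all partitions of $n$. A partition is graphical if it is the degree sequence (in decreasing order) of some simple graph. *)

theory Defs
  imports "HOL-Probability.Probability" "Graph_Theory.Pair_Digraph"
begin

definition partitions_of :: "nat \<Rightarrow> nat list set" where
  "partitions_of n = {xs. sorted_wrt (\<ge>) xs \<and> (\<forall>x\<in>set xs. 0 < x) \<and> sum_list xs = n}"

text \<open>
  A \<open>pair_graph\<close> is a finite, loopless, symmetric digraph without parallel arcs, i.e. a finite
  simple graph in which every edge \<open>{u, v}\<close> is represented by the two arcs \<open>(u, v)\<close> and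
  \<open>(v, u)\<close>. Hence the degree of a vertex, the number of its neighbours, is its out-degree.
\<close>

definition degree_sequence :: "'a pair_pre_digraph \<Rightarrow> nat list" where
  "degree_sequence G =
     rev (sorted_list_of_multiset (image_mset (out_degree (with_proj G)) (mset_set (pverts G))))"

text \<open>Vertices of type \<^typ>\<open>nat\<close> are no restriction, as the graphs are finite.\<close>

definition graphical :: "nat list \<Rightarrow> bool" where
  "graphical xs \<longleftrightarrow> (\<exists>G :: nat pair_pre_digraph. pair_graph G \<and> degree_sequence G = xs)"

text \<open>\<^const>\<open>pmf_of_set\<close> is the uniform distribution only on finite nonempty sets.\<close>

lemma finite_partitions_of: "finite (partitions_of n)"
proof (rule finite_subset)
  have len: "length xs \<le> sum_list xs" if "\<forall>x\<in>set xs. 0 < x" for xs :: "nat list"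
    using that by (induction xs) auto
  show "partitions_of n \<subseteq> {xs. set xs \<subseteq> {..n} \<and> length xs \<le> n}"
    using len by (auto simp: partitions_of_def dest: member_le_sum_list)
  show "finite {xs. set xs \<subseteq> {..n} \<and> length xs \<le> n}"
    by (rule finite_lists_length_le) simp
qed

lemma partitions_of_nonempty: "partitions_of n \<noteq> {}"
proof -
  have "(if n = 0 then [] else [n]) \<in> partitions_of n"
    by (auto simp: partitions_of_def)
  then show ?thesis by blast
qed

definition prob_graphical :: "nat \<Rightarrow> real" where
  "prob_graphical n = measure_pmf.prob (pmf_of_set (partitions_of n)) {xs. graphical xs}"

end

theory Submission
  imports Defs "HOL-Real_Asymp.Real_Asymp"
begin

text \<open>
  Cut a partition along its Durfee square of side \<open>d\<close>, and let \<open>g\<^sub>j\<close> and \<open>h\<^sub>j\<close> be the numbers of columns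
  of height \<open>j\<close> to the right of the square and of rows of length \<open>j\<close> below it. The Erdos--Gallai
  inequalities say that \<open>T\<^sub>k = \<Sum>\<^sub>j min(j, k) (h\<^sub>j - g\<^sub>j) \<ge> k\<close> for all \<open>k \<le> d\<close>. The size of the partition is
  \<open>d\<^sup>2 + \<Sum>\<^sub>j j (g\<^sub>j + h\<^sub>j)\<close>, so given \<open>d\<close> and the sums \<open>s\<^sub>j = g\<^sub>j + h\<^sub>j\<close> the \<open>g\<^sub>j\<close> are independent and uniform
  on \<open>{0..s\<^sub>j}\<close>, and \<open>T\<^sub>k\<close> is a sum of independent symmetric variables.

  Look at \<open>T\<close> along scales \<open>K\<^sub>m\<close> that grow by a factor \<open>(ln n)\<^bsup>5/2\<^esup>\<close>. With overwhelming probability the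
  contribution to \<open>T\<close> at \<open>K\<^sub>m\<close> of all \<open>j\<close> outside the block of ratio \<open>(ln n)\<^bsup>5/2\<^esup>\<close> around \<open>K\<^sub>m\<close> is at most
  \<open>\<surd>(n K\<^sub>m)\<close> times a negative power of \<open>ln n\<close>, while by a Littlewood--Offord argument the contribution of
  the block exceeds minus this bound with probability at most \<open>1/2 + o(1)\<close>. The blocks are independent,
  and there are about \<open>ln n / (5 ln ln n)\<close> of them between the scales \<open>1\<close> and \<open>\<surd>n\<close>, which leaves room for
  \<open>0.11 < (ln 2) / 5\<close>.

  The exceptional events only need bounds up to a power of \<open>n\<close>. These follow from injections that add or
  remove parts, since the number \<open>p(n)\<close> of partitions equals \<open>exp (c \<surd>n)\<close> with \<open>c = \<pi> \<surd>(2/3)\<close> up to a power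
  of \<open>n\<close>; the latter is proved by induction from \<open>n p(n) = \<Sum> v p(n - k v)\<close>, following Erdos.
\<close>

section \<open>Growth of the partition numbers\<close>

text \<open>The main factor, about \<open>(1/2) ^ M\<close>, eventually exceeds every fixed negative
  power of \<open>n\<close>, so it could not survive multiplication by a power of \<open>n\<close>.
  It is therefore counted inside the fibres over \<open>(d, s)\<close>, where uniformity is exact;
  only the exceptional events pass through comparisons of partition numbers, which cost
  \<open>n ^ A\<close> for some large fixed \<open>A\<close>. Those events must then be rarer than a
  prescribed power of \<open>n\<close>.

  For the contribution from outside a block this means allowing a deviation of order \<surd>(ln n)
  standard deviations, and this sets the scales. With block ratio \<open>\<rho>^2\<close> the
  off-block standard deviation is below that of the block by a factor of order \<surd>\<rho>, so the
  block lands in the undecided window with chance of order \<surd>(ln n / \<rho>). This vanishes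
  when \<rho> is a power of ln n with exponent above 1; the exponent 5/4 is used.

  The same demand keeps the scales between about n^(1/100) and n^(23/50): lower blocks have too few
  variables for the failure probability needed, and Durfee sides below the top scale are excluded by
  a crude count only.\<close>

definition nparts :: "nat \<Rightarrow> nat" where
  "nparts n = card (partitions_of n)"

text \<open>As multisets, partitions gain and lose copies of a part without any resorting.\<close>

definition mparts :: "nat \<Rightarrow> nat multiset set" where
  "mparts n = {M. 0 \<notin># M \<and> \<Sum>\<^sub># M = n}"

lemma bij_betw_mset_partitions: "bij_betw mset (partitions_of n) (mparts n)"
proof (rule bij_betw_byWitness[where f' = "\<lambda>M. rev (sorted_list_of_multiset M)"])
  show "\<forall>xs\<in>partitions_of n. rev (sorted_list_of_multiset (mset xs)) = xs"
  proof
    fix xs assume "xs \<in> partitions_of n"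
    then have "sorted (rev xs)"
      by (simp add: partitions_of_def sorted_wrt_rev)
    then have "sort xs = rev xs"
      by (intro properties_for_sort) auto
    then show "rev (sorted_list_of_multiset (mset xs)) = xs"
      by simp
  qed
  show "mset ` partitions_of n \<subseteq> mparts n"
    by (auto simp: partitions_of_def mparts_def sum_mset_sum_list)
  show "(\<lambda>M. rev (sorted_list_of_multiset M)) ` mparts n \<subseteq> partitions_of n"
  proof
    fix xs assume "xs \<in> (\<lambda>M. rev (sorted_list_of_multiset M)) ` mparts n"
    then obtain M where M: "M \<in> mparts n" "xs = rev (sorted_list_of_multiset M)" by blast
    have "sum_list xs = sum_mset (mset xs)" by (simp add: sum_mset_sum_list)
    also have "\<dots> = n" using M by (simp add: mparts_def)
    finally show "xs \<in> partitions_of n"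
      using M by (auto simp: partitions_of_def mparts_def sorted_wrt_rev intro!: gr0I)
  qed
qed auto

lemma card_mparts: "card (mparts n) = nparts n"
  using bij_betw_same_card[OF bij_betw_mset_partitions] by (simp add: nparts_def)

lemma finite_mparts [simp]: "finite (mparts n)"
  using bij_betw_finite[OF bij_betw_mset_partitions] finite_partitions_of by blast

lemma nparts_pos: "nparts n > 0"
  by (simp add: nparts_def card_gt_0_iff finite_partitions_of partitions_of_nonempty)

text \<open>Removing \<open>k\<close> copies of \<open>v\<close> is a bijection onto the partitions
  of \<open>n - k * v\<close>.\<close>

lemma card_mparts_count_ge:
  assumes "v > 0"
  shows "card {M \<in> mparts n. k \<le> count M v} = (if k * v \<le> n then nparts (n - k * v) else 0)"
proof (cases "k * v \<le> n")
  case True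
  have "bij_betw (\<lambda>M. M + replicate_mset k v) (mparts (n - k * v)) {M \<in> mparts n. k \<le> count M v}"
  proof (rule bij_betw_byWitness[where f' = "\<lambda>M. M - replicate_mset k v"])
    show "\<forall>M\<in>{M \<in> mparts n. k \<le> count M v}. M - replicate_mset k v + replicate_mset k v = M"
      by (auto simp: count_le_replicate_mset_subset_eq)
    show "(\<lambda>M. M + replicate_mset k v) ` mparts (n - k * v) \<subseteq> {M \<in> mparts n. k \<le> count M v}"
      using assms True by (auto simp: mparts_def sum_mset_replicate_mset split: if_splits)
    show "(\<lambda>M. M - replicate_mset k v) ` {M \<in> mparts n. k \<le> count M v} \<subseteq> mparts (n - k * v)"
    proof safe
      fix M assume M: "M \<in> mparts n" "k \<le> count M v"
      then have sub: "replicate_mset k v \<subseteq># M"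
        by (simp add: count_le_replicate_mset_subset_eq)
      then have "\<Sum>\<^sub># (M - replicate_mset k v) = n - k * v"
        using M by (simp add: sum_mset_diff mparts_def sum_mset_replicate_mset)
      then show "M - replicate_mset k v \<in> mparts (n - k * v)"
        using M by (auto simp: mparts_def dest: in_diffD)
    qed
  qed simp
  then show ?thesis
    using True bij_betw_same_card card_mparts by metis
next
  case False
  have "{M \<in> mparts n. k \<le> count M v} = {}"
  proof safe
    fix M assume M: "M \<in> mparts n" "k \<le> count M v"
    then have "replicate_mset k v \<subseteq># M"
      by (simp add: count_le_replicate_mset_subset_eq)
    then have "\<Sum>\<^sub># (replicate_mset k v) \<le> \<Sum>\<^sub># M"
      by (metis le_add1 subset_mset.add_diff_inverse sum_mset.union)
    then show "M \<in> {}" using M False by (simp add: mparts_def sum_mset_replicate_mset)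
  qed
  then show ?thesis using False by (auto simp del: Collect_empty_eq)
qed

lemma sum_mset_eq_sum_layers:
  assumes "M \<in> mparts n"
  shows "n = (\<Sum>v=1..n. \<Sum>k=1..n. if k \<le> count M v then v else 0)"
proof -
  have le: "v * count M v \<le> n" if "v \<in># M" for v
  proof -
    have "replicate_mset (count M v) v \<subseteq># M"
      by (simp only: order_refl flip: count_le_replicate_mset_subset_eq)
    then have "\<Sum>\<^sub># (replicate_mset (count M v) v) \<le> \<Sum>\<^sub># M"
      by (metis le_add1 subset_mset.add_diff_inverse sum_mset.union)
    then show ?thesis using assms by (simp add: mparts_def sum_mset_replicate_mset mult.commute)
  qed
  have pos: "0 < v" if "v \<in># M" for v
    using that assms by (auto simp: mparts_def intro!: gr0I)
  have vn: "v \<le> n" if "v \<in># M" for v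
    using le[OF that] that by (metis One_nat_def Suc_leI count_greater_zero_iff le_trans mult.right_neutral mult_le_mono2)
  have cn: "count M v \<le> n" for v
  proof (cases "v \<in># M")
    case True
    then show ?thesis using le[OF True] pos[OF True]
      by (metis One_nat_def Suc_leI le_trans mult.left_neutral mult_le_mono1)
  qed (simp add: not_in_iff)
  obtain xs where xs: "mset xs = M" using ex_mset by blast
  have "n = sum_list xs" using assms xs by (auto simp: mparts_def sum_mset_sum_list)
  also have "\<dots> = (\<Sum>v\<in>set_mset M. v * count M v)"
    using sum_list_map_eq_sum_count[of "\<lambda>x. x" xs] xs by (auto simp: count_mset mult.commute)
  also have "\<dots> = (\<Sum>v=1..n. v * count M v)"
    using pos vn by (intro sum.mono_neutral_left) (auto simp: not_in_iff Suc_le_eq)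
  also have "\<dots> = (\<Sum>v=1..n. \<Sum>k=1..n. if k \<le> count M v then v else 0)"
  proof (rule sum.cong)
    fix v
    have "(\<Sum>k=1..n. if k \<le> count M v then v else 0) = (\<Sum>k\<in>{1..count M v}. v)"
      using cn[of v] by (intro sum.mono_neutral_cong_right) auto
    then show "v * count M v = (\<Sum>k=1..n. if k \<le> count M v then v else 0)" by simp
  qed simp
  finally show ?thesis .
qed

text \<open>Double counting of the total size of all partitions of \<open>n\<close>, each size being
  split into layers: the \<open>k\<close>-th copy of a part \<open>v\<close> contributes
  \<open>v\<close>. Collecting terms by \<open>k * v\<close> would give Euler's recurrence with the
  divisor sum.\<close>

lemma nparts_recurrence:
  "n * nparts n = (\<Sum>v=1..n. \<Sum>k=1..n. if k * v \<le> n then v * nparts (n - k * v) else 0)"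
proof -
  have "n * nparts n = (\<Sum>M\<in>mparts n. n)"
    by (simp add: card_mparts)
  also have "\<dots> = (\<Sum>M\<in>mparts n. \<Sum>v=1..n. \<Sum>k=1..n. if k \<le> count M v then v else 0)"
    using sum_mset_eq_sum_layers by (intro sum.cong) auto
  also have "\<dots> = (\<Sum>v=1..n. \<Sum>k=1..n. \<Sum>M\<in>mparts n. if k \<le> count M v then v else 0)"
    by (subst sum.swap, intro sum.cong refl, subst sum.swap) simp
  also have "\<dots> = (\<Sum>v=1..n. \<Sum>k=1..n. v * card {M \<in> mparts n. k \<le> count M v})"
    by (intro sum.cong refl) (simp flip: sum.inter_filter)
  also have "\<dots> = (\<Sum>v=1..n. \<Sum>k=1..n. if k * v \<le> n then v * nparts (n - k * v) else 0)"
    by (intro sum.cong refl) (simp add: card_mparts_count_ge)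
  finally show ?thesis .
qed

section \<open>Comparison of the sum of v e^(-yv) with 1/y^2\<close>

lemma two_times_le_exp_diff:
  fixes z :: real
  assumes "0 \<le> z"
  shows "2 * z \<le> exp z - exp (- z)"
proof -
  \<comment> \<open>Second order suffices: \<open>u - 1 / u\<close> is at least \<open>2 * z\<close>
    because u^2 - 2zu - 1 is exactly z^4/4.\<close>
  define u where "u = 1 + z + z\<^sup>2 / 2"
  have u: "u \<le> exp z" "u > 0"
    using exp_lower_Taylor_quadratic[OF assms] assms by (auto simp: u_def add_pos_nonneg)
  have "u\<^sup>2 - 2 * z * u - 1 = z ^ 4 / 4"
    by (simp add: u_def power2_eq_square power4_eq_xxxx field_simps)
  moreover have "0 \<le> z ^ 4 / 4" using assms by simp
  ultimately have "u * u - 1 \<ge> 2 * z * u"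
    unfolding power2_eq_square by linarith
  then have "2 * z \<le> u - 1 / u"
    using u by (simp add: field_simps)
  also have "1 / u \<ge> exp (- z)"
    using u by (simp add: exp_minus field_simps)
  then have "u - 1 / u \<le> exp z - exp (- z)" using u by linarith
  finally show ?thesis .
qed

text \<open>The left side is the closed form of the sum of v e^(-yv) over all v; the right side is
  1/(2 sinh(y/2))^2, so comparing it with 1/y^2 amounts to comparing sinh with its argument.\<close>

lemma exp_neg_quotient_eq:
  fixes y :: real
  assumes "0 < y"
  shows "exp (- y) / (1 - exp (- y))\<^sup>2 = 1 / (exp (y / 2) - exp (- (y / 2)))\<^sup>2"
proof -
  have "1 - exp (- y) = exp (- (y / 2)) * (exp (y / 2) - exp (- (y / 2)))"
    by (simp add: right_diff_distrib flip: exp_add)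
  moreover have "exp (- y) = (exp (- (y / 2)))\<^sup>2"
    by (simp flip: exp_double)
  ultimately show ?thesis
    by (simp add: power_mult_distrib)
qed

lemma exp_neg_quotient_le:
  fixes y :: real
  assumes "0 < y"
  shows "exp (- y) / (1 - exp (- y))\<^sup>2 \<le> 1 / y\<^sup>2"
proof -
  have "y \<le> exp (y / 2) - exp (- (y / 2))"
    using two_times_le_exp_diff[of "y / 2"] assms by simp
  then have "y\<^sup>2 \<le> (exp (y / 2) - exp (- (y / 2)))\<^sup>2"
    using assms by (intro power_mono) auto
  then show ?thesis
    using assms by (simp add: exp_neg_quotient_eq frac_le)
qed

text \<open>The true loss for small \<open>y\<close> is near 1/12. Any constant would serve, since
  it will be paid only for the O(1/x) values of \<open>k\<close> with xk at most 1, and O(1/x) is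
  the tolerated error.\<close>

lemma exp_neg_quotient_ge:
  fixes y :: real
  assumes "0 < y" "y \<le> 1"
  shows "1 / y\<^sup>2 - 1 \<le> exp (- y) / (1 - exp (- y))\<^sup>2"
proof -
  define z where "z = y / 2"
  have z: "0 < z" "z \<le> 1 / 2" using assms by (auto simp: z_def)
  obtain t where t: "\<bar>t\<bar> \<le> \<bar>z\<bar>" "exp z = (\<Sum>m<4. z ^ m / fact m) + exp t / fact 4 * z ^ 4"
    using Maclaurin_exp_le[of z 4] by blast
  obtain t' where t': "exp (- z) = (\<Sum>m<4. (- z) ^ m / fact m) + exp t' / fact 4 * (- z) ^ 4"
    using Maclaurin_exp_le[of "- z" 4] by blast
  have "exp t \<le> exp (1 / 2)" using t z by simp
  also have "exp (1 / 2 :: real) \<le> 2"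
    using exp_bound[of "1/2 :: real"] by (simp add: power2_eq_square)
  finally have et: "exp t \<le> 2" .
  have "exp z = 1 + z + z\<^sup>2 / 2 + z ^ 3 / 6 + exp t / 24 * z ^ 4"
    using t(2) by (simp add: eval_nat_numeral fact_numeral)
  moreover have "exp t / 24 * z ^ 4 \<le> 2 / 24 * z ^ 4"
    using et by (intro mult_right_mono) auto
  moreover have "exp (- z) \<ge> 1 - z + z\<^sup>2 / 2 - z ^ 3 / 6"
  proof -
    have "0 \<le> exp t' / 24 * z ^ 4" using z by (intro mult_nonneg_nonneg) auto
    then show ?thesis using t' by (simp add: eval_nat_numeral fact_numeral)
  qed
  moreover have "z ^ 4 \<le> z ^ 3" using z by (intro power_decreasing) auto
  moreover have "z ^ 3 \<ge> 0" using z by auto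
  ultimately have "exp z - exp (- z) \<le> 2 * z + 2 / 3 * z ^ 3"
    by linarith
  also have "\<dots> = y * (1 + z\<^sup>2 / 3)"
    by (simp add: z_def power3_eq_cube power2_eq_square field_simps)
  finally have "exp z - exp (- z) \<le> y * (1 + z\<^sup>2 / 3)" .
  moreover have "0 < exp z - exp (- z)" using z by simp
  ultimately have "(exp z - exp (- z))\<^sup>2 \<le> (y * (1 + z\<^sup>2 / 3))\<^sup>2"
    by (intro power_mono) auto
  also have "\<dots> \<le> y\<^sup>2 * (1 + y\<^sup>2)"
  proof -
    have "z ^ 4 \<le> z\<^sup>2" using z by (intro power_decreasing) auto
    moreover have "y\<^sup>2 = 4 * z\<^sup>2" by (simp add: z_def power2_eq_square)
    moreover have "(1 + z\<^sup>2 / 3)\<^sup>2 = 1 + 2 / 3 * z\<^sup>2 + z ^ 4 / 9"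
      by (simp add: power2_eq_square power4_eq_xxxx field_simps)
    moreover have "0 \<le> z\<^sup>2" by simp
    ultimately have "(1 + z\<^sup>2 / 3)\<^sup>2 \<le> 1 + y\<^sup>2" by linarith
    then show ?thesis by (simp add: power_mult_distrib mult_left_mono)
  qed
  finally have le: "(exp z - exp (- z))\<^sup>2 \<le> y\<^sup>2 * (1 + y\<^sup>2)" .
  have "1 / y\<^sup>2 - 1 \<le> 1 / (y\<^sup>2 * (1 + y\<^sup>2))"
  proof -
    have "(1 - y\<^sup>2) * (1 + y\<^sup>2) \<le> 1" by (simp add: algebra_simps)
    moreover have "1 + y\<^sup>2 > 0" by (simp add: add_pos_nonneg)
    ultimately have "1 - y\<^sup>2 \<le> 1 / (1 + y\<^sup>2)" by (simp add: pos_le_divide_eq)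
    then have "(1 - y\<^sup>2) / y\<^sup>2 \<le> 1 / (1 + y\<^sup>2) / y\<^sup>2"
      by (intro divide_right_mono) auto
    then show ?thesis using assms by (simp add: diff_divide_distrib mult.commute)
  qed
  also have "\<dots> \<le> 1 / (exp z - exp (- z))\<^sup>2"
    using le \<open>0 < exp z - exp (- z)\<close> by (intro frac_le) auto
  finally show ?thesis
    using assms by (simp add: exp_neg_quotient_eq z_def)
qed

lemma exp_mult_Suc: "exp (- (y * real (Suc v))) = exp (- y) * exp (- y) ^ v" for y :: real
proof -
  have "exp (- y) * exp (- y) ^ v = exp (- y) ^ Suc v" by simp
  also have "\<dots> = exp (real (Suc v) * (- y))" by (rule exp_of_nat_mult [symmetric])
  also have "real (Suc v) * (- y) = - (y * real (Suc v))" by (simp only: mult_minus_right mult.commute)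
  finally show ?thesis by (rule sym)
qed

lemma sums_mult_exp_neg:
  fixes y :: real
  assumes "0 < y"
  shows "(\<lambda>v. real (Suc v) * exp (- (y * real (Suc v)))) sums (exp (- y) / (1 - exp (- y))\<^sup>2)"
proof -
  have "(\<lambda>v. exp (- y) * (of_nat (Suc v) * exp (- y) ^ v)) sums (exp (- y) * (1 / (1 - exp (- y))\<^sup>2))"
    using assms by (intro sums_mult geometric_deriv_sums) auto
  moreover have "exp (- y) * (of_nat (Suc v) * exp (- y) ^ v) = real (Suc v) * exp (- (y * real (Suc v)))" for v
    unfolding exp_mult_Suc by (simp only: mult_ac)
  ultimately show ?thesis by (simp only: mult_1_right times_divide_eq_right)
qed

lemma sum_from_1_eq: "(\<Sum>v=1..n. f v) = (\<Sum>v<n. f (Suc v))" for f :: "nat \<Rightarrow> 'a::comm_monoid_add"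
  using sum.atLeast1_atMost_eq[of f n] by simp

lemma sum_mult_exp_neg_le:
  fixes y :: real
  assumes "0 < y"
  shows "(\<Sum>v=1..n. real v * exp (- (y * real v))) \<le> 1 / y\<^sup>2"
proof -
  have "(\<Sum>v=1..n. real v * exp (- (y * real v))) \<le> exp (- y) / (1 - exp (- y))\<^sup>2"
    unfolding sum_from_1_eq
    using sums_mult_exp_neg[OF assms] sum_le_suminf[OF sums_summable[OF sums_mult_exp_neg[OF assms]], of "{..<n}"]
    by (simp add: sums_iff)
  also have "\<dots> \<le> 1 / y\<^sup>2" using assms by (rule exp_neg_quotient_le)
  finally show ?thesis .
qed

lemma tendsto_sum_mult_exp_neg:
  fixes y :: real
  assumes "0 < y"
  shows "(\<lambda>n. \<Sum>v=1..n. real v * exp (- (y * real v))) \<longlonglongrightarrow> exp (- y) / (1 - exp (- y))\<^sup>2"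
  unfolding sum_from_1_eq using sums_mult_exp_neg[OF assms] by (simp add: sums_def)

lemma sum_exp_neg_le:
  fixes y :: real
  assumes "0 < y"
  shows "(\<Sum>v=1..n. exp (- (y * real v))) \<le> 1 / y"
proof -
  define q where "q = exp (- y)"
  have q: "0 < q" "q < 1" using assms by (auto simp: q_def)
  have "(\<Sum>v=1..n. exp (- (y * real v))) = (\<Sum>v<n. q * q ^ v)"
    unfolding sum_from_1_eq q_def exp_mult_Suc ..
  also have "\<dots> = q * ((1 - q ^ n) / (1 - q))"
    using q by (simp add: sum_gp_strict flip: sum_distrib_left)
  also have "\<dots> \<le> q * (1 / (1 - q))"
    using q by (intro mult_left_mono divide_right_mono) auto
  also have "\<dots> \<le> 1 / y"
  proof -
    have "(y + 1) * q \<le> exp y * q"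
      using exp_ge_add_one_self[of y] q by (intro mult_right_mono) (auto simp: add.commute)
    also have "\<dots> = 1" by (simp add: q_def flip: exp_add)
    finally show ?thesis using q assms by (simp add: field_simps)
  qed
  finally show ?thesis .
qed

lemma sum_cube_exp_neg_le:
  fixes y :: real
  assumes "0 < y"
  shows "(\<Sum>v=1..n. real v ^ 3 * exp (- (y * real v))) \<le> 96 / y ^ 4"
proof -
  \<comment> \<open>Half of the decay absorbs the cube, by the third Taylor term of exp at
    \<open>w / 2\<close>; the remaining half is summed geometrically.\<close>
  have cube: "w ^ 3 * exp (- w) \<le> 48 * exp (- (w / 2))" if "0 \<le> w" for w :: real
  proof -
    have "(w / 2) ^ 3 / 6 \<le> exp (w / 2)"
      using exp_lower_Taylor_quadratic[of "w/2"] that Maclaurin_exp_le[of "w / 2" 4]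
      by (auto simp: eval_nat_numeral fact_numeral intro!: add_nonneg_nonneg)
    then have "w ^ 3 \<le> 48 * exp (w / 2)" by (simp add: power_divide)
    then have "w ^ 3 * exp (- w) \<le> 48 * exp (w / 2) * exp (- w)" by (intro mult_right_mono) auto
    then show ?thesis by (simp add: mult.assoc flip: exp_add)
  qed
  have "(\<Sum>v=1..n. real v ^ 3 * exp (- (y * real v))) = (\<Sum>v=1..n. (y * real v) ^ 3 * exp (- (y * real v))) / y ^ 3"
    using assms by (simp add: sum_divide_distrib power_mult_distrib)
  also have "\<dots> \<le> (\<Sum>v=1..n. 48 * exp (- (y * real v / 2))) / y ^ 3"
    using assms by (intro divide_right_mono sum_mono cube) auto
  also have "\<dots> = 48 * (\<Sum>v=1..n. exp (- (y / 2 * real v))) / y ^ 3"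
    by (simp add: sum_distrib_left)
  also have "\<dots> \<le> 48 * (1 / (y / 2)) / y ^ 3"
    using assms by (intro divide_right_mono mult_left_mono sum_exp_neg_le) auto
  also have "\<dots> = 96 / y ^ 4" using assms by (simp add: field_simps eval_nat_numeral)
  finally show ?thesis .
qed

section \<open>Partial sums and tails of \<zeta>(2)\<close>

lemma sum_inverse_squares_le: "(\<Sum>k=1..n. 1 / (real k)\<^sup>2) \<le> pi\<^sup>2 / 6"
  unfolding sum_from_1_eq
  using inverse_squares_sums sum_le_suminf[OF sums_summable[OF inverse_squares_sums], of "{..<n}"]
  by (simp add: sums_iff add.commute)

text \<open>Since 1/(t+1)^2 is at most 1/t - 1/(t+1), the partial sum plus \<open>1 / real K\<close>
  decreases in \<open>K\<close>. This controls the tails of \<zeta>(2) here and, later, the weight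
  of indices above a block.\<close>

lemma sum_inverse_squares_telescope:
  assumes "0 < K"
  shows "(\<Sum>k=1..K+n. 1 / (real k)\<^sup>2) + 1 / real (K + n) \<le> (\<Sum>k=1..K. 1 / (real k)\<^sup>2) + 1 / real K"
proof (induction n)
  case (Suc n)
  define t where "t = real (K + n)"
  have t: "t > 0" using assms by (simp add: t_def)
  have "1 / (t + 1)\<^sup>2 + 1 / (t + 1) \<le> 1 / t"
  proof -
    have "1 / (t + 1)\<^sup>2 \<le> 1 / (t * (t + 1))"
      using t by (intro divide_left_mono) (auto simp: power2_eq_square)
    also have "\<dots> = 1 / t - 1 / (t + 1)" using t by (simp add: field_simps)
    finally show ?thesis by simp
  qed
  then show ?case using Suc by (simp add: t_def add_ac)
qed simp

lemma sum_inverse_squares_ge: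
  assumes "0 < K"
  shows "pi\<^sup>2 / 6 - 1 / real K \<le> (\<Sum>k=1..K. 1 / (real k)\<^sup>2)"
proof -
  have "(\<lambda>n. \<Sum>k=1..n. 1 / (real k)\<^sup>2) \<longlonglongrightarrow> pi\<^sup>2 / 6"
    unfolding sum_from_1_eq using inverse_squares_sums by (simp add: sums_def add.commute)
  then have "(\<lambda>n. \<Sum>k=1..n+K. 1 / (real k)\<^sup>2) \<longlonglongrightarrow> pi\<^sup>2 / 6"
    by (rule LIMSEQ_ignore_initial_segment)
  then have "pi\<^sup>2 / 6 \<le> (\<Sum>k=1..K. 1 / (real k)\<^sup>2) + 1 / real K"
  proof (rule LIMSEQ_le_const2, intro exI allI impI)
    fix n :: nat
    have "0 \<le> 1 / real (K + n)" by simp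
    then show "(\<Sum>k=1..n+K. 1 / (real k)\<^sup>2) \<le> (\<Sum>k=1..K. 1 / (real k)\<^sup>2) + 1 / real K"
      using sum_inverse_squares_telescope[OF assms, of n] by (simp only: add.commute)
  qed
  then show ?thesis by linarith
qed

definition hr_const :: real where
  "hr_const = pi * sqrt (2 / 3)"

text \<open>The derivative of \<open>hr_const * sqrt\<close> at \<open>n\<close>, so removing a size
  \<open>m\<close> should cost a factor near exp(-m \<open>hr_rate n\<close>). Its square is
  \<pi>^2/(6n), that is, \<zeta>(2) divided by the square of the rate is \<open>n\<close>.\<close>

definition hr_rate :: "nat \<Rightarrow> real" where
  "hr_rate n = hr_const / (2 * sqrt (real n))"

lemma hr_const_pos: "hr_const > 0"
  by (simp add: hr_const_def)

lemma hr_rate_pos: "n > 0 \<Longrightarrow> hr_rate n > 0"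
  by (simp add: hr_rate_def hr_const_pos)

lemma hr_rate_sq: "n > 0 \<Longrightarrow> (hr_rate n)\<^sup>2 = pi\<^sup>2 / (6 * real n)"
  by (simp add: hr_rate_def hr_const_def power_divide power_mult_distrib)

lemma sqrt_add_le:
  assumes "0 < n" "0 \<le> n + m"
  shows "sqrt (n + m) \<le> sqrt n + m / (2 * sqrt n)"
proof -
  have "sqrt (n + m) * sqrt n = sqrt ((n + m) * n)"
    by (simp add: real_sqrt_mult)
  also have "\<dots> \<le> (n + m + n) / 2"
    using assms by (intro arith_geo_mean_sqrt) auto
  finally have "sqrt (n + m) \<le> (2 * n + m) / 2 / sqrt n"
    using assms by (simp add: pos_le_divide_eq)
  also have "\<dots> = n / sqrt n + m / (2 * sqrt n)"
    by (simp add: add_divide_distrib)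
  finally show ?thesis using assms by (simp add: real_div_sqrt)
qed

lemma hr_exp_add_le:
  assumes "0 < n" "0 \<le> real n + m"
  shows "exp (hr_const * sqrt (real n + m)) \<le> exp (hr_const * sqrt (real n)) * exp (hr_rate n * m)"
proof -
  have "hr_const * sqrt (real n + m) \<le> hr_const * (sqrt (real n) + m / (2 * sqrt (real n)))"
    using assms hr_const_pos by (intro mult_left_mono sqrt_add_le) auto
  then show ?thesis
    by (simp add: hr_rate_def algebra_simps flip: exp_add)
qed

text \<open>The induction closes without any error term: the tangent bound for the square root and
  the bound 1/(xk)^2 for the inner sums are both one-sided, and the sum of 1/(xk)^2 over all
  \<open>k\<close> is exactly \<open>n\<close> by the choice of \<open>hr_const\<close>.\<close>

theorem nparts_upper: "real (nparts n) \<le> exp (hr_const * sqrt (real n))"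
proof (induction n rule: less_induct)
  case (less n)
  show ?case
  proof (cases "n = 0")
    case True
    have "xs = []" if "xs \<in> partitions_of 0" for xs
      using that by (cases xs) (auto simp: partitions_of_def)
    then have "partitions_of 0 = {[]}"
      using partitions_of_nonempty by blast
    then show ?thesis using True by (simp add: nparts_def)
  next
    case False
    define x where "x = hr_rate n"
    have x: "x > 0" using False by (simp add: x_def hr_rate_pos)
    define E where "E = exp (hr_const * sqrt (real n))"
    have "real n * real (nparts n) = real (n * nparts n)" by simp
    also have "\<dots> = (\<Sum>v=1..n. \<Sum>k=1..n. real (if k * v \<le> n then v * nparts (n - k * v) else 0))"
      unfolding nparts_recurrence by simp
    also have "\<dots> \<le> (\<Sum>v=1..n. \<Sum>k=1..n. E * (real v * exp (- (x * real k * real v))))"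
    proof (intro sum_mono)
      fix v k assume vk: "v \<in> {1..n}" "k \<in> {1..n}"
      show "real (if k * v \<le> n then v * nparts (n - k * v) else 0) \<le> E * (real v * exp (- (x * real k * real v)))"
      proof (cases "k * v \<le> n")
        case True
        have "k * v > 0" using vk by simp
        then have "real (nparts (n - k * v)) \<le> exp (hr_const * sqrt (real (n - k * v)))"
          using less False by simp
        also have "\<dots> \<le> E * exp (x * - real (k * v))"
          unfolding E_def x_def using hr_exp_add_le[of n "- real (k * v)"] True False
          by (simp add: of_nat_diff flip: of_nat_mult)
        finally have "real v * real (nparts (n - k * v)) \<le> real v * (E * exp (x * - real (k * v)))"
          by (intro mult_left_mono) auto
        then show ?thesis using True by (simp add: mult_ac)
      qed (simp add: E_def)
    qed
    also have "\<dots> = E * (\<Sum>k=1..n. \<Sum>v=1..n. real v * exp (- (x * real k * real v)))"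
      by (subst sum.swap) (simp add: sum_distrib_left)
    also have "\<dots> \<le> E * (\<Sum>k=1..n. 1 / (x * real k)\<^sup>2)"
      using x by (intro mult_left_mono sum_mono sum_mult_exp_neg_le) (auto simp: E_def)
    also have "(\<Sum>k=1..n. 1 / (x * real k)\<^sup>2) = 1 / x\<^sup>2 * (\<Sum>k=1..n. 1 / (real k)\<^sup>2)"
      by (simp add: sum_distrib_left power_mult_distrib)
    also have "E * \<dots> \<le> E * (1 / x\<^sup>2 * (pi\<^sup>2 / 6))"
      by (intro mult_left_mono sum_inverse_squares_le) (auto simp: E_def)
    also have "1 / x\<^sup>2 * (pi\<^sup>2 / 6) = real n"
      using False by (simp add: x_def hr_rate_sq)
    finally show ?thesis using False by (simp add: E_def)
  qed
qed

text \<open>The coefficient 1/2 of the square, in place of Taylor's 1/8, keeps the bound valid up to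
  \<open>y = 1\<close>; this is needed because the removed part may be almost all of
  \<open>n\<close>. The left side factors as (1 - y)(1 + y/2).\<close>

lemma sqrt_diff_ge:
  assumes "0 \<le> y" "y \<le> 1"
  shows "1 - y / 2 - y\<^sup>2 / 2 \<le> sqrt (1 - y)"
proof (rule real_le_rsqrt)
  have "1 - y / 2 - y\<^sup>2 / 2 = (1 - y) * (1 + y / 2)"
    by (simp add: power2_eq_square field_simps)
  moreover have "((1 - y) * (1 + y / 2))\<^sup>2 = (1 - y) * ((1 - y) * (1 + y / 2)\<^sup>2)"
    by (simp add: power2_eq_square)
  moreover have "(1 - y) * ((1 - y) * (1 + y / 2)\<^sup>2) \<le> (1 - y) * 1"
  proof (intro mult_left_mono)
    have "(1 - y) * (1 + y / 2)\<^sup>2 = 1 - 3 / 4 * y\<^sup>2 - y ^ 3 / 4"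
      by (simp add: power2_eq_square power3_eq_cube field_simps)
    moreover have "0 \<le> y\<^sup>2" "0 \<le> y ^ 3" using assms by auto
    ultimately show "(1 - y) * (1 + y / 2)\<^sup>2 \<le> 1" by linarith
  qed (use assms in simp)
  ultimately show "(1 - y / 2 - y\<^sup>2 / 2)\<^sup>2 \<le> 1 - y" by simp
qed

text \<open>With y = m/n, the denominator n^A gains a factor e^(Ay) and the second-order term of the
  square root loses a factor e^(-xmy). The bracket is the linearisation of their product.\<close>

lemma exp_sqrt_over_power_diff_ge:
  fixes A :: nat
  assumes "m < n" "0 < n"
  defines "x \<equiv> hr_rate n"
  shows "exp (hr_const * sqrt (real (n - m))) / real (n - m) ^ A
     \<ge> exp (hr_const * sqrt (real n)) / real n ^ A * (exp (- (x * real m)) * (1 + real m / real n * (real A - x * real m)))"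
proof -
  define y where "y = real m / real n"
  have y: "0 \<le> y" "y < 1" using assms by (auto simp: y_def)
  have nm: "real (n - m) = real n * (1 - y)"
    using assms by (simp add: y_def of_nat_diff field_simps)
  have m: "real m = real n * y" using assms by (simp add: y_def)
  have xm: "x * real m = hr_const * sqrt (real n) * y / 2"
  proof -
    have "real n = sqrt (real n) * sqrt (real n)" by simp
    then have "x * real m = hr_const / (2 * sqrt (real n)) * (sqrt (real n) * sqrt (real n) * y)"
      unfolding m x_def hr_rate_def by simp
    then show ?thesis using assms by (simp del: real_sqrt_mult_self)
  qed
  have "hr_const * sqrt (real n) * (1 - y / 2 - y\<^sup>2 / 2) \<le> hr_const * sqrt (real n) * sqrt (1 - y)"
    using sqrt_diff_ge[of y] y hr_const_pos by (intro mult_left_mono) auto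
  also have "\<dots> = hr_const * sqrt (real (n - m))"
    unfolding nm by (simp add: real_sqrt_mult)
  also have "hr_const * sqrt (real n) * (1 - y / 2 - y\<^sup>2 / 2) = hr_const * sqrt (real n) - x * real m - x * real m * y"
    unfolding xm by (simp add: algebra_simps power2_eq_square)
  finally have 1: "exp (hr_const * sqrt (real n) - x * real m - x * real m * y) \<le> exp (hr_const * sqrt (real (n - m)))"
    by simp
  have "(1 - y) ^ A \<le> exp (- y) ^ A"
    using y exp_ge_add_one_self[of "- y"] by (intro power_mono) auto
  also have "\<dots> = exp (real A * (- y))" by (simp only: exp_of_nat_mult)
  finally have "real (n - m) ^ A \<le> real n ^ A * exp (real A * (- y))"
    unfolding nm power_mult_distrib by (intro mult_left_mono) auto
  then have 2: "exp (real A * y) / real n ^ A \<le> 1 / real (n - m) ^ A"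
    using assms by (simp add: exp_minus field_simps)
  have "exp (hr_const * sqrt (real n)) / real n ^ A * (exp (- (x * real m)) * (1 + y * (real A - x * real m)))
      \<le> exp (hr_const * sqrt (real n)) / real n ^ A * (exp (- (x * real m)) * exp (y * (real A - x * real m)))"
    by (intro mult_left_mono exp_ge_add_one_self) auto
  also have "\<dots> = exp (hr_const * sqrt (real n) - x * real m - x * real m * y) * (exp (real A * y) / real n ^ A)"
    by (simp add: algebra_simps flip: exp_add)
  also have "\<dots> \<le> exp (hr_const * sqrt (real (n - m))) * (1 / real (n - m) ^ A)"
    using 1 2 by (intro mult_mono) auto
  finally show ?thesis by (simp add: y_def)
qed

text \<open>
  Without the factor in brackets the sum is \<open>\<Sum> \<sigma>(m) e\<^sup>-\<^sup>x\<^sup>m\<close>, truncated to a box, and equals \<open>n - O(1/x)\<close>.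
  A large \<open>A\<close> makes the first-order gain beat both this loss and the second-order term.
\<close>
lemma weighted_divisor_sum_ge:
  fixes A :: real and n :: nat
  assumes n: "0 < n" and x_def: "x = hr_rate n" and x: "x \<le> 1 / 2" "2 / x \<le> real n"
    and A: "3200 \<le> A"
    and W: "\<And>G. n \<le> G \<Longrightarrow>
      (\<Sum>v=1..G. \<Sum>k=1..G. real v * (exp (- (x * real (k * v))) * (1 + real (k * v) / real n * (A - x * real (k * v))))) \<le> W"
  shows "real n \<le> W"
proof -
  have x0: "x > 0" using n by (simp add: x_def hr_rate_pos)
  \<comment> \<open>About 1/x terms, as the lower bound 1/(xk)^2 - 1 needs xk at most 1. The
    subtracted ones cost at most 1/x and the missing tail of \<zeta>(2) at most 2/x, together
    3/x.\<close>
  define K where "K = nat \<lfloor>1 / x\<rfloor>"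
  have "1 / x \<ge> 2" using x x0 by (simp add: field_simps)
  then have K: "0 < K" "real K \<le> 1 / x" "1 / (2 * x) \<le> real K"
  proof -
    have "1 \<le> \<lfloor>1 / x\<rfloor>" using \<open>1 / x \<ge> 2\<close> by (simp add: le_floor_iff)
    then have *: "real K = of_int \<lfloor>1 / x\<rfloor>" "0 < K" using x0 by (auto simp: K_def less_imp_le)
    show "0 < K" "real K \<le> 1 / x" using * by auto
    have "1 / x - 1 \<le> real K" unfolding * by linarith
    then show "1 / (2 * x) \<le> real K" using \<open>1 / x \<ge> 2\<close> by (simp add: field_simps)
  qed
  have "1 / x \<le> 2 / x" using x0 by (intro divide_right_mono) auto
  then have "real K \<le> real n" using K x by linarith
  then have Kn: "K \<le> n" by simp
  define S0 where "S0 = (\<lambda>G. \<Sum>k=1..K. \<Sum>v=1..G. real v * exp (- (x * real k * real v)))"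
  have S1: "1 / (16 * x ^ 3) \<le> (\<Sum>k=1..G. \<Sum>v=1..G. real v * exp (- (x * real k * real v)) * real (k * v))" (is "_ \<le> ?S1")
    if G: "n \<le> G" for G
  proof -
    \<comment> \<open>The terms with k = 1 and v between 1/x and 2/x already have the right order:
      at least 1/(2x) of them, each at least e^(-2)/x^2, hence at least 1/(8x^2).\<close>
    define V where "V = {nat \<lceil>1 / x\<rceil>..nat \<lfloor>2 / x\<rfloor>}"
    have V: "1 / x \<le> real v" "real v \<le> 2 / x" if "v \<in> V" for v
    proof -
      have "1 / x \<le> real (nat \<lceil>1 / x\<rceil>)" by (rule real_nat_ceiling_ge)
      also have "\<dots> \<le> real v" using that by (simp add: V_def)
      finally show "1 / x \<le> real v" .
      have "real v \<le> real (nat \<lfloor>2 / x\<rfloor>)" using that by (simp add: V_def)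
      also have "\<dots> \<le> 2 / x" using x0 by (intro of_nat_floor) auto
      finally show "real v \<le> 2 / x" .
    qed
    have "real (nat \<lfloor>2 / x\<rfloor>) = of_int \<lfloor>2 / x\<rfloor>" "real (nat \<lceil>1 / x\<rceil>) = of_int \<lceil>1 / x\<rceil>"
      using x0 by (simp_all add: ceiling_le_iff order_less_imp_le)
    then have "2 / x < real (nat \<lfloor>2 / x\<rfloor>) + 1" "real (nat \<lceil>1 / x\<rceil>) < 1 / x + 1"
      by linarith+
    then have "real (card V) \<ge> 2 / x - 1 / x - 1"
      unfolding V_def card_atLeastAtMost by linarith
    then have cV: "real (card V) \<ge> 1 / (2 * x)"
      using \<open>1 / x \<ge> 2\<close> by (simp add: field_simps)
    have e2: "exp (- 2 :: real) \<ge> 1 / 8"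
    proof -
      have "exp (1 :: real) \<le> 272 / 100" by (rule order_trans[OF less_imp_le[OF e_less_272]]) simp
      then have "exp (1 :: real) ^ 2 \<le> (272 / 100) ^ 2" by (intro power_mono) auto
      also have "\<dots> \<le> 8" by (simp add: power2_eq_square)
      finally have "exp (2 :: real) \<le> 8" by (simp flip: exp_double)
      then show ?thesis by (simp add: exp_minus field_simps)
    qed
    have V_sub: "V \<subseteq> {1..G}"
    proof
      fix v assume v: "v \<in> V"
      have "real v \<le> real G" "1 \<le> real v" using V[OF v] x(2) G \<open>1 / x \<ge> 2\<close> by linarith+
      then show "v \<in> {1..G}" by simp
    qed
    have "1 / (16 * x ^ 3) = 1 / (2 * x) * ((1 / x)\<^sup>2 * (1 / 8))"
      using x0 by (simp add: field_simps eval_nat_numeral)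
    also have "\<dots> \<le> real (card V) * ((1 / x)\<^sup>2 * (1 / 8))"
      using cV by (intro mult_right_mono) auto
    also have "\<dots> = (\<Sum>v\<in>V. (1 / x)\<^sup>2 * (1 / 8))" by simp
    also have "\<dots> \<le> (\<Sum>v\<in>V. (real v)\<^sup>2 * exp (- (x * real v)))"
    proof (intro sum_mono mult_mono power_mono)
      fix v assume v: "v \<in> V"
      show "1 / x \<le> real v" by (rule V[OF v])
      have "x * real v \<le> 2" using V(2)[OF v] x0 by (simp add: field_simps)
      then have "exp (- 2) \<le> exp (- (x * real v))" by simp
      then show "1 / 8 \<le> exp (- (x * real v))" using e2 by linarith
    qed (use x0 in auto)
    also have "\<dots> \<le> (\<Sum>v=1..G. (real v)\<^sup>2 * exp (- (x * real v)))"
      using V_sub by (intro sum_mono2) auto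
    also have "\<dots> = (\<Sum>k\<in>{1::nat}. \<Sum>v=1..G. real v * exp (- (x * real k * real v)) * real (k * v))"
      by (simp add: power2_eq_square mult_ac)
    also have "\<dots> \<le> ?S1"
      using G n by (intro sum_mono2 sum_nonneg) auto
    finally show ?thesis .
  qed
  have S2: "(\<Sum>k=1..G. \<Sum>v=1..G. real v * exp (- (x * real k * real v)) * (real (k * v))\<^sup>2) \<le> 192 / x ^ 4" for G
  proof -
    have "(\<Sum>k=1..G. \<Sum>v=1..G. real v * exp (- (x * real k * real v)) * (real (k * v))\<^sup>2)
        = (\<Sum>k=1..G. (real k)\<^sup>2 * (\<Sum>v=1..G. real v ^ 3 * exp (- (x * real k * real v))))"
      by (simp add: sum_distrib_left power2_eq_square power3_eq_cube mult_ac)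
    also have "\<dots> \<le> (\<Sum>k=1..G. (real k)\<^sup>2 * (96 / (x * real k) ^ 4))"
      using x0 by (intro sum_mono mult_left_mono sum_cube_exp_neg_le) auto
    also have "\<dots> = 96 / x ^ 4 * (\<Sum>k=1..G. 1 / (real k)\<^sup>2)"
      unfolding sum_distrib_left
      by (intro sum.cong refl) (simp add: power_mult_distrib field_simps eval_nat_numeral)
    also have "\<dots> \<le> 96 / x ^ 4 * 2"
    proof (intro mult_left_mono)
      have "pi\<^sup>2 \<le> (16 / 5)\<^sup>2"
        using pi_less_4 pi_approx(2) by (intro power_mono) auto
      then have "pi\<^sup>2 / 6 \<le> 2" by (simp add: power2_eq_square)
      then show "(\<Sum>k=1..G. 1 / (real k)\<^sup>2) \<le> 2"
        using sum_inverse_squares_le[of G] by linarith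
    qed (use x0 in auto)
    finally show ?thesis by simp
  qed
  have le: "S0 G + A / real n * (1 / (16 * x ^ 3)) - x / real n * (192 / x ^ 4) \<le> W" if G: "n \<le> G" for G
  proof -
    have "S0 G \<le> (\<Sum>k=1..G. \<Sum>v=1..G. real v * exp (- (x * real k * real v)))"
      unfolding S0_def using G Kn by (intro sum_mono2 sum_nonneg) auto
    moreover have "A / real n * (1 / (16 * x ^ 3)) \<le> A / real n * (\<Sum>k=1..G. \<Sum>v=1..G. real v * exp (- (x * real k * real v)) * real (k * v))"
      using A by (intro mult_left_mono S1 G) auto
    moreover have "x / real n * (\<Sum>k=1..G. \<Sum>v=1..G. real v * exp (- (x * real k * real v)) * (real (k * v))\<^sup>2) \<le> x / real n * (192 / x ^ 4)"
      using x0 by (intro mult_left_mono S2) auto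
    moreover have "(\<Sum>v=1..G. \<Sum>k=1..G. real v * (exp (- (x * real (k * v))) * (1 + real (k * v) / real n * (A - x * real (k * v)))))
       = (\<Sum>k=1..G. \<Sum>v=1..G. real v * exp (- (x * real k * real v)))
         + A / real n * (\<Sum>k=1..G. \<Sum>v=1..G. real v * exp (- (x * real k * real v)) * real (k * v))
         - x / real n * (\<Sum>k=1..G. \<Sum>v=1..G. real v * exp (- (x * real k * real v)) * (real (k * v))\<^sup>2)"
      unfolding sum_distrib_left
      by (subst sum.swap, unfold sum.distrib[symmetric] sum_subtractf[symmetric], intro sum.cong refl)
         (simp add: algebra_simps power2_eq_square add_divide_distrib diff_divide_distrib)
    ultimately show ?thesis using W[OF G] by linarith
  qed
  \<comment> \<open>The closed form belongs to the infinite sum over \<open>v\<close>; the freedom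
    to take \<open>G\<close> arbitrarily large permits the passage to it.\<close>
  have lim: "S0 \<longlonglongrightarrow> (\<Sum>k=1..K. exp (- (x * real k)) / (1 - exp (- (x * real k)))\<^sup>2)"
    unfolding S0_def using x0 by (intro tendsto_sum tendsto_sum_mult_exp_neg) auto
  have "(\<lambda>G. S0 G + A / real n * (1 / (16 * x ^ 3)) - x / real n * (192 / x ^ 4))
     \<longlonglongrightarrow> (\<Sum>k=1..K. exp (- (x * real k)) / (1 - exp (- (x * real k)))\<^sup>2) + A / real n * (1 / (16 * x ^ 3)) - x / real n * (192 / x ^ 4)"
    by (intro tendsto_intros lim)
  then have main: "(\<Sum>k=1..K. exp (- (x * real k)) / (1 - exp (- (x * real k)))\<^sup>2) + A / real n * (1 / (16 * x ^ 3)) - x / real n * (192 / x ^ 4) \<le> W"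
    using le by (intro LIMSEQ_le_const2) auto
  have "real n - 3 / x \<le> (\<Sum>k=1..K. exp (- (x * real k)) / (1 - exp (- (x * real k)))\<^sup>2)"
  proof -
    have xx: "1 / x\<^sup>2 * (pi\<^sup>2 / 6) = real n"
      using n by (simp add: x_def hr_rate_sq)
    have "1 / real K \<le> 2 * x" using K x0 by (simp add: field_simps)
    then have "1 / x\<^sup>2 * (1 / real K) \<le> 1 / x\<^sup>2 * (2 * x)" by (intro mult_left_mono) auto
    also have "\<dots> = 2 / x" using x0 by (simp add: power2_eq_square)
    finally have "real n - 3 / x \<le> 1 / x\<^sup>2 * (pi\<^sup>2 / 6 - 1 / real K) - real K"
      unfolding right_diff_distrib xx using K by linarith
    also have "\<dots> \<le> 1 / x\<^sup>2 * (\<Sum>k=1..K. 1 / (real k)\<^sup>2) - real K"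
      using K by (intro diff_right_mono mult_left_mono sum_inverse_squares_ge) auto
    also have "\<dots> = (\<Sum>k=1..K. 1 / (x * real k)\<^sup>2 - 1)"
      by (simp add: sum_distrib_left sum_subtractf power_mult_distrib)
    also have "\<dots> \<le> (\<Sum>k=1..K. exp (- (x * real k)) / (1 - exp (- (x * real k)))\<^sup>2)"
    proof (intro sum_mono exp_neg_quotient_ge)
      fix k assume k: "k \<in> {1..K}"
      have "real k \<le> 1 / x" using k K(2) order_trans[of "real k" "real K" "1 / x"] by simp
      then show "x * real k \<le> 1" using x0 by (simp add: field_simps)
    qed (use x0 in auto)
    finally show ?thesis .
  qed
  moreover have "3 / x \<le> A / real n * (1 / (16 * x ^ 3)) - x / real n * (192 / x ^ 4)"
  proof -
    have "real n * x\<^sup>2 = pi\<^sup>2 / 6" using n by (simp add: x_def hr_rate_sq)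
    moreover have "pi\<^sup>2 \<le> (16 / 5)\<^sup>2" using pi_less_4 pi_approx(2) by (intro power_mono) auto
    ultimately have nx: "real n * x\<^sup>2 \<le> 2" by (simp add: power2_eq_square)
    \<comment> \<open>Here 3200/16 - 192 = 8, whereas the left side is at most 6.\<close>
    have "3 * (real n * x\<^sup>2) \<le> A / 16 - 192" using A nx by linarith
    then have "3 \<le> (A / 16 - 192) / (real n * x\<^sup>2)" using n x0 by (simp add: pos_le_divide_eq)
    then have "3 / x \<le> (A / 16 - 192) / (real n * x\<^sup>2) / x" using x0 by (intro divide_right_mono) auto
    also have "\<dots> = A / real n * (1 / (16 * x ^ 3)) - x / real n * (192 / x ^ 4)"
      using n x0 by (simp add: field_simps eval_nat_numeral)
    finally show ?thesis .
  qed
  ultimately show ?thesis using main by linarith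
qed

text \<open>Induction with the comparison function \<open>\<phi>\<close>. By the recurrence, the
  claim for smaller arguments gives \<open>n * nparts n\<close> at least \<open>a * \<phi> n\<close>
  times the weighted sum, and that sum is at least \<open>n\<close>.\<close>

theorem nparts_lower:
  "\<exists>A a. a > 0 \<and> (\<forall>n>0. a * (exp (hr_const * sqrt (real n)) / real n ^ A) \<le> real (nparts n))"
proof -
  define A :: nat where "A = 3200"
  have A: "3200 \<le> real A" by (simp add: A_def)
  define \<phi> where "\<phi> = (\<lambda>n. exp (hr_const * sqrt (real n)) / real n ^ A)"
  have "eventually (\<lambda>n::nat. hr_const / (2 * sqrt (real n)) \<le> 1 / 2) sequentially"
    unfolding hr_const_def by real_asymp
  moreover have "eventually (\<lambda>n::nat. 2 / (hr_const / (2 * sqrt (real n))) \<le> real n) sequentially"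
    unfolding hr_const_def by real_asymp
  moreover have "eventually (\<lambda>n::nat. hr_const / (2 * sqrt (real n)) * real n \<ge> 3201) sequentially"
    unfolding hr_const_def by real_asymp
  ultimately have "eventually (\<lambda>n::nat. hr_rate n \<le> 1 / 2 \<and> 2 / hr_rate n \<le> real n \<and> real A + 1 \<le> hr_rate n * real n) sequentially"
    unfolding hr_rate_def A_def by eventually_elim simp
  then obtain n0 where n0: "\<And>n. n \<ge> n0 \<Longrightarrow> hr_rate n \<le> 1 / 2 \<and> 2 / hr_rate n \<le> real n \<and> real A + 1 \<le> hr_rate n * real n"
    by (auto simp: eventually_sequentially)
  \<comment> \<open>Below \<open>n0\<close> the claim becomes trivial: there
    \<open>a * \<phi> n\<close> is at most 1.\<close>
  define a where "a = exp (- (hr_const * sqrt (real n0)))"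
  have a: "a > 0" by (simp add: a_def)
  have "a * \<phi> n \<le> real (nparts n)" if "n > 0" for n
    using that
  proof (induction n rule: less_induct)
    case (less n)
    show ?case
    proof (cases "n < n0")
      case True
      have "\<phi> n \<le> exp (hr_const * sqrt (real n)) / 1"
        unfolding \<phi>_def using less.prems by (intro divide_left_mono) auto
      also have "\<dots> \<le> exp (hr_const * sqrt (real n0))"
        using True hr_const_pos by simp
      finally have "a * \<phi> n \<le> a * exp (hr_const * sqrt (real n0))"
        using a by (intro mult_left_mono) auto
      also have "\<dots> = 1" by (simp add: a_def flip: exp_add)
      also have "1 \<le> real (nparts n)" using nparts_pos[of n] by simp
      finally show ?thesis .
    next
      case False
      define x where "x = hr_rate n"
      have x: "x \<le> 1 / 2" "2 / x \<le> real n" "real A + 1 \<le> x * real n"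
        using n0[of n] False by (auto simp: x_def)
      have x0: "x > 0" using less.prems by (simp add: x_def hr_rate_pos)
      have ph: "\<phi> n > 0" using less.prems by (simp add: \<phi>_def)
      define T where "T = (\<lambda>v k. real v * (exp (- (x * real (k * v))) * (1 + real (k * v) / real n * (real A - x * real (k * v)))))"
      have T_neg: "T v k \<le> 0" if "n \<le> k * v" for v k
      proof -
        have le: "real n \<le> real (k * v)" using that by (simp only: of_nat_le_iff)
        then have "x * real n \<le> x * real (k * v)" using x0 by (intro mult_left_mono) auto
        then have "real A - x * real (k * v) \<le> - 1" using x(3) by linarith
        moreover have "1 \<le> real (k * v) / real n" using le less.prems by simp
        moreover have "real (k * v) / real n * (real A - x * real (k * v)) \<le> real (k * v) / real n * (- 1)"
          using \<open>real A - x * real (k * v) \<le> - 1\<close> by (intro mult_left_mono) auto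
        ultimately have "1 + real (k * v) / real n * (real A - x * real (k * v)) \<le> 0" by linarith
        then show ?thesis unfolding T_def
          by (intro mult_nonneg_nonpos) auto
      qed
      have "real n \<le> real n * real (nparts n) / (a * \<phi> n)"
      proof (rule weighted_divisor_sum_ge[OF less.prems x_def x(1,2) A])
        fix G assume G: "n \<le> G"
        have "(\<Sum>v=1..G. \<Sum>k=1..G. T v k) \<le> (\<Sum>v=1..G. \<Sum>k=1..G. if k * v < n then T v k else 0)"
          using T_neg by (intro sum_mono) auto
        also have "\<dots> = (\<Sum>v=1..n. \<Sum>k=1..n. if k * v < n then T v k else 0)"
        proof -
          have zero: "(if k * v < n then T v k else 0) = 0" if "n < k \<or> n < v" "0 < v" "0 < k" for v k
          proof -
            have "1 * v \<le> k * v" "k * 1 \<le> k * v"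
              using that by (intro mult_le_mono; simp)+
            then have "\<not> k * v < n" using that(1) by linarith
            then show ?thesis by simp
          qed
          have "(\<Sum>v=1..G. \<Sum>k=1..G. if k * v < n then T v k else 0) = (\<Sum>v=1..G. \<Sum>k=1..n. if k * v < n then T v k else 0)"
          proof (rule sum.cong[OF refl], rule sum.mono_neutral_right)
            fix v assume "v \<in> {1..G}"
            then show "\<forall>k\<in>{1..G} - {1..n}. (if k * v < n then T v k else 0) = 0"
              by (intro ballI zero) auto
          qed (use G in auto)
          also have "\<dots> = (\<Sum>v=1..n. \<Sum>k=1..n. if k * v < n then T v k else 0)"
          proof (rule sum.mono_neutral_right)
            show "\<forall>v\<in>{1..G} - {1..n}. (\<Sum>k=1..n. if k * v < n then T v k else 0) = 0"
              by (intro ballI sum.neutral zero) auto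
          qed (use G in auto)
          finally show ?thesis .
        qed
        also have "a * \<phi> n * \<dots> \<le> real (n * nparts n)"
          unfolding nparts_recurrence sum_distrib_left of_nat_sum
        proof (intro sum_mono)
          fix v k assume vk: "v \<in> {1..n}" "k \<in> {1..n}"
          show "a * \<phi> n * (if k * v < n then T v k else 0) \<le> real (if k * v \<le> n then v * nparts (n - k * v) else 0)"
          proof (cases "k * v < n")
            case True
            have kv: "0 < k * v" using vk by simp
            have "\<phi> n * (exp (- (x * real (k * v))) * (1 + real (k * v) / real n * (real A - x * real (k * v)))) \<le> \<phi> (n - k * v)"
              unfolding \<phi>_def x_def using exp_sqrt_over_power_diff_ge[OF True less.prems, of A] by simp
            then have "a * (\<phi> n * (exp (- (x * real (k * v))) * (1 + real (k * v) / real n * (real A - x * real (k * v))))) \<le> a * \<phi> (n - k * v)"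
              using a by (intro mult_left_mono) auto
            also have "\<dots> \<le> real (nparts (n - k * v))"
              using less.IH[of "n - k * v"] True kv less.prems by simp
            finally have "real v * (a * (\<phi> n * (exp (- (x * real (k * v))) * (1 + real (k * v) / real n * (real A - x * real (k * v))))))
               \<le> real v * real (nparts (n - k * v))"
              by (intro mult_left_mono) auto
            then show ?thesis using True by (simp add: T_def mult_ac)
          qed simp
        qed
        finally have "a * \<phi> n * (\<Sum>v=1..G. \<Sum>k=1..G. T v k) \<le> real (n * nparts n)"
          using a ph by (simp add: mult_left_mono)
        then show "(\<Sum>v=1..G. \<Sum>k=1..G. real v * (exp (- (x * real (k * v))) * (1 + real (k * v) / real n * (real A - x * real (k * v))))) \<le> real n * real (nparts n) / (a * \<phi> n)"
          using a ph by (simp add: T_def pos_le_divide_eq mult_ac)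
      qed
      then show ?thesis using a ph less.prems by (simp add: field_simps)
    qed
  qed
  then show ?thesis using a unfolding \<phi>_def by blast
qed

section \<open>Durfee codes and the Erdos--Gallai inequalities\<close>

text \<open>
  In the code \<open>(d, g, h)\<close> of a partition, \<open>d\<close> is the side of the Durfee square, \<open>g j\<close> counts the
  columns of height \<open>j\<close> to the right of the square and \<open>h j\<close> the rows of length \<open>j\<close> below it.
\<close>
definition codes :: "nat \<Rightarrow> (nat \<times> (nat \<Rightarrow> nat) \<times> (nat \<Rightarrow> nat)) set" where
  "codes n = {(d, g, h). (\<forall>j. j \<notin> {1..d} \<longrightarrow> g j = 0 \<and> h j = 0) \<and> d * d + (\<Sum>j=1..d. j * (g j + h j)) = n}"

definition runs :: "(nat \<Rightarrow> nat) \<Rightarrow> nat list \<Rightarrow> nat list" where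
  "runs h js = concat (map (\<lambda>j. replicate (h j) j) js)"

text \<open>Rows are numbered from 0, so row \<open>i\<close> of the square is prolonged by the
  columns of height at least \<open>Suc i\<close>. The rows below are generated in increasing order
  and then reversed.\<close>

fun decode :: "nat \<times> (nat \<Rightarrow> nat) \<times> (nat \<Rightarrow> nat) \<Rightarrow> nat list" where
  "decode (d, g, h) = map (\<lambda>i. d + (\<Sum>j=Suc i..d. g j)) [0..<d] @ rev (runs h [1..<Suc d])"

text \<open>Cells counted by rows and by columns: a column of height \<open>j\<close> meets
  \<open>min j k\<close> of the first \<open>k\<close> rows.\<close>

lemma sum_tail_sums:
  fixes g :: "nat \<Rightarrow> nat"
  assumes "k \<le> d"
  shows "(\<Sum>i<k. \<Sum>j=Suc i..d. g j) = (\<Sum>j=1..d. min j k * g j)"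
proof -
  have "(\<Sum>i<k. \<Sum>j=Suc i..d. g j) = (\<Sum>i<k. \<Sum>j=1..d. if i < j then g j else 0)"
    by (intro sum.cong refl sum.mono_neutral_cong_left) auto
  also have "\<dots> = (\<Sum>j=1..d. \<Sum>i<k. if i < j then g j else 0)"
    by (rule sum.swap)
  also have "\<dots> = (\<Sum>j=1..d. min j k * g j)"
  proof (intro sum.cong refl)
    fix j
    have "(\<Sum>i<k. if i < j then g j else 0) = (\<Sum>i<min j k. g j)"
      by (intro sum.mono_neutral_cong_right) auto
    then show "(\<Sum>i<k. if i < j then g j else 0) = min j k * g j" by simp
  qed
  finally show ?thesis .
qed

lemma sum_list_map_runs: "sum_list (map f (runs h js)) = sum_list (map (\<lambda>j. h j * f j) js)" for f :: "nat \<Rightarrow> nat"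
  by (induction js) (auto simp: runs_def sum_list_replicate)

lemma sum_list_upt: "sum_list (map f [1..<Suc d]) = (\<Sum>j=1..d. f j)" for f :: "nat \<Rightarrow> nat"
  by (simp add: interv_sum_list_conv_sum_set_nat atLeastLessThanSuc_atLeastAtMost del: upt_Suc)

lemma sorted_runs: "sorted js \<Longrightarrow> sorted (runs h js)"
  by (induction js) (auto simp: runs_def sorted_append)

lemma set_runs: "set (runs h js) \<subseteq> set js"
  by (auto simp: runs_def)

lemma count_runs: "distinct js \<Longrightarrow> count (mset (runs h js)) v = (if v \<in> set js then h v else 0)"
  by (induction js) (auto simp: runs_def)

lemma length_decode_ge: "d \<le> length (decode (d, g, h))"
  by simp

lemma decode_nth: "i < d \<Longrightarrow> decode (d, g, h) ! i = d + (\<Sum>j=Suc i..d. g j)"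
  by (simp add: nth_append)

lemma decode_nth_le:
  assumes "d \<le> i" "i < length (decode (d, g, h))"
  shows "decode (d, g, h) ! i \<le> d"
proof -
  have "decode (d, g, h) ! i = rev (runs h [1..<Suc d]) ! (i - d)" "i - d < length (rev (runs h [1..<Suc d]))"
    using assms by (simp_all add: nth_append del: upt_Suc)
  then have "decode (d, g, h) ! i \<in> set (runs h [1..<Suc d])"
    by (metis nth_mem set_rev)
  then show ?thesis using set_runs[of h "[1..<Suc d]"] by (auto simp del: upt_Suc)
qed

text \<open>If the sides differed, the entry at the smaller one would lie inside the larger square,
  hence be large, and below the smaller square, hence be small.\<close>

lemma decode_size_unique:
  assumes "decode (d, g, h) = decode (d', g', h')"
  shows "d \<le> d'"
proof (rule ccontr)
  assume "\<not> d \<le> d'"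
  then have "d' < d" by simp
  then have "d \<le> decode (d, g, h) ! d'" by (simp only: decode_nth le_add1)
  moreover have "decode (d', g', h') ! d' \<le> d'"
  proof (rule decode_nth_le[OF order_refl])
    have "d' < length (decode (d, g, h))"
      using \<open>d' < d\<close> length_decode_ge by (rule less_le_trans)
    then show "d' < length (decode (d', g', h'))" by (simp only: assms)
  qed
  ultimately show False using \<open>d' < d\<close> by (simp only: assms)
qed

lemma inj_on_decode: "inj_on decode (codes n)"
proof
  fix p p' assume p: "p \<in> codes n" "p' \<in> codes n" "decode p = decode p'"
  obtain d g h where P: "p = (d, g, h)" by (cases p) auto
  obtain d' g' h' where P': "p' = (d', g', h')" by (cases p') auto
  have eq: "decode (d, g, h) = decode (d', g', h')" using p P P' by simp
  have d: "d' = d"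
    using decode_size_unique[OF eq] decode_size_unique[OF eq[symmetric]] by simp
  have tails: "(\<Sum>j=Suc i..d. g j) = (\<Sum>j=Suc i..d. g' j)" if "i < d" for i
    using decode_nth[OF that, of g h] decode_nth[OF that, of g' h'] eq unfolding d by (simp del: decode.simps)
  have "g j = g' j" for j
  proof (cases "j \<in> {1..d}")
    case True
    then obtain i where i: "j = Suc i" "i < d" by (cases j) auto
    have "(\<Sum>j=Suc (Suc i)..d. g j) = (\<Sum>j=Suc (Suc i)..d. g' j)"
      using tails[of "Suc i"] i by (cases "Suc i < d") auto
    moreover have "(\<Sum>j=Suc i..d. f j) = f (Suc i) + (\<Sum>j=Suc (Suc i)..d. f j)" for f :: "nat \<Rightarrow> nat"
      using i by (intro sum.atLeast_Suc_atMost) auto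
    ultimately show ?thesis using tails[OF i(2)] i by simp
  qed (use p P P' d in \<open>auto simp: codes_def\<close>)
  moreover have "h j = h' j" for j
  proof (cases "j \<in> {1..d}")
    case True
    have "drop d (decode (d, g, h)) = drop d (decode (d, g', h'))" using eq d by simp
    then have "runs h [1..<Suc d] = runs h' [1..<Suc d]" by (simp del: upt_Suc)
    then show ?thesis
      using count_runs[of "[1..<Suc d]" h j] count_runs[of "[1..<Suc d]" h' j] True by (simp del: upt_Suc)
  qed (use p P P' d in \<open>auto simp: codes_def\<close>)
  ultimately show "p = p'" using P P' d by (simp add: fun_eq_iff)
qed

lemma sum_list_decode: "sum_list (decode (d, g, h)) = d * d + (\<Sum>j=1..d. j * (g j + h j))"
proof -
  have "sum_list (map (\<lambda>i. d + (\<Sum>j=Suc i..d. g j)) [0..<d]) = (\<Sum>i<d. d + (\<Sum>j=Suc i..d. g j))"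
    by (simp add: interv_sum_list_conv_sum_set_nat lessThan_atLeast0)
  also have "\<dots> = d * d + (\<Sum>j=1..d. min j d * g j)"
    by (simp only: sum.distrib sum_tail_sums[OF order_refl]) simp
  also have "(\<Sum>j=1..d. min j d * g j) = (\<Sum>j=1..d. j * g j)"
    by (intro sum.cong) auto
  finally have "sum_list (map (\<lambda>i. d + (\<Sum>j=Suc i..d. g j)) [0..<d]) = d * d + (\<Sum>j=1..d. j * g j)" .
  moreover have "sum_list (runs h [1..<Suc d]) = (\<Sum>j=1..d. j * h j)"
    using sum_list_map_runs[of "\<lambda>x. x" h "[1..<Suc d]"] by (simp only: sum_list_upt list.map_ident mult.commute)
  ultimately show ?thesis by (simp add: distrib_left sum.distrib sum_list_rev del: upt_Suc)
qed

lemma decode_in_partitions_of: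
  assumes "(d, g, h) \<in> codes n"
  shows "decode (d, g, h) \<in> partitions_of n"
proof -
  define A where "A = map (\<lambda>i. d + (\<Sum>j=Suc i..d. g j)) [0..<d]"
  define B where "B = runs h [1..<Suc d]"
  have B: "set B \<subseteq> {1..d}" using set_runs[of h "[1..<Suc d]"] by (auto simp: B_def simp del: upt_Suc)
  have "sorted_wrt (\<ge>) A"
    unfolding A_def by (auto simp: sorted_wrt_iff_nth_less intro!: sum_mono2)
  moreover have "sorted_wrt (\<ge>) (rev B)"
    by (simp add: B_def sorted_wrt_rev sorted_runs del: upt_Suc)
  moreover have "a \<ge> b" if "a \<in> set A" "b \<in> set B" for a b
    using that B by (force simp: A_def)
  moreover have "0 < x" if "x \<in> set A \<union> set B" for x
    using that B by (force simp: A_def)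
  moreover have "sum_list (decode (d, g, h)) = n"
    unfolding sum_list_decode using assms by (simp add: codes_def)
  moreover have "decode (d, g, h) = A @ rev B" by (simp add: A_def B_def)
  ultimately show ?thesis
    by (simp add: partitions_of_def sorted_wrt_append del: decode.simps)
qed

lemma partitions_of_subset_decode: "partitions_of n \<subseteq> decode ` codes n"
proof
  fix xs assume xs: "xs \<in> partitions_of n"
  have anti: "xs ! j \<le> xs ! i" if "i \<le> j" "j < length xs" for i j
    using xs that by (cases "i = j") (auto simp: partitions_of_def sorted_wrt_iff_nth_less)
  have pos: "0 < x" if "x \<in> set xs" for x
    using xs that by (auto simp: partitions_of_def)
  \<comment> \<open>With rows numbered from 0, the Durfee side is the first index whose entry does
    not exceed it.\<close>
  define stop where "stop = (\<lambda>d. \<not> (d < length xs \<and> d < xs ! d))"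
  define d where "d = (LEAST d. stop d)"
  have "stop (length xs)" by (simp add: stop_def)
  then have d: "stop d" unfolding d_def by (rule LeastI)
  have d': "i < length xs \<and> i < xs ! i" if "i < d" for i
    using not_less_Least[of i stop] that by (auto simp: d_def stop_def)
  have len: "d \<le> length xs" using d'[of "d - 1"] by (cases d) auto
  have big: "d \<le> xs ! i" if "i < d" for i
    using d'[of "d - 1"] anti[of i "d - 1"] that by fastforce
  have small: "x \<le> d" if x: "x \<in> set (drop d xs)" for x
  proof -
    obtain i where i: "i < length xs - d" "x = xs ! (d + i)"
      using x by (auto simp: in_set_conv_nth)
    then have "xs ! (d + i) \<le> xs ! d" by (intro anti) auto
    moreover have "xs ! d \<le> d" using d i by (auto simp: stop_def)
    ultimately show ?thesis using i by simp
  qed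
  \<comment> \<open>Row lengths with the value \<open>d\<close> from row \<open>d\<close> on: the
    last difference then measures the columns of full height \<open>d\<close> to the right of the
    square.\<close>
  define f where "f = (\<lambda>j. if j < d then xs ! j else d)"
  define g where "g = (\<lambda>j. if j \<in> {1..d} then f (j - 1) - f j else 0)"
  define h where "h = (\<lambda>j. if j \<in> {1..d} then count (mset (drop d xs)) j else 0)"
  have tail: "d + (\<Sum>j=Suc i..d. g j) = f i" if "i \<le> d" for i
    using that
  proof (induction i rule: inc_induct)
    case base
    then show ?case by (simp add: f_def)
  next
    case (step i)
    have "(\<Sum>j=Suc i..d. g j) = g (Suc i) + (\<Sum>j=Suc (Suc i)..d. g j)"
      using step by (intro sum.atLeast_Suc_atMost) auto
    moreover have "f (Suc i) \<le> f i"
      using step len by (auto simp: f_def intro: anti big)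
    ultimately show ?case using step by (simp add: g_def)
  qed
  have "map (\<lambda>i. d + (\<Sum>j=Suc i..d. g j)) [0..<d] = take d xs"
    using len tail by (intro nth_equalityI) (auto simp: f_def)
  moreover have "runs h [1..<Suc d] = rev (drop d xs)"
  proof -
    have "mset (runs h [1..<Suc d]) = mset (rev (drop d xs))"
    proof (rule multiset_eqI)
      fix v
      have "count (mset (drop d xs)) v = 0" if "v \<notin> {1..d}"
      proof -
        have "v \<notin> set (drop d xs)"
          using that small[of v] pos[of v] in_set_dropD[of v d xs] by auto
        then show ?thesis by (simp add: count_mset_0_iff)
      qed
      then show "count (mset (runs h [1..<Suc d])) v = count (mset (rev (drop d xs))) v"
        by (subst count_runs) (auto simp: h_def)
    qed
    moreover have "sorted (rev (drop d xs))"
      using xs by (auto simp: partitions_of_def sorted_wrt_rev sorted_wrt_drop)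
    ultimately show ?thesis
      using sorted_runs[of "[1..<Suc d]" h] properties_for_sort sort_key_id_if_sorted
      by (metis sorted_upt)
  qed
  ultimately have dec: "decode (d, g, h) = xs" by (simp del: upt_Suc)
  moreover have "(d, g, h) \<in> codes n"
    using sum_list_decode[of d g h] xs unfolding dec codes_def by (auto simp: partitions_of_def g_def h_def)
  ultimately show "xs \<in> decode ` codes n" by (metis image_eqI)
qed

lemma bij_betw_decode: "bij_betw decode (codes n) (partitions_of n)"
  unfolding bij_betw_def using inj_on_decode partitions_of_subset_decode decode_in_partitions_of by fastforce

lemma card_codes: "card (codes n) = nparts n"
  using bij_betw_same_card[OF bij_betw_decode] by (simp add: nparts_def)

lemma finite_codes [simp]: "finite (codes n)"
  using bij_betw_finite[OF bij_betw_decode] finite_partitions_of by blast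

section \<open>The necessity half of the Erdos-Gallai theorem\<close>

lemma sum_degrees_le:
  fixes G :: "'a pair_pre_digraph"
  assumes "pair_graph G" "A \<subseteq> pverts G"
  defines "deg \<equiv> out_degree (with_proj G)"
  shows "(\<Sum>v\<in>A. deg v) \<le> card A * (card A - 1) + (\<Sum>v\<in>pverts G - A. min (deg v) (card A))"
proof -
  interpret pair_graph G by fact
  have fin: "finite (pverts G)" "finite (parcs G)" by (simp_all add: pair_finite_verts pair_finite_arcs)
  have finA: "finite A" using assms fin finite_subset by blast
  have deg: "deg v = card {e \<in> parcs G. fst e = v}" for v
    unfolding deg_def out_degree_def out_arcs_def by simp
  \<comment> \<open>The arcs leaving \<open>A\<close> are split by their head: inside
    \<open>A\<close> there are at most |A|(|A| - 1), as loops are excluded, and the others are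
    grouped by the vertex outside \<open>A\<close> that they reach.\<close>
  have "(\<Sum>v\<in>A. deg v) = card (\<Union>v\<in>A. {e \<in> parcs G. fst e = v})"
    unfolding deg using finA fin by (subst card_UN_disjoint) auto
  also have "(\<Union>v\<in>A. {e \<in> parcs G. fst e = v}) = {e \<in> parcs G. fst e \<in> A \<and> snd e \<in> A} \<union> (\<Union>v\<in>pverts G - A. {e \<in> parcs G. fst e \<in> A \<and> snd e = v})"
    by (auto dest: in_arcsD2)
  also have "card \<dots> \<le> card {e \<in> parcs G. fst e \<in> A \<and> snd e \<in> A} + card (\<Union>v\<in>pverts G - A. {e \<in> parcs G. fst e \<in> A \<and> snd e = v})"
    by (rule card_Un_le)
  also have "card {e \<in> parcs G. fst e \<in> A \<and> snd e \<in> A} \<le> card (SIGMA u:A. A - {u})"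
    using finA by (intro card_mono) (auto dest: no_loops')
  also have "\<dots> = card A * (card A - 1)"
    using finA by (subst card_SigmaI) auto
  also have "card (\<Union>v\<in>pverts G - A. {e \<in> parcs G. fst e \<in> A \<and> snd e = v}) \<le> (\<Sum>v\<in>pverts G - A. card {e \<in> parcs G. fst e \<in> A \<and> snd e = v})"
    using fin by (intro card_UN_le) auto
  also have "\<dots> \<le> (\<Sum>v\<in>pverts G - A. min (deg v) (card A))"
  proof (intro sum_mono min.boundedI)
    fix v
    \<comment> \<open>Reversal of arcs: by symmetry the arcs into \<open>v\<close> inject into those
      out of \<open>v\<close>.\<close>
    have "card {e \<in> parcs G. fst e \<in> A \<and> snd e = v} \<le> card {e \<in> parcs G. fst e = v}"
    proof (rule card_inj_on_le[where f = "\<lambda>e. (snd e, fst e)"])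
      show "(\<lambda>e. (snd e, fst e)) ` {e \<in> parcs G. fst e \<in> A \<and> snd e = v} \<subseteq> {e \<in> parcs G. fst e = v}"
        by (auto dest: arcs_symmetric)
    qed (use fin in \<open>auto simp: inj_on_def prod_eq_iff\<close>)
    then show "card {e \<in> parcs G. fst e \<in> A \<and> snd e = v} \<le> deg v" by (simp add: deg)
    show "card {e \<in> parcs G. fst e \<in> A \<and> snd e = v} \<le> card A"
      by (rule card_inj_on_le[where f = fst]) (use finA in \<open>auto simp: inj_on_def\<close>)
  qed
  finally show ?thesis by simp
qed

lemma image_mset_eq_mset_obtain:
  assumes "image_mset f M = mset xs"
  obtains ys where "mset ys = M" "map f ys = xs"
  using assms
proof (induction xs arbitrary: M thesis)
  case (Cons x xs)
  then obtain M' y where "M = add_mset y M'" "f y = x" "image_mset f M' = mset xs"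
    by (auto dest: msed_map_invR)
  moreover from this obtain ys where "mset ys = M'" "map f ys = xs" using Cons.IH by blast
  ultimately show ?case using Cons.prems(1)[of "y # ys"] by simp
qed simp

lemma graphical_erdos_gallai:
  assumes "graphical xs" "k \<le> length xs"
  shows "sum_list (take k xs) \<le> k * (k - 1) + sum_list (map (\<lambda>x. min x k) (drop k xs))"
proof -
  obtain G :: "nat pair_pre_digraph" where G: "pair_graph G" "degree_sequence G = xs"
    using assms by (auto simp: graphical_def)
  interpret pair_graph G by fact
  define deg where "deg = out_degree (with_proj G)"
  have "image_mset deg (mset_set (pverts G)) = mset xs"
    unfolding G(2)[symmetric] degree_sequence_def deg_def by simp
  then obtain vs where vs: "mset vs = mset_set (pverts G)" "map deg vs = xs"
    by (rule image_mset_eq_mset_obtain)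
  have set: "set vs = pverts G"
    using vs(1) pair_finite_verts by (metis finite_set_mset_mset_set set_mset_mset)
  have "distinct vs"
    using vs(1) by (metis count_mset_set' distinct_count_atmost_1 set le_zero_eq linorder_le_cases not_one_le_zero count_mset_set(1) List.finite_set)
  then have dist: "distinct (take k vs)" "distinct (drop k vs)" "set (take k vs) \<inter> set (drop k vs) = {}"
    by (simp_all add: set_take_disj_set_drop_if_distinct)
  have un: "pverts G = set (take k vs) \<union> set (drop k vs)"
    unfolding set[symmetric] by (metis append_take_drop_id set_append)
  have len: "card (set (take k vs)) = k"
    using assms(2) vs(2) dist by (auto simp: distinct_card)
  have "(\<Sum>v\<in>set (take k vs). deg v) \<le> k * (k - 1) + (\<Sum>v\<in>pverts G - set (take k vs). min (deg v) k)"
    using sum_degrees_le[OF G(1), of "set (take k vs)"] un len by (simp add: deg_def)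
  also have "pverts G - set (take k vs) = set (drop k vs)" using un dist by blast
  finally show ?thesis
    using dist by (simp add: sum_list_distinct_conv_sum_set take_map drop_map comp_def flip: vs(2))
qed

text \<open>The first \<open>k\<close> rows contribute kd plus the cells right of the square; the
  remaining d - k rows of the square are longer than the cut-off and give k each. The difference kd
  - k(k-1) - (d-k)k is the surplus \<open>k\<close> on the left.\<close>

lemma graphical_decode:
  assumes "graphical (decode (d, g, h))" "0 < k" "k \<le> d"
  shows "k + (\<Sum>j=1..d. min j k * g j) \<le> (\<Sum>j=1..d. min j k * h j)"
proof -
  define A where "A = (\<lambda>i. d + (\<Sum>j=Suc i..d. g j))"
  have dec: "decode (d, g, h) = map A [0..<d] @ rev (runs h [1..<Suc d])" by (simp add: A_def)
  have "sum_list (take k (decode (d, g, h))) = sum_list (map A [0..<k])"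
    unfolding dec using assms by (simp add: take_map del: upt_Suc)
  also have "\<dots> = (\<Sum>i<k. A i)"
    by (simp add: interv_sum_list_conv_sum_set_nat lessThan_atLeast0)
  also have "\<dots> = k * d + (\<Sum>j=1..d. min j k * g j)"
    unfolding A_def by (simp only: sum.distrib sum_tail_sums[OF assms(3)]) simp
  finally have 1: "sum_list (take k (decode (d, g, h))) = k * d + (\<Sum>j=1..d. min j k * g j)" .
  have "sum_list (map (\<lambda>x. min x k) (drop k (decode (d, g, h))))
     = sum_list (map (\<lambda>i. min (A i) k) [k..<d]) + sum_list (map (\<lambda>x. min x k) (runs h [1..<Suc d]))"
    unfolding dec using assms by (simp add: drop_map rev_map[symmetric] sum_list_rev comp_def del: upt_Suc)
  also have "map (\<lambda>i. min (A i) k) [k..<d] = map (\<lambda>i. k) [k..<d]"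
    using assms by (auto simp: A_def)
  also have "sum_list (map (\<lambda>x. min x k) (runs h [1..<Suc d])) = (\<Sum>j=1..d. min j k * h j)"
    unfolding sum_list_map_runs sum_list_upt by (simp add: mult.commute)
  finally have 2: "sum_list (map (\<lambda>x. min x k) (drop k (decode (d, g, h)))) = (d - k) * k + (\<Sum>j=1..d. min j k * h j)"
    by (simp add: sum_list_triv)
  have "k * d + (\<Sum>j=1..d. min j k * g j) \<le> k * (k - 1) + ((d - k) * k + (\<Sum>j=1..d. min j k * h j))"
    using graphical_erdos_gallai[OF assms(1), of k] assms(3) length_decode_ge[of d g h] 1 2 by linarith
  moreover obtain e where "d = k + e" using assms(3) le_Suc_ex by blast
  moreover obtain k' where "k = Suc k'" using assms(2) gr0_implies_Suc by blast
  ultimately show ?thesis by (simp add: algebra_simps)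
qed

section \<open>A Littlewood--Offord bound for uniform variables\<close>

text \<open>Points are extended by 0 outside \<open>J\<close>, so that points over disjoint index
  sets are glued by pointwise addition.\<close>

definition grid :: "'i set \<Rightarrow> ('i \<Rightarrow> nat) \<Rightarrow> ('i \<Rightarrow> nat) set" where
  "grid J s = {g. (\<forall>j\<in>J. g j \<le> s j) \<and> (\<forall>j. j \<notin> J \<longrightarrow> g j = 0)}"

definition restrict0 :: "'i set \<Rightarrow> ('i \<Rightarrow> nat) \<Rightarrow> 'i \<Rightarrow> nat" where
  "restrict0 J g = (\<lambda>j. if j \<in> J then g j else 0)"

lemma grid_empty [simp]: "grid {} s = {\<lambda>_. 0}"
  by (auto simp: grid_def)

lemma bij_betw_grid_Un:
  assumes "A \<inter> C = {}"
  shows "bij_betw (\<lambda>(g, h). \<lambda>j. g j + h j) (grid A s \<times> grid C s) (grid (A \<union> C) s)"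
proof (rule bij_betw_byWitness[where f' = "\<lambda>g. (restrict0 A g, restrict0 C g)"])
  show "\<forall>p\<in>grid A s \<times> grid C s. (restrict0 A (case p of (g, h) \<Rightarrow> \<lambda>j. g j + h j), restrict0 C (case p of (g, h) \<Rightarrow> \<lambda>j. g j + h j)) = p"
    using assms by (auto simp: grid_def restrict0_def fun_eq_iff)
qed (use assms in \<open>auto simp: grid_def restrict0_def fun_eq_iff\<close>)

lemma grid_singleton: "grid {j} s = (\<lambda>a. (\<lambda>_. 0)(j := a)) ` {..s j}"
proof
  show "grid {j} s \<subseteq> (\<lambda>a. (\<lambda>_. 0)(j := a)) ` {..s j}"
  proof
    fix g assume "g \<in> grid {j} s"
    then have "g = (\<lambda>_. 0)(j := g j)" "g j \<le> s j" by (auto simp: grid_def fun_eq_iff)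
    then show "g \<in> (\<lambda>a. (\<lambda>_. 0)(j := a)) ` {..s j}" by blast
  qed
qed (auto simp: grid_def)

lemma sum_grid_Un:
  assumes "A \<inter> C = {}"
  shows "(\<Sum>g\<in>grid (A \<union> C) s. F g) = (\<Sum>g\<in>grid A s. \<Sum>h\<in>grid C s. F (\<lambda>j. g j + h j))"
  using sum.reindex_bij_betw[OF bij_betw_grid_Un[OF assms], of F s]
  by (simp add: sum.cartesian_product case_prod_unfold)

lemma sum_grid_insert:
  assumes "j \<notin> J"
  shows "(\<Sum>g\<in>grid (insert j J) s. F g) = (\<Sum>a\<le>s j. \<Sum>g\<in>grid J s. F (g(j := a)))"
proof -
  have inj: "inj_on (\<lambda>a. (\<lambda>_. 0)(j := a)) {..s j}"
    by (auto simp: inj_on_def fun_eq_iff)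
  have "(\<Sum>g\<in>grid ({j} \<union> J) s. F g) = (\<Sum>a\<le>s j. \<Sum>g\<in>grid J s. F (\<lambda>i. ((\<lambda>_. 0)(j := a)) i + g i))"
    using assms by (subst sum_grid_Un) (auto simp: grid_singleton sum.reindex[OF inj])
  also have "\<dots> = (\<Sum>a\<le>s j. \<Sum>g\<in>grid J s. F (g(j := a)))"
  proof (intro sum.cong refl)
    fix a g assume "g \<in> grid J s"
    then have "(\<lambda>i. ((\<lambda>_. 0)(j := a)) i + g i) = g(j := a)"
      using assms by (auto simp: grid_def fun_eq_iff)
    then show "F (\<lambda>i. ((\<lambda>_. 0)(j := a)) i + g i) = F (g(j := a))" by simp
  qed
  finally show ?thesis by simp
qed

lemma finite_grid [simp]: "finite J \<Longrightarrow> finite (grid J s)"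
proof (induction J rule: finite_induct)
  case (insert j J)
  have "finite (grid {j} s \<times> grid J s)" using insert by (simp add: grid_singleton)
  then have "finite (grid ({j} \<union> J) s)"
    using bij_betw_finite[OF bij_betw_grid_Un[of "{j}" J s]] insert by simp
  then show ?case by simp
qed simp

lemma sum_prod_grid:
  fixes f :: "'i \<Rightarrow> nat \<Rightarrow> 'b::comm_semiring_1"
  assumes "finite J"
  shows "(\<Sum>g\<in>grid J s. \<Prod>j\<in>J. f j (g j)) = (\<Prod>j\<in>J. \<Sum>a\<le>s j. f j a)"
  using assms
proof (induction J rule: finite_induct)
  case (insert j J)
  have "(\<Sum>g\<in>grid (insert j J) s. \<Prod>i\<in>insert j J. f i (g i))
      = (\<Sum>a\<le>s j. \<Sum>g\<in>grid J s. f j a * (\<Prod>i\<in>J. f i ((g(j := a)) i)))"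
    using insert by (simp add: sum_grid_insert)
  also have "\<dots> = (\<Sum>a\<le>s j. \<Sum>g\<in>grid J s. f j a * (\<Prod>i\<in>J. f i (g i)))"
    using insert by (intro sum.cong refl arg_cong2[of _ _ _ _ "(*)"] prod.cong) auto
  also have "\<dots> = (\<Sum>a\<le>s j. f j a) * (\<Prod>j\<in>J. \<Sum>a\<le>s j. f j a)"
    by (simp add: insert sum_distrib_right flip: sum_distrib_left)
  finally show ?case using insert by simp
qed simp

lemma card_grid: "finite J \<Longrightarrow> card (grid J s) = (\<Prod>j\<in>J. s j + 1)"
  using sum_prod_grid[where f = "\<lambda>_ _. 1::nat" and J = J and s = s] by simp

lemma real_card_filter: "finite A \<Longrightarrow> real (card {x \<in> A. P x}) = (\<Sum>x\<in>A. of_bool (P x))"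
  by (simp add: of_bool_def flip: sum.inter_filter)

text \<open>Independence of coordinates as a count: the last block is split off, and the events of
  the other blocks do not see its coordinates.\<close>

lemma card_independent_blocks_le:
  fixes q :: real
  assumes "finite I" "0 \<le> q" "\<And>m. m < M \<Longrightarrow> B m \<subseteq> I" "disjoint_family_on B {..<M}"
    and "\<And>m. m < M \<Longrightarrow> real (card {g \<in> grid (B m) s. Q m g}) \<le> q * real (card (grid (B m) s))"
  shows "real (card {g \<in> grid I s. \<forall>m<M. Q m (restrict0 (B m) g)}) \<le> q ^ M * real (card (grid I s))"
  using assms
proof (induction M arbitrary: I)
  case (Suc M)
  define I' where "I' = I - B M"
  have fin: "finite I'" "finite (B M)" and I: "I = I' \<union> B M" "I' \<inter> B M = {}"
    using Suc.prems finite_subset[of "B M" I] by (auto simp: I'_def)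
  have disj: "B m \<inter> B M = {}" if "m < M" for m
    using Suc.prems(4) that by (auto simp: disjoint_family_on_def)
  have sub: "B m \<subseteq> I'" if "m < M" for m
    using disj[OF that] Suc.prems(3)[of m] that by (auto simp: I'_def)
  have r: "restrict0 (B m) (\<lambda>j. g j + h j) = restrict0 (B m) g" if "h \<in> grid (B M) s" "m < M" for g h m
    using that disj[of m] by (auto simp: restrict0_def grid_def fun_eq_iff)
  have rM: "restrict0 (B M) (\<lambda>j. g j + h j) = h" if "g \<in> grid I' s" "h \<in> grid (B M) s" for g h
    using that I by (auto simp: restrict0_def grid_def fun_eq_iff)
  have "real (card {g \<in> grid I s. \<forall>m<Suc M. Q m (restrict0 (B m) g)})
      = (\<Sum>g\<in>grid I' s. \<Sum>h\<in>grid (B M) s. of_bool (\<forall>m<Suc M. Q m (restrict0 (B m) (\<lambda>j. g j + h j))))"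
    unfolding real_card_filter[OF finite_grid[OF Suc.prems(1)]] unfolding I(1) sum_grid_Un[OF I(2)] ..
  also have "\<dots> = (\<Sum>g\<in>grid I' s. \<Sum>h\<in>grid (B M) s. of_bool (\<forall>m<M. Q m (restrict0 (B m) g)) * of_bool (Q M h))"
  proof (intro sum.cong refl)
    fix g h assume "g \<in> grid I' s" "h \<in> grid (B M) s"
    then show "(of_bool (\<forall>m<Suc M. Q m (restrict0 (B m) (\<lambda>j. g j + h j))) :: real)
      = of_bool (\<forall>m<M. Q m (restrict0 (B m) g)) * of_bool (Q M h)"
      by (simp add: less_Suc_eq all_conj_distrib r rM flip: of_bool_conj)
  qed
  also have "\<dots> = real (card {g \<in> grid I' s. \<forall>m<M. Q m (restrict0 (B m) g)}) * real (card {h \<in> grid (B M) s. Q M h})"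
    unfolding real_card_filter[OF finite_grid[OF fin(1)]] real_card_filter[OF finite_grid[OF fin(2)]]
    by (rule sum_product [symmetric])
  also have "\<dots> \<le> (q ^ M * real (card (grid I' s))) * (q * real (card (grid (B M) s)))"
    using Suc.prems fin sub
    by (intro mult_mono Suc.IH) (auto simp: disjoint_family_on_def)
  also have "real (card (grid I' s)) * real (card (grid (B M) s)) = real (card (grid I s))"
    unfolding I(1) using I(2) fin by (simp add: card_grid prod.union_disjoint)
  then have "(q ^ M * real (card (grid I' s))) * (q * real (card (grid (B M) s))) = q ^ Suc M * real (card (grid I s))"
    by (simp add: mult_ac)
  finally show ?case .
qed simp

section \<open>Sums of the \<open>k\<close> largest binomial coefficients of a row\<close>

definition midbin :: "nat \<Rightarrow> nat \<Rightarrow> nat" where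
  "midbin N k = (\<Sum>i\<le>N. if - int k < 2 * int i - int N \<and> 2 * int i - int N \<le> int k then N choose i else 0)"

lemma midbin_0: "0 < k \<Longrightarrow> midbin 0 k = 1"
  by (simp add: midbin_def)

text \<open>Pascal's rule turns the window from -k (excluded) to k into its two shifts by 1, which
  together cover the same points, with multiplicity, as the windows for \<open>k + 1\<close> and
  \<open>k - 1\<close>. The exchange argument below produces the same two sizes.\<close>

lemma midbin_Suc:
  assumes "0 < k"
  shows "midbin (Suc N) k = midbin N (k + 1) + midbin N (k - 1)"
proof -
  define c where "c = (\<lambda>d i. - int k < 2 * int i + d - int N \<and> 2 * int i + d - int N \<le> int k)"
  have "midbin (Suc N) k = (\<Sum>i\<le>Suc N. if c (-1) i then (Suc N choose i) else 0)"
    unfolding midbin_def c_def by (intro sum.cong refl if_cong) auto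
  also have "\<dots> = (if c (-1) 0 then 1 else 0) + (\<Sum>i\<le>N. if c (-1) (Suc i) then (N choose Suc i) + (N choose i) else 0)"
    by (subst sum.atMost_Suc_shift) (simp, intro sum.cong refl, simp)
  also have "(\<Sum>i\<le>N. if c (-1) (Suc i) then (N choose Suc i) + (N choose i) else 0)
     = (\<Sum>i\<le>N. if c (-1) (Suc i) then N choose Suc i else 0) + (\<Sum>i\<le>N. if c (-1) (Suc i) then N choose i else 0)"
    by (subst sum.distrib[symmetric]) (intro sum.cong refl, simp)
  also have "(if c (-1) 0 then 1 else 0) + ((\<Sum>i\<le>N. if c (-1) (Suc i) then N choose Suc i else 0) + (\<Sum>i\<le>N. if c (-1) (Suc i) then N choose i else 0))
     = (\<Sum>i\<le>Suc N. if c (-1) i then N choose i else 0) + (\<Sum>i\<le>N. if c 1 i then N choose i else 0)"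
    unfolding sum.atMost_Suc_shift by (simp add: c_def add.commute)
  also have "(\<Sum>i\<le>Suc N. if c (-1) i then N choose i else 0) = (\<Sum>i\<le>N. if c (-1) i then N choose i else 0)"
    by (simp add: binomial_eq_0)
  also have "\<dots> + (\<Sum>i\<le>N. if c 1 i then N choose i else 0) = midbin N (k + 1) + midbin N (k - 1)"
    unfolding midbin_def sum.distrib[symmetric] c_def
    using assms by (intro sum.cong refl) (auto simp: of_nat_diff)
  finally show ?thesis .
qed

lemma central_binomial_Suc: "real (Suc m) * real ((2 * Suc m) choose Suc m) = 2 * real (2 * m + 1) * real ((2 * m) choose m)"
proof -
  have 1: "real ((2 * Suc m) choose Suc m) = fact (2 * Suc m) / (fact (Suc m) * fact (Suc m))"
    by (subst binomial_fact) auto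
  have 2: "real ((2 * m) choose m) = fact (2 * m) / (fact m * fact m)"
    by (subst binomial_fact) auto
  have 3: "(fact (2 * Suc m) :: real) = 2 * real (Suc m) * real (2 * m + 1) * fact (2 * m)"
    by (simp add: algebra_simps)
  have 4: "(fact (Suc m) :: real) = real (Suc m) * fact m" by simp
  show ?thesis unfolding 1 2 3 4 by (simp del: of_nat_Suc fact_Suc)
qed

text \<open>The factor \<open>2 * m + 1\<close> makes the induction step reduce to (2M-1)(2M+1)
  being at most 4M^2, with M = m + 1.\<close>

lemma central_binomial_sq_le: "(real ((2 * m) choose m))\<^sup>2 * real (2 * m + 1) \<le> 16 ^ m"
proof (induction m)
  case (Suc m)
  define C where "C = real ((2 * m) choose m)"
  define M where "M = real m + 1"
  have M: "M > 0" by (simp add: M_def)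
  have eq: "real ((2 * Suc m) choose Suc m) = 2 * (2 * M - 1) * C / M"
    using central_binomial_Suc[of m] M by (simp add: C_def M_def field_simps)
  have "(2 * M - 1) * (2 * M + 1) \<le> 4 * M\<^sup>2"
    by (simp add: algebra_simps power2_eq_square)
  then have "(2 * M - 1) * (2 * M + 1) / M\<^sup>2 \<le> 4"
    using M by (simp add: pos_divide_le_eq)
  then have "4 * (C\<^sup>2 * (2 * M - 1)) * ((2 * M - 1) * (2 * M + 1) / M\<^sup>2) \<le> 4 * (C\<^sup>2 * (2 * M - 1)) * 4"
    by (intro mult_left_mono) (auto simp: M_def)
  also have "\<dots> \<le> 4 * 16 ^ m * 4"
    using Suc by (simp add: C_def M_def)
  finally have le: "4 * (C\<^sup>2 * (2 * M - 1)) * ((2 * M - 1) * (2 * M + 1) / M\<^sup>2) \<le> 16 ^ Suc m" by simp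
  have "4 * (C\<^sup>2 * (2 * M - 1)) * ((2 * M - 1) * (2 * M + 1) / M\<^sup>2) = (2 * (2 * M - 1) * C / M)\<^sup>2 * (2 * M + 1)"
    using M by (simp add: power2_eq_square field_simps)
  moreover have "real (2 * Suc m + 1) = 2 * M + 1" by (simp add: M_def)
  ultimately show ?case unfolding eq using le by (simp only:)
qed simp

lemma midbin_1_le: "real (midbin N 1) / 2 ^ N \<le> 1 / sqrt (real N + 1)"
proof -
  have mid: "midbin N 1 = N choose ((N + 1) div 2)"
  proof -
    have "midbin N 1 = (\<Sum>i\<le>N. if i = (N + 1) div 2 then N choose i else 0)"
      unfolding midbin_def by (intro sum.cong refl if_cong) auto
    then show ?thesis by simp
  qed
  define m where "m = (N + 1) div 2"
  have cb: "real ((2 * m) choose m) * sqrt (real (2 * m + 1)) \<le> 4 ^ m"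
  proof (rule power2_le_imp_le)
    have "(16 :: real) ^ m = (4 ^ m)\<^sup>2" using power_mult_distrib[of "4::real" 4 m] by (simp add: power2_eq_square)
    then show "(real ((2 * m) choose m) * sqrt (real (2 * m + 1)))\<^sup>2 \<le> (4 ^ m)\<^sup>2"
      using central_binomial_sq_le[of m] by (simp add: power_mult_distrib)
  qed simp
  have p4: "(4 :: real) ^ m = 2 ^ (2 * m)" by (simp add: power_mult)
  consider "N = 2 * m" | "N + 1 = 2 * m" unfolding m_def by linarith
  then have "real (N choose m) * sqrt (real N + 1) \<le> 2 ^ N"
  proof cases
    case 1
    then show ?thesis using cb p4 by (simp add: add.commute)
  next
    \<comment> \<open>For odd \<open>N\<close> the two middle coefficients are equal and add up to
      the central one of the next row.\<close>
    case 2
    then obtain m' where m': "m = Suc m'" by (cases m) auto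
    have N: "N = 2 * m' + 1" using 2 m' by simp
    have "(2 * m) choose m = Suc N choose Suc m'" using N m' by simp
    also have "\<dots> = (N choose m') + (N choose Suc m')"
      by (rule binomial_Suc_Suc)
    also have "N choose m' = N choose Suc m'"
      using binomial_symmetric[of m' N] N by simp
    finally have "real (N choose m) = real ((2 * m) choose m) / 2" using m' by simp
    moreover have "sqrt (real N + 1) \<le> sqrt (real (2 * m + 1))" using 2 by simp
    ultimately have "real (N choose m) * sqrt (real N + 1) \<le> real ((2 * m) choose m) / 2 * sqrt (real (2 * m + 1))"
      by (intro mult_mono) auto
    also have "\<dots> \<le> 4 ^ m / 2" using cb by simp
    also have "\<dots> = 2 ^ (N + 1) / 2" using 2 p4 by simp
    finally show ?thesis by simp
  qed
  then show ?thesis unfolding mid m_def by (simp add: field_simps)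
qed

text \<open>
  The permutation \<open>a \<mapsto> a + (s + 1) div 2\<close> modulo \<open>s + 1\<close> moves every point of \<open>{0..s}\<close> by at least
  \<open>(s + 1) div 2\<close>; averaging over it turns a uniform variable into a mixture of widely spaced coin flips.
\<close>
definition half_turn :: "nat \<Rightarrow> nat \<Rightarrow> nat" where
  "half_turn s a = (if a + (s + 1) div 2 \<le> s then a + (s + 1) div 2 else a + (s + 1) div 2 - (s + 1))"

lemma bij_betw_half_turn: "bij_betw (half_turn s) {..s} {..s}"
proof -
  have "inj_on (half_turn s) {..s}"
    by (auto simp: inj_on_def half_turn_def split: if_splits)
  moreover have "half_turn s ` {..s} \<subseteq> {..s}"
    by (auto simp: half_turn_def)
  ultimately show ?thesis
    by (simp add: bij_betw_def endo_inj_surj)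
qed

lemma half_turn_far: "a \<le> s \<Longrightarrow> a + (s + 1) div 2 \<le> half_turn s a \<or> half_turn s a + (s + 1) div 2 \<le> a"
  by (auto simp: half_turn_def)

definition separated :: "real \<Rightarrow> real set \<Rightarrow> bool" where
  "separated \<delta> Y \<longleftrightarrow> (\<forall>y\<in>Y. \<forall>y'\<in>Y. y < y' \<longrightarrow> y + \<delta> \<le> y')"

lemma separated_shift: "separated \<delta> Y \<Longrightarrow> separated \<delta> ((\<lambda>y. y - t) ` Y)"
  by (fastforce simp: separated_def)

lemma separated_subset: "separated \<delta> Y \<Longrightarrow> Z \<subseteq> Y \<Longrightarrow> separated \<delta> Z"
  by (auto simp: separated_def)

text \<open>
  Kleitman's exchange: two copies of \<open>Y\<close> shifted apart by at least \<open>\<delta>\<close> rearrange, by moving the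
  topmost point from the upper copy to the lower, into separated sets with one point more and one less.
\<close>
lemma separated_exchange:
  fixes c :: "real \<Rightarrow> real"
  assumes "finite Y" "Y \<noteq> {}" "separated \<delta> Y" "u + \<delta> \<le> t" "0 < \<delta>"
    and f: "\<And>Z. finite Z \<Longrightarrow> separated \<delta> Z \<Longrightarrow> (\<Sum>z\<in>Z. c z) \<le> f (card Z)"
  shows "(\<Sum>y\<in>Y. c (y - u)) + (\<Sum>y\<in>Y. c (y - t)) \<le> f (card Y + 1) + f (card Y - 1)"
proof -
  define M where "M = Max Y"
  have M: "M \<in> Y" "\<And>y. y \<in> Y \<Longrightarrow> y \<le> M" using assms by (auto simp: M_def)
  define L where "L = (\<lambda>y. y - t) ` Y"
  define R where "R = (\<lambda>y. y - u) ` (Y - {M})"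
  have above: "z + \<delta> \<le> M - u" if z: "z \<in> L" for z
  proof -
    obtain y where "y \<in> Y" "z = y - t" using z unfolding L_def by blast
    then show ?thesis using M(2)[of y] assms(4) by linarith
  qed
  have notin: "M - u \<notin> L" using above[of "M - u"] assms(5) by linarith
  have sepL: "separated \<delta> (insert (M - u) L)"
    unfolding separated_def
  proof (intro ballI impI)
    fix y y' assume y: "y \<in> insert (M - u) L" "y' \<in> insert (M - u) L" "y < y'"
    have "y \<noteq> M - u"
    proof
      assume "y = M - u"
      then have "y' \<in> L" using y by auto
      then show False using above[of y'] \<open>y = M - u\<close> y(3) assms(5) by linarith
    qed
    then have "y \<in> L" using y by blast
    then show "y + \<delta> \<le> y'"
      using y above[of y] separated_shift[OF assms(3), of t] by (auto simp: separated_def simp flip: L_def)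
  qed
  have sepR: "separated \<delta> R"
    unfolding R_def by (intro separated_shift separated_subset[OF assms(3)]) auto
  have "(\<Sum>y\<in>Y. c (y - u)) = c (M - u) + (\<Sum>y\<in>Y - {M}. c (y - u))"
    using assms M by (intro sum.remove) auto
  also have "(\<Sum>y\<in>Y - {M}. c (y - u)) = (\<Sum>z\<in>R. c z)"
    unfolding R_def by (subst sum.reindex) (auto simp: inj_on_def)
  finally have "(\<Sum>y\<in>Y. c (y - u)) + (\<Sum>y\<in>Y. c (y - t)) = (\<Sum>z\<in>insert (M - u) L. c z) + (\<Sum>z\<in>R. c z)"
    using notin assms(1) by (simp add: L_def sum.reindex inj_on_def)
  also have "\<dots> \<le> f (card (insert (M - u) L)) + f (card R)"
    using assms(1) by (intro add_mono f sepL sepR) (auto simp: L_def R_def)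
  also have "card (insert (M - u) L) = card Y + 1"
    using notin assms(1) by (simp add: L_def card_image inj_on_def)
  also have "card R = card Y - 1"
    using M assms(1) by (simp add: R_def card_image inj_on_def)
  finally show ?thesis .
qed

text \<open>The bound is wanted for one window, but the exchange step creates larger target sets, so
  the induction runs over all separated \<open>Y\<close>. A coordinate whose half range moves the
  sum by \<delta> brings one step of the binomial recursion; any other only shifts \<open>Y\<close>.
  Without variables at most one window contains 0.\<close>

lemma littlewood_offord_separated:
  fixes v :: "'i \<Rightarrow> real"
  assumes "finite J" "0 < \<delta>" "finite Y" "separated \<delta> Y"
  shows "(\<Sum>y\<in>Y. real (card {g \<in> grid J s. y \<le> (\<Sum>j\<in>J. v j * real (g j)) \<and> (\<Sum>j\<in>J. v j * real (g j)) < y + \<delta>}))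
    \<le> real (midbin (card {j \<in> J. \<delta> \<le> v j * real ((s j + 1) div 2)}) (card Y))
       / 2 ^ card {j \<in> J. \<delta> \<le> v j * real ((s j + 1) div 2)} * real (card (grid J s))"
  using assms(1,3,4)
proof (induction J arbitrary: Y rule: finite_induct)
  case empty
  show ?case
  proof (cases "{y \<in> Y. y \<le> 0 \<and> 0 < y + \<delta>} = {}")
    case True
    then have "\<not> (y \<le> 0 \<and> 0 < y + \<delta>)" if "y \<in> Y" for y using that by blast
    then have "(\<Sum>y\<in>Y. real (card {g \<in> grid {} s. y \<le> (\<Sum>j\<in>{}. v j * real (g j)) \<and> (\<Sum>j\<in>{}. v j * real (g j)) < y + \<delta>})) = 0"
      by (intro sum.neutral) (auto simp: card_eq_0_iff)
    then show ?thesis by simp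
  next
    case False
    then obtain y where y: "y \<in> Y" "y \<le> 0" "0 < y + \<delta>" by blast
    have "real (card {g \<in> grid {} s. z \<le> (\<Sum>j\<in>{}. v j * real (g j)) \<and> (\<Sum>j\<in>{}. v j * real (g j)) < z + \<delta>})
        \<le> (if z = y then 1 else 0)" if z: "z \<in> Y" for z
    proof (cases "z = y")
      case False
      then have "z + \<delta> \<le> y \<or> y + \<delta> \<le> z"
        using z y empty(2) unfolding separated_def by (metis linorder_neqE_linordered_idom)
      then have "\<not> (z \<le> 0 \<and> 0 < z + \<delta>)" using y by linarith
      then show ?thesis by (auto simp: card_eq_0_iff)
    next
      case True
      have "card {g \<in> grid {} s. z \<le> (\<Sum>j\<in>{}. v j * real (g j)) \<and> (\<Sum>j\<in>{}. v j * real (g j)) < z + \<delta>} \<le> card {\<lambda>_::'i. 0::nat}"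
        by (intro card_mono) auto
      then show ?thesis using True by simp
    qed
    then have "(\<Sum>z\<in>Y. real (card {g \<in> grid {} s. z \<le> (\<Sum>j\<in>{}. v j * real (g j)) \<and> (\<Sum>j\<in>{}. v j * real (g j)) < z + \<delta>}))
        \<le> (\<Sum>z\<in>Y. if z = y then 1 else 0)"
      by (rule sum_mono)
    also have "\<dots> = 1" using y empty by simp
    also have "(1 :: real) = real (midbin 0 (card Y))"
      using y empty by (subst midbin_0) (auto simp: card_gt_0_iff)
    finally show ?thesis by simp
  qed
next
  case (insert j J)
  define big where "big = (\<lambda>j. \<delta> \<le> v j * real ((s j + 1) div 2))"
  define c where "c = (\<lambda>z. real (card {g \<in> grid J s. z \<le> (\<Sum>i\<in>J. v i * real (g i)) \<and> (\<Sum>i\<in>J. v i * real (g i)) < z + \<delta>}))"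
  define N where "N = card {i \<in> J. big i}"
  define T where "T = real (card (grid J s))"
  have c: "(\<Sum>z\<in>Z. c z) \<le> real (midbin N (card Z)) / 2 ^ N * T" if "finite Z" "separated \<delta> Z" for Z
    using insert.IH[OF that] by (simp add: c_def N_def big_def T_def)
  have T: "real (card (grid (insert j J) s)) = (real (s j) + 1) * T"
    using insert by (simp add: card_grid T_def algebra_simps)
  have slice: "real (card {g \<in> grid (insert j J) s. y \<le> (\<Sum>i\<in>insert j J. v i * real (g i)) \<and> (\<Sum>i\<in>insert j J. v i * real (g i)) < y + \<delta>})
      = (\<Sum>a\<le>s j. c (y - v j * real a))" for y
  proof -
    have upd: "(\<Sum>i\<in>insert j J. v i * real ((g(j := a)) i)) = v j * real a + (\<Sum>i\<in>J. v i * real (g i))" for g a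
      using insert by (simp, intro sum.cong) auto
    have "real (card {g \<in> grid (insert j J) s. y \<le> (\<Sum>i\<in>insert j J. v i * real (g i)) \<and> (\<Sum>i\<in>insert j J. v i * real (g i)) < y + \<delta>})
      = (\<Sum>a\<le>s j. \<Sum>g\<in>grid J s. of_bool (y \<le> v j * real a + (\<Sum>i\<in>J. v i * real (g i)) \<and> v j * real a + (\<Sum>i\<in>J. v i * real (g i)) < y + \<delta>))"
      unfolding real_card_filter[OF finite_grid[OF finite.insertI[OF insert.hyps(1)]]]
        sum_grid_insert[OF insert.hyps(2)] upd ..
    also have "\<dots> = (\<Sum>a\<le>s j. c (y - v j * real a))"
      unfolding c_def using insert by (simp add: real_card_filter algebra_simps)
    finally show ?thesis .
  qed
  have total: "(\<Sum>y\<in>Y. real (card {g \<in> grid (insert j J) s. y \<le> (\<Sum>i\<in>insert j J. v i * real (g i)) \<and> (\<Sum>i\<in>insert j J. v i * real (g i)) < y + \<delta>}))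
      = (\<Sum>a\<le>s j. \<Sum>y\<in>Y. c (y - v j * real a))"
    unfolding slice by (rule sum.swap)
  show ?case
  proof (cases "big j \<and> Y \<noteq> {}")
    case False
    have each: "(\<Sum>y\<in>Y. c (y - v j * real a)) \<le> real (midbin N (card Y)) / 2 ^ N * T" for a
    proof -
      have "(\<Sum>y\<in>Y. c (y - v j * real a)) = (\<Sum>z\<in>(\<lambda>y. y - v j * real a) ` Y. c z)"
        by (subst sum.reindex) (auto simp: inj_on_def)
      also have "\<dots> \<le> real (midbin N (card ((\<lambda>y. y - v j * real a) ` Y))) / 2 ^ N * T"
        using insert.prems by (intro c separated_shift) auto
      also have "card ((\<lambda>y. y - v j * real a) ` Y) = card Y"
        by (intro card_image) (auto simp: inj_on_def)
      finally show ?thesis .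
    qed
    show ?thesis
    proof (cases "Y = {}")
      case True
      then show ?thesis by simp
    next
      case False
      then have "\<not> big j" using \<open>\<not> (big j \<and> Y \<noteq> {})\<close> by blast
      then have eq: "{i \<in> insert j J. \<delta> \<le> v i * real ((s i + 1) div 2)} = {i \<in> J. big i}"
        by (auto simp: big_def)
      have "(\<Sum>a\<le>s j. \<Sum>y\<in>Y. c (y - v j * real a)) \<le> (\<Sum>a\<le>s j. real (midbin N (card Y)) / 2 ^ N * T)"
        by (intro sum_mono each)
      then show ?thesis unfolding total T eq N_def[symmetric] by (simp add: algebra_simps)
    qed
  next
    case True
    define F where "F = (\<lambda>k. real (midbin N k) / 2 ^ N * T)"
    have k: "0 < card Y" using True insert.prems by (simp add: card_gt_0_iff)
    have pair: "(\<Sum>y\<in>Y. c (y - v j * real a)) + (\<Sum>y\<in>Y. c (y - v j * real (half_turn (s j) a))) \<le> F (card Y + 1) + F (card Y - 1)"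
      if a: "a \<le> s j" for a
    proof -
      define r where "r = (s j + 1) div 2"
      have vr: "\<delta> \<le> v j * real r" using True by (simp add: big_def r_def)
      then have "0 < v j * real r" using assms(2) by linarith
      then have v0: "0 < v j" by (simp add: zero_less_mult_iff)
      have far: "v j * real a' + \<delta> \<le> v j * real b'" if "a' + r \<le> b'" for a' b'
      proof -
        have "real a' + real r \<le> real b'" using that by linarith
        then have "v j * (real a' + real r) \<le> v j * real b'" using v0 by (intro mult_left_mono) auto
        then show ?thesis using vr by (simp add: algebra_simps)
      qed
      have c': "(\<Sum>z\<in>Z. c z) \<le> F (card Z)" if "finite Z" "separated \<delta> Z" for Z
        using c[OF that] by (simp add: F_def)
      from half_turn_far[OF a] show ?thesis
      proof
        assume "a + (s j + 1) div 2 \<le> half_turn (s j) a"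
        then show ?thesis
          using insert.prems True assms(2) c' by (intro separated_exchange[of Y \<delta>] far) (auto simp: r_def)
      next
        assume "half_turn (s j) a + (s j + 1) div 2 \<le> a"
        then have "(\<Sum>y\<in>Y. c (y - v j * real (half_turn (s j) a))) + (\<Sum>y\<in>Y. c (y - v j * real a)) \<le> F (card Y + 1) + F (card Y - 1)"
          using insert.prems True assms(2) c' by (intro separated_exchange[of Y \<delta>] far) (auto simp: r_def)
        then show ?thesis by (simp add: add.commute)
      qed
    qed
    have "(\<Sum>a\<le>s j. \<Sum>y\<in>Y. c (y - v j * real (half_turn (s j) a))) = (\<Sum>a\<le>s j. \<Sum>y\<in>Y. c (y - v j * real a))"
      by (rule sum.reindex_bij_betw[OF bij_betw_half_turn])
    then have "2 * (\<Sum>a\<le>s j. \<Sum>y\<in>Y. c (y - v j * real a))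
      = (\<Sum>a\<le>s j. (\<Sum>y\<in>Y. c (y - v j * real a)) + (\<Sum>y\<in>Y. c (y - v j * real (half_turn (s j) a))))"
      by (simp add: sum.distrib)
    also have "\<dots> \<le> (\<Sum>a\<le>s j. F (card Y + 1) + F (card Y - 1))"
      by (intro sum_mono pair) auto
    also have "\<dots> = (real (s j) + 1) * (real (midbin (Suc N) (card Y)) / 2 ^ N * T)"
      using k by (simp add: F_def midbin_Suc algebra_simps add_divide_distrib)
    finally have "(\<Sum>a\<le>s j. \<Sum>y\<in>Y. c (y - v j * real a)) \<le> real (midbin (Suc N) (card Y)) / 2 ^ Suc N * ((real (s j) + 1) * T)"
      by (simp add: field_simps)
    moreover have "{i \<in> insert j J. \<delta> \<le> v i * real ((s i + 1) div 2)} = insert j {i \<in> J. big i}"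
      using True by (auto simp: big_def)
    then have "card {i \<in> insert j J. \<delta> \<le> v i * real ((s i + 1) div 2)} = Suc N"
      using insert by (simp add: N_def)
    ultimately show ?thesis unfolding total T by simp
  qed
qed

lemma littlewood_offord_interval:
  fixes v :: "'i \<Rightarrow> real"
  assumes "finite J" "0 < \<delta>" "a \<le> b"
    and N: "real N \<le> real (card {j \<in> J. \<delta> \<le> v j * real ((s j + 1) div 2)})"
  shows "real (card {g \<in> grid J s. a \<le> (\<Sum>j\<in>J. v j * real (g j)) \<and> (\<Sum>j\<in>J. v j * real (g j)) \<le> b})
    \<le> ((b - a) / \<delta> + 1) / sqrt (real N + 1) * real (card (grid J s))"
proof -
  define X where "X = (\<lambda>g. \<Sum>j\<in>J. v j * real (g j))"
  define n where "n = nat \<lfloor>(b - a) / \<delta>\<rfloor>"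
  have n: "real n \<le> (b - a) / \<delta>" unfolding n_def using assms by (intro of_nat_floor) auto
  have "{g \<in> grid J s. a \<le> X g \<and> X g \<le> b} \<subseteq> (\<Union>i\<le>n. {g \<in> grid J s. a + real i * \<delta> \<le> X g \<and> X g < a + real i * \<delta> + \<delta>})"
  proof
    fix g assume g: "g \<in> {g \<in> grid J s. a \<le> X g \<and> X g \<le> b}"
    define i where "i = nat \<lfloor>(X g - a) / \<delta>\<rfloor>"
    have i0: "0 \<le> (X g - a) / \<delta>" using g assms by simp
    then have i: "real i \<le> (X g - a) / \<delta>" "(X g - a) / \<delta> < real i + 1"
      unfolding i_def by (auto simp: of_nat_floor)
    have "i \<le> n" unfolding i_def n_def using g assms
      by (intro nat_mono floor_mono divide_right_mono) auto
    moreover have "a + real i * \<delta> \<le> X g" "X g < a + real i * \<delta> + \<delta>"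
      using i assms by (simp_all add: field_simps)
    ultimately show "g \<in> (\<Union>i\<le>n. {g \<in> grid J s. a + real i * \<delta> \<le> X g \<and> X g < a + real i * \<delta> + \<delta>})"
      using g by blast
  qed
  then have "real (card {g \<in> grid J s. a \<le> X g \<and> X g \<le> b})
      \<le> real (card (\<Union>i\<le>n. {g \<in> grid J s. a + real i * \<delta> \<le> X g \<and> X g < a + real i * \<delta> + \<delta>}))"
    using assms by (intro of_nat_mono card_mono) auto
  also have "\<dots> \<le> real (\<Sum>i\<le>n. card {g \<in> grid J s. a + real i * \<delta> \<le> X g \<and> X g < a + real i * \<delta> + \<delta>})"
    by (intro of_nat_mono card_UN_le) auto
  also have "\<dots> = (\<Sum>i\<le>n. real (card {g \<in> grid J s. a + real i * \<delta> \<le> X g \<and> X g < a + real i * \<delta> + \<delta>}))" by simp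
  also have "\<dots> \<le> (\<Sum>i\<le>n. 1 / sqrt (real N + 1) * real (card (grid J s)))"
  proof (intro sum_mono)
    fix i
    define N' where "N' = card {j \<in> J. \<delta> \<le> v j * real ((s j + 1) div 2)}"
    have "real (card {g \<in> grid J s. a + real i * \<delta> \<le> X g \<and> X g < a + real i * \<delta> + \<delta>}) \<le> real (midbin N' 1) / 2 ^ N' * real (card (grid J s))"
      using littlewood_offord_separated[OF assms(1,2), of "{a + real i * \<delta>}" s v]
      by (simp add: X_def N'_def separated_def)
    also have "\<dots> \<le> 1 / sqrt (real N' + 1) * real (card (grid J s))"
      by (intro mult_right_mono midbin_1_le) auto
    also have "\<dots> \<le> 1 / sqrt (real N + 1) * real (card (grid J s))"
      using N by (intro mult_right_mono divide_left_mono) (auto simp: N'_def add_pos_nonneg)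
    finally show "real (card {g \<in> grid J s. a + real i * \<delta> \<le> X g \<and> X g < a + real i * \<delta> + \<delta>}) \<le> 1 / sqrt (real N + 1) * real (card (grid J s))" .
  qed
  also have "\<dots> = (real n + 1) / sqrt (real N + 1) * real (card (grid J s))" by simp
  also have "\<dots> \<le> ((b - a) / \<delta> + 1) / sqrt (real N + 1) * real (card (grid J s))"
    using n by (intro mult_right_mono divide_right_mono) auto
  finally show ?thesis by (simp add: X_def)
qed

text \<open>The reflection of \<open>g\<close> to \<open>s - g\<close> changes the sign of the sum,
  so the events "at least -E" and "at most E" have equal size. They cover the grid, hence each has
  half of it plus half of the event that the sum lies between -E and E, which is a Littlewood-Offord
  window of length 2E.\<close>

lemma card_grid_ge_neg_le:
  fixes w :: "'i \<Rightarrow> real"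
  assumes "finite J" "0 < \<delta>" "0 \<le> E"
    and N: "real N \<le> real (card {j \<in> J. \<delta> \<le> 2 * w j * real ((s j + 1) div 2)})"
  shows "real (card {g \<in> grid J s. - E \<le> (\<Sum>j\<in>J. w j * (real (s j) - 2 * real (g j)))})
    \<le> (1 / 2 + (E / \<delta> + 1) / sqrt (real N + 1)) * real (card (grid J s))"
proof -
  define X where "X = (\<lambda>g. \<Sum>j\<in>J. w j * (real (s j) - 2 * real (g j)))"
  define S where "S = (\<Sum>j\<in>J. w j * real (s j))"
  have X: "X g = S - (\<Sum>j\<in>J. 2 * w j * real (g j))" for g
    by (simp add: X_def S_def right_diff_distrib sum_subtractf mult_ac)
  define \<rho> where "\<rho> = (\<lambda>g j. if j \<in> J then s j - g j else (0::nat))"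
  have \<rho>: "bij_betw \<rho> {g \<in> grid J s. - E \<le> X g} {g \<in> grid J s. X g \<le> E}"
  proof -
    have neg: "X (\<rho> g) = - X g" if "g \<in> grid J s" for g
      unfolding X_def sum_negf[symmetric] using that
      by (intro sum.cong refl) (auto simp: \<rho>_def grid_def of_nat_diff algebra_simps)
    have inv: "\<rho> (\<rho> g) = g" if "g \<in> grid J s" for g
      using that by (auto simp: \<rho>_def grid_def fun_eq_iff)
    have cl: "\<rho> g \<in> grid J s" for g by (auto simp: \<rho>_def grid_def)
    show ?thesis
      by (rule bij_betw_byWitness[where f' = \<rho>]) (auto simp: neg inv cl)
  qed
  have fin: "finite (grid J s)" using assms by simp
  have "2 * card {g \<in> grid J s. - E \<le> X g} = card {g \<in> grid J s. - E \<le> X g} + card {g \<in> grid J s. X g \<le> E}"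
    using bij_betw_same_card[OF \<rho>] by simp
  also have "\<dots> = card ({g \<in> grid J s. - E \<le> X g} \<union> {g \<in> grid J s. X g \<le> E}) + card ({g \<in> grid J s. - E \<le> X g} \<inter> {g \<in> grid J s. X g \<le> E})"
    using fin by (intro card_Un_Int) auto
  also have "{g \<in> grid J s. - E \<le> X g} \<union> {g \<in> grid J s. X g \<le> E} = grid J s"
    using assms by auto
  also have "{g \<in> grid J s. - E \<le> X g} \<inter> {g \<in> grid J s. X g \<le> E}
     = {g \<in> grid J s. S - E \<le> (\<Sum>j\<in>J. 2 * w j * real (g j)) \<and> (\<Sum>j\<in>J. 2 * w j * real (g j)) \<le> S + E}"
    unfolding X by auto
  finally have "2 * real (card {g \<in> grid J s. - E \<le> X g}) = real (card (grid J s))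
     + real (card {g \<in> grid J s. S - E \<le> (\<Sum>j\<in>J. 2 * w j * real (g j)) \<and> (\<Sum>j\<in>J. 2 * w j * real (g j)) \<le> S + E})"
    by linarith
  also have "\<dots> \<le> real (card (grid J s)) + ((S + E - (S - E)) / \<delta> + 1) / sqrt (real N + 1) * real (card (grid J s))"
    using assms by (intro add_left_mono littlewood_offord_interval) auto
  also have "\<dots> \<le> real (card (grid J s)) + (2 * (E / \<delta> + 1)) / sqrt (real N + 1) * real (card (grid J s))"
    by (intro add_left_mono mult_right_mono divide_right_mono) auto
  also have "\<dots> = 2 * ((1 / 2 + (E / \<delta> + 1) / sqrt (real N + 1)) * real (card (grid J s)))"
    unfolding times_divide_eq_right[symmetric] by (simp only: distrib_right distrib_left)
  finally show ?thesis unfolding X_def by linarith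
qed

section \<open>Moments and tails of random codes\<close>

text \<open>The upper and lower estimates of the partition numbers differ by a power of
  \<open>n\<close>; this is where the factor \<open>n ^ A\<close> enters all bounds on exceptional
  events.\<close>

lemma nparts_ratio:
  obtains A :: nat and c :: real where "0 < c"
    "\<And>n N. 0 < n \<Longrightarrow> real (nparts N) \<le> c * real n ^ A * real (nparts n) * exp (hr_rate n * (real N - real n))"
proof -
  obtain A a where a: "a > 0" and lower: "\<And>n. n > 0 \<Longrightarrow> a * (exp (hr_const * sqrt (real n)) / real n ^ A) \<le> real (nparts n)"
    using nparts_lower by blast
  have "real (nparts N) \<le> 1 / a * real n ^ A * real (nparts n) * exp (hr_rate n * (real N - real n))" if n: "0 < n" for n N
  proof -
    have "real (nparts N) \<le> exp (hr_const * sqrt (real n + (real N - real n)))"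
      using nparts_upper[of N] by simp
    also have "\<dots> \<le> exp (hr_const * sqrt (real n)) * exp (hr_rate n * (real N - real n))"
      using n by (intro hr_exp_add_le) auto
    also have "exp (hr_const * sqrt (real n)) \<le> 1 / a * real n ^ A * real (nparts n)"
      using lower[OF n] a n by (simp add: field_simps)
    finally show ?thesis by simp
  qed
  then show ?thesis using that[of "1 / a" A] a by simp
qed

lemma ratio_bound_nonneg:
  assumes "\<And>N. real (nparts N) \<le> R * exp (x * (real N - real n))"
  shows "0 \<le> R"
proof -
  have "0 \<le> R * exp (x * (real 0 - real n))"
    using assms[of 0] by (meson of_nat_0_le_iff order_trans)
  then show ?thesis by (simp add: zero_le_mult_iff)
qed

lemma codes_size_le: "(d, g, h) \<in> codes n \<Longrightarrow> d \<le> n"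
proof -
  assume "(d, g, h) \<in> codes n"
  then have "d * d \<le> n" by (auto simp: codes_def)
  moreover have "d \<le> d * d" by (cases d) auto
  ultimately show "d \<le> n" by (rule order_trans[rotated])
qed

lemma codes_part_le:
  assumes "(d, g, h) \<in> codes n"
  shows "g j \<le> n" "h j \<le> n"
proof -
  have *: "j * (g j + h j) \<le> n"
  proof (cases "j \<in> {1..d}")
    case True
    then have "j * (g j + h j) \<le> (\<Sum>j=1..d. j * (g j + h j))"
      by (intro member_le_sum) auto
    then show ?thesis using assms by (auto simp: codes_def)
  qed (use assms in \<open>auto simp: codes_def\<close>)
  have "g j + h j \<le> n"
  proof (cases "j = 0")
    case False
    then have "g j + h j \<le> j * (g j + h j)" by (cases j) auto
    then show ?thesis using * by (rule order_trans)
  qed (use assms in \<open>auto simp: codes_def\<close>)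
  then show "g j \<le> n" "h j \<le> n" by auto
qed

lemma real_card_codes:
  "real (card {(d, g, h) \<in> codes n. P d g h}) = (\<Sum>(d, g, h)\<in>codes n. of_bool (P d g h))"
proof -
  have "{(d, g, h) \<in> codes n. P d g h} = {p \<in> codes n. case p of (d, g, h) \<Rightarrow> P d g h}"
    by auto
  then have "real (card {(d, g, h) \<in> codes n. P d g h}) = (\<Sum>p\<in>codes n. of_bool (case p of (d, g, h) \<Rightarrow> P d g h))"
    by (simp only: real_card_filter[OF finite_codes])
  also have "\<dots> = (\<Sum>(d, g, h)\<in>codes n. of_bool (P d g h))"
    by (rule sum.cong) (auto simp: case_prod_unfold)
  finally show ?thesis .
qed

text \<open>Deleting \<open>t j\<close> columns of height \<open>j\<close> and \<open>t' j\<close>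
  rows of length \<open>j\<close> is injective and leaves the Durfee square alone, so no control of
  \<open>d\<close> is required.\<close>

lemma card_codes_ge_le:
  assumes "\<And>j. j \<notin> {1..n} \<Longrightarrow> t j = 0 \<and> t' j = 0"
  shows "card {(d, g, h) \<in> codes n. \<forall>j\<in>{1..n}. t j \<le> g j \<and> t' j \<le> h j}
    \<le> (if (\<Sum>j=1..n. j * (t j + t' j)) \<le> n then nparts (n - (\<Sum>j=1..n. j * (t j + t' j))) else 0)"
proof -
  define m where "m = (\<Sum>j=1..n. j * (t j + t' j))"
  define S where "S = {(d, g, h) \<in> codes n. \<forall>j\<in>{1..n}. t j \<le> g j \<and> t' j \<le> h j}"
  define \<phi> where "\<phi> = (\<lambda>(d :: nat, g, h). (d, \<lambda>j. g j - t j, \<lambda>j. h j - t' j))"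
  have key: "m \<le> n \<and> (d, \<lambda>j. g j - t j, \<lambda>j. h j - t' j) \<in> codes (n - m) \<and> (\<forall>j. t j \<le> g j \<and> t' j \<le> h j)"
    if S: "(d, g, h) \<in> S" for d g h
  proof -
    have cod: "(d, g, h) \<in> codes n" using S by (simp add: S_def)
    have le: "t j \<le> g j \<and> t' j \<le> h j" for j
      using S assms[of j] by (cases "j \<in> {1..n}") (auto simp: S_def)
    have "d \<le> n" using cod by (rule codes_size_le)
    have zero: "t j = 0 \<and> t' j = 0" if "j \<notin> {1..d}" for j
      using le[of j] that cod by (auto simp: codes_def)
    have "m = (\<Sum>j=1..d. j * (t j + t' j))"
      unfolding m_def using \<open>d \<le> n\<close> zero by (intro sum.mono_neutral_right) auto
    moreover have "(\<Sum>j=1..d. j * (g j - t j + (h j - t' j))) + (\<Sum>j=1..d. j * (t j + t' j)) = (\<Sum>j=1..d. j * (g j + h j))"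
      unfolding sum.distrib[symmetric]
    proof (intro sum.cong refl)
      fix j
      have "g j - t j + (h j - t' j) + (t j + t' j) = g j + h j" using le[of j] by linarith
      then show "j * (g j - t j + (h j - t' j)) + j * (t j + t' j) = j * (g j + h j)"
        by (simp only: flip: distrib_left)
    qed
    ultimately have n: "n = d * d + ((\<Sum>j=1..d. j * (g j - t j + (h j - t' j))) + m)"
      using cod by (simp add: codes_def)
    have "(d, \<lambda>j. g j - t j, \<lambda>j. h j - t' j) \<in> codes (n - m)"
      unfolding codes_def mem_Collect_eq prod.case using cod by (subst n) (auto simp: codes_def)
    then show ?thesis using n le by auto
  qed
  show ?thesis
  proof (cases "S = {}")
    case True
    then show ?thesis unfolding S_def[symmetric] by simp
  next
    case False
    then have mn: "m \<le> n" using key by fastforce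
    have "inj_on \<phi> S"
    proof
      fix p p' assume p: "p \<in> S" "p' \<in> S" "\<phi> p = \<phi> p'"
      obtain d g h d' g' h' where P: "p = (d, g, h)" "p' = (d', g', h')" by (metis prod_cases3)
      have "g j = g' j" "h j = h' j" for j
        using p key[of d g h] key[of d' g' h'] unfolding P by (auto simp: \<phi>_def fun_eq_iff) (metis eq_diff_iff)+
      then show "p = p'" using p P by (auto simp: \<phi>_def fun_eq_iff)
    qed
    moreover have "\<phi> ` S \<subseteq> codes (n - m)" using key by (auto simp: \<phi>_def)
    ultimately have "card S \<le> card (codes (n - m))" by (intro card_inj_on_le) auto
    then show ?thesis using mn by (simp add: card_codes S_def m_def)
  qed
qed

section \<open>Exponential moments and a Chernoff bound\<close>

lemma sum_codes_swap:
  "(\<Sum>(d, g, h)\<in>codes n. F d (g(i := h i)) (h(i := g i))) = (\<Sum>(d, g, h)\<in>codes n. F d g h)"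
proof (rule sum.reindex_bij_witness[where i = "\<lambda>(d, g, h). (d, g(i := h i), h(i := g i))" and j = "\<lambda>(d, g, h). (d, g(i := h i), h(i := g i))"])
  show "(case p of (d, g, h) \<Rightarrow> (d, g(i := h i), h(i := g i))) \<in> codes n" if p: "p \<in> codes n" for p
  proof -
    obtain d g h where P: "p = (d, g, h)" by (cases p) auto
    have "(\<Sum>j=1..d. j * ((g(i := h i)) j + (h(i := g i)) j)) = (\<Sum>j=1..d. j * (g j + h j))"
      by (intro sum.cong) auto
    then show ?thesis using p unfolding P codes_def by auto
  qed
  then show "(case p of (d, g, h) \<Rightarrow> (d, g(i := h i), h(i := g i))) \<in> codes n" if "p \<in> codes n" for p using that .
qed auto

text \<open>Since \<open>g i\<close> and \<open>h i\<close> may be exchanged separately for each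
  \<open>i\<close>, the factors can be symmetrised one index at a time. Applied to exponentials this
  produces hyperbolic cosines, which have no linear term.\<close>

lemma sum_codes_symmetrize:
  fixes e :: "nat \<Rightarrow> nat \<Rightarrow> nat \<Rightarrow> real"
  assumes "finite I"
  shows "(\<Sum>(d, g, h)\<in>codes n. \<Prod>j\<in>I. e j (g j) (h j))
       = (\<Sum>(d, g, h)\<in>codes n. \<Prod>j\<in>I. (e j (g j) (h j) + e j (h j) (g j)) / 2)"
proof -
  define a where "a = (\<lambda>j x y. (e j x y + e j y x) / 2)"
  have "(\<Sum>(d, g, h)\<in>codes n. \<Prod>j\<in>I. e j (g j) (h j))
      = (\<Sum>(d, g, h)\<in>codes n. \<Prod>j\<in>I. if j \<in> J then a j (g j) (h j) else e j (g j) (h j))" if "J \<subseteq> I" for J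
    using finite_subset[OF that assms] that
  proof (induction J rule: finite_induct)
    case (insert i J)
    define P where "P = (\<lambda>g h :: nat \<Rightarrow> nat. \<Prod>j\<in>I - {i}. if j \<in> J then a j (g j) (h j) else e j (g j) (h j))"
    have Psw: "P (g(i := h i)) (h(i := g i)) = P g h" for g h
      unfolding P_def by (intro prod.cong) auto
    have "(\<Sum>(d, g, h)\<in>codes n. \<Prod>j\<in>I. e j (g j) (h j)) = (\<Sum>(d, g, h)\<in>codes n. \<Prod>j\<in>I. if j \<in> J then a j (g j) (h j) else e j (g j) (h j))"
      using insert by auto
    also have "\<dots> = (\<Sum>(d, g, h)\<in>codes n. e i (g i) (h i) * P g h)"
      unfolding P_def using insert assms by (intro sum.cong refl) (auto simp: prod.remove[of I i])
    finally have 1: "(\<Sum>(d, g, h)\<in>codes n. \<Prod>j\<in>I. e j (g j) (h j)) = (\<Sum>(d, g, h)\<in>codes n. e i (g i) (h i) * P g h)" .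
    have 2: "\<dots> = (\<Sum>(d, g, h)\<in>codes n. e i (h i) (g i) * P g h)"
      using sum_codes_swap[of "\<lambda>d g h. e i (g i) (h i) * P g h" i n] by (simp add: Psw)
    have "2 * (\<Sum>(d, g, h)\<in>codes n. \<Prod>j\<in>I. e j (g j) (h j))
        = (\<Sum>(d, g, h)\<in>codes n. e i (g i) (h i) * P g h) + (\<Sum>(d, g, h)\<in>codes n. e i (h i) (g i) * P g h)"
      using 1 2 by linarith
    also have "\<dots> = 2 * (\<Sum>(d, g, h)\<in>codes n. a i (g i) (h i) * P g h)"
      by (simp add: a_def sum_distrib_left algebra_simps add_divide_distrib case_prod_unfold flip: sum.distrib)
    also have "(\<Sum>(d, g, h)\<in>codes n. a i (g i) (h i) * P g h)
        = (\<Sum>(d, g, h)\<in>codes n. \<Prod>j\<in>I. if j \<in> insert i J then a j (g j) (h j) else e j (g j) (h j))"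
    proof (intro sum.cong refl)
      fix p assume "p \<in> codes n"
      obtain d g h where P': "p = (d, g, h)" by (cases p) auto
      have "P g h = (\<Prod>j\<in>I - {i}. if j \<in> insert i J then a j (g j) (h j) else e j (g j) (h j))"
        unfolding P_def by (intro prod.cong) auto
      then show "(case p of (d, g, h) \<Rightarrow> a i (g i) (h i) * P g h)
        = (case p of (d, g, h) \<Rightarrow> \<Prod>j\<in>I. if j \<in> insert i J then a j (g j) (h j) else e j (g j) (h j))"
        using insert assms unfolding P' by (simp add: prod.remove[of I i])
    qed
    finally show ?case by simp
  qed simp
  from this[OF order_refl] show ?thesis
    by (simp add: a_def)
qed

text \<open>Up to the factor \<open>R\<close>, the \<open>g j\<close> and \<open>h j\<close> are
  dominated by independent geometric variables of ratio e^(-xj). Only joint events of the form "at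
  least t" are controlled, which is why the functions of \<open>g j\<close> and \<open>h j\<close>
  are given through nonnegative increments \<open>D\<close>.\<close>

lemma sum_codes_prod_le:
  fixes D :: "nat \<Rightarrow> nat \<Rightarrow> real"
  assumes ratio: "\<And>N. real (nparts N) \<le> R * exp (x * (real N - real n))"
    and D: "\<And>j a. 0 \<le> D j a"
  shows "(\<Sum>(d, g, h)\<in>codes n. (\<Prod>j=1..n. \<Sum>a\<le>g j. D j a) * (\<Prod>j=1..n. \<Sum>a\<le>h j. D j a))
    \<le> R * (\<Prod>j=1..n. \<Sum>a\<le>n. D j a * exp (- (x * real j * real a)))\<^sup>2"
proof -
  define I where "I = {1..n}"
  define V where "V = grid I (\<lambda>_. n)"
  have finV: "finite V" by (simp add: V_def I_def)
  define W where "W = (\<lambda>t. \<Prod>j\<in>I. D j (t j))"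
  define e where "e = (\<lambda>t. \<Prod>j\<in>I. exp (- (x * real j * real (t j))))"
  have R0: "0 \<le> R" using ratio by (rule ratio_bound_nonneg)
  have W0: "0 \<le> W t" for t unfolding W_def using D by (intro prod_nonneg) auto
  have expand: "(\<Prod>j\<in>I. \<Sum>a\<le>g j. D j a) = (\<Sum>t\<in>V. of_bool (\<forall>j\<in>I. t j \<le> g j) * W t)" if "\<And>j. g j \<le> n" for g
  proof -
    have "(\<Prod>j\<in>I. \<Sum>a\<le>g j. D j a) = (\<Prod>j\<in>I. \<Sum>a\<le>n. if a \<le> g j then D j a else 0)"
      using that by (intro prod.cong refl sum.mono_neutral_cong_left) (auto simp: order_trans)
    also have "\<dots> = (\<Sum>t\<in>V. \<Prod>j\<in>I. if t j \<le> g j then D j (t j) else 0)"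
      unfolding V_def by (rule sum_prod_grid [symmetric]) (simp add: I_def)
    also have "\<dots> = (\<Sum>t\<in>V. of_bool (\<forall>j\<in>I. t j \<le> g j) * W t)"
    proof (intro sum.cong refl)
      fix t
      show "(\<Prod>j\<in>I. if t j \<le> g j then D j (t j) else 0) = of_bool (\<forall>j\<in>I. t j \<le> g j) * W t"
      proof (cases "\<forall>j\<in>I. t j \<le> g j")
        case True
        then have "(\<Prod>j\<in>I. if t j \<le> g j then D j (t j) else 0) = W t" unfolding W_def by (intro prod.cong) auto
        then show ?thesis using True by simp
      next
        case False
        then have "(\<Prod>j\<in>I. if t j \<le> g j then D j (t j) else 0) = 0" by (intro prod_zero) (auto simp: I_def)
        then show ?thesis using False by simp
      qed
    qed
    finally show ?thesis .
  qed
  have joint: "real (card {(d, g, h) \<in> codes n. \<forall>j\<in>I. t j \<le> g j \<and> t' j \<le> h j}) \<le> R * (e t * e t')"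
    if t: "t \<in> V" "t' \<in> V" for t t'
  proof -
    define m where "m = (\<Sum>j=1..n. j * (t j + t' j))"
    have "real (card {(d, g, h) \<in> codes n. \<forall>j\<in>I. t j \<le> g j \<and> t' j \<le> h j}) \<le> real (if m \<le> n then nparts (n - m) else 0)"
      unfolding m_def I_def using t by (intro of_nat_mono card_codes_ge_le) (auto simp: V_def grid_def I_def)
    also have "\<dots> \<le> R * exp (- (x * real m))"
      using ratio[of "n - m"] R0 by (auto simp: of_nat_diff)
    also have "exp (- (x * real m)) = e t * e t'"
      unfolding e_def I_def m_def
      by (simp add: exp_sum[symmetric] sum_distrib_left sum_negf[symmetric] sum.distrib[symmetric] algebra_simps flip: exp_add)
    finally show ?thesis .
  qed
  have "(\<Sum>(d, g, h)\<in>codes n. (\<Prod>j\<in>I. \<Sum>a\<le>g j. D j a) * (\<Prod>j\<in>I. \<Sum>a\<le>h j. D j a))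
     = (\<Sum>(d, g, h)\<in>codes n. \<Sum>t\<in>V. \<Sum>t'\<in>V. W t * W t' * of_bool (\<forall>j\<in>I. t j \<le> g j \<and> t' j \<le> h j))"
  proof (intro sum.cong refl)
    fix p assume p: "p \<in> codes n"
    obtain d g h where P: "p = (d, g, h)" by (cases p) auto
    have le: "g j \<le> n" "h j \<le> n" for j using codes_part_le[of d g h n] p P by auto
    have "of_bool (\<forall>j\<in>I. t j \<le> g j) * W t * (of_bool (\<forall>j\<in>I. t' j \<le> h j) * W t')
       = W t * W t' * of_bool (\<forall>j\<in>I. t j \<le> g j \<and> t' j \<le> h j)" for t t'
      by auto
    then show "(case p of (d, g, h) \<Rightarrow> (\<Prod>j\<in>I. \<Sum>a\<le>g j. D j a) * (\<Prod>j\<in>I. \<Sum>a\<le>h j. D j a))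
      = (case p of (d, g, h) \<Rightarrow> \<Sum>t\<in>V. \<Sum>t'\<in>V. W t * W t' * of_bool (\<forall>j\<in>I. t j \<le> g j \<and> t' j \<le> h j))"
      unfolding P by (simp only: prod.case expand[OF le(1)] expand[OF le(2)] sum_product)
  qed
  also have "\<dots> = (\<Sum>t\<in>V. \<Sum>t'\<in>V. \<Sum>(d, g, h)\<in>codes n. W t * W t' * of_bool (\<forall>j\<in>I. t j \<le> g j \<and> t' j \<le> h j))"
    unfolding case_prod_unfold by (subst sum.swap, intro sum.cong refl, rule sum.swap)
  also have "\<dots> = (\<Sum>t\<in>V. \<Sum>t'\<in>V. W t * W t' * real (card {(d, g, h) \<in> codes n. \<forall>j\<in>I. t j \<le> g j \<and> t' j \<le> h j}))"
    unfolding real_card_codes by (simp only: case_prod_unfold sum_distrib_left)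
  also have "\<dots> \<le> (\<Sum>t\<in>V. \<Sum>t'\<in>V. W t * W t' * (R * (e t * e t')))"
    using W0 by (intro sum_mono mult_left_mono joint) auto
  also have "\<dots> = R * (\<Sum>t\<in>V. W t * e t)\<^sup>2"
    unfolding power2_eq_square sum_product by (simp add: sum_distrib_left mult_ac)
  also have "(\<Sum>t\<in>V. W t * e t) = (\<Prod>j\<in>I. \<Sum>a\<le>n. D j a * exp (- (x * real j * real a)))"
    unfolding W_def e_def prod.distrib[symmetric] V_def by (rule sum_prod_grid) (simp add: I_def)
  finally show ?thesis by (simp add: I_def)
qed

lemma sinh_le_mult_exp:
  fixes u :: real
  assumes "0 \<le> u"
  shows "sinh u \<le> u * exp u"
proof -
  have "exp u * (1 - exp (- (2 * u))) \<le> exp u * (2 * u)"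
    using exp_ge_add_one_self[of "- (2 * u)"] by (intro mult_left_mono) auto
  moreover have "exp u * (1 - exp (- (2 * u))) = exp u - exp (- u)"
    by (simp add: right_diff_distrib flip: exp_add)
  ultimately show ?thesis by (simp add: sinh_def field_simps)
qed

text \<open>The factor z^2 matters: it makes the final exponent quadratic in the weights, as for a
  Gaussian tail.\<close>

lemma cosh_increment_le:
  fixes z :: real
  assumes "0 \<le> z" "1 \<le> a"
  shows "cosh (z * real a) - cosh (z * real (a - 1)) \<le> z\<^sup>2 * real a * exp (2 * z * real a)"
proof -
  have "cosh (z * real (a - 1)) = cosh (z * real a - z)"
    using assms by (simp add: of_nat_diff algebra_simps)
  then have "cosh (z * real a) - cosh (z * real (a - 1)) = cosh (z * real a) * (1 - cosh z) + sinh (z * real a) * sinh z"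
    by (simp add: cosh_diff algebra_simps)
  also have "\<dots> \<le> sinh (z * real a) * sinh z"
    using cosh_real_ge_1[of z] by (simp add: mult_le_0_iff mult_nonneg_nonpos)
  also have "\<dots> \<le> (z * real a * exp (z * real a)) * (z * exp z)"
    using assms by (intro mult_mono sinh_le_mult_exp) auto
  also have "\<dots> = z\<^sup>2 * real a * exp (z * real a + z)"
    by (simp add: power2_eq_square exp_add)
  also have "\<dots> \<le> z\<^sup>2 * real a * exp (2 * z * real a)"
    using assms mult_left_mono[of 1 "real a" z] by (intro mult_left_mono) auto
  finally show ?thesis .
qed

lemma sum_cosh_increments_le:
  fixes z y :: real
  assumes "0 \<le> z" "4 * z \<le> y" "0 < y"
  shows "(\<Sum>a\<le>n. (if a = 0 then 1 else cosh (z * real a) - cosh (z * real (a - 1))) * exp (- (y * real a))) \<le> 1 + 4 * z\<^sup>2 / y\<^sup>2"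
proof -
  have "(\<Sum>a\<le>n. (if a = 0 then 1 else cosh (z * real a) - cosh (z * real (a - 1))) * exp (- (y * real a)))
     = 1 + (\<Sum>a=1..n. (cosh (z * real a) - cosh (z * real (a - 1))) * exp (- (y * real a)))"
  proof -
    have "{..n} = insert 0 {1..n}" by auto
    then show ?thesis by simp
  qed
  also have "(\<Sum>a=1..n. (cosh (z * real a) - cosh (z * real (a - 1))) * exp (- (y * real a)))
     \<le> (\<Sum>a=1..n. z\<^sup>2 * (real a * exp (- (y / 2 * real a))))"
  proof (rule sum_mono)
    fix a assume a: "a \<in> {1..n}"
    have "(cosh (z * real a) - cosh (z * real (a - 1))) * exp (- (y * real a)) \<le> z\<^sup>2 * real a * exp (2 * z * real a) * exp (- (y * real a))"
      using assms a by (intro mult_right_mono cosh_increment_le) auto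
    also have "\<dots> = z\<^sup>2 * real a * exp (2 * z * real a - y * real a)"
      by (simp add: exp_diff exp_minus field_simps)
    also have "\<dots> \<le> z\<^sup>2 * real a * exp (- (y / 2 * real a))"
    proof -
      have "4 * z * real a \<le> y * real a" using assms by (intro mult_right_mono) auto
      then show ?thesis by (intro mult_left_mono) auto
    qed
    finally show "(cosh (z * real a) - cosh (z * real (a - 1))) * exp (- (y * real a)) \<le> z\<^sup>2 * (real a * exp (- (y / 2 * real a)))"
      by (simp add: mult_ac)
  qed
  also have "\<dots> = z\<^sup>2 * (\<Sum>a=1..n. real a * exp (- (y / 2 * real a)))"
    by (simp add: sum_distrib_left)
  also have "\<dots> \<le> z\<^sup>2 * (1 / (y / 2)\<^sup>2)"
    using assms by (intro mult_left_mono sum_mult_exp_neg_le) auto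
  finally show ?thesis by (simp add: power_divide mult.commute)
qed

lemma cosh_eq_sum_increments:
  "cosh (z * real b) = (\<Sum>a\<le>b. if a = 0 then 1 else cosh (z * real a) - cosh (z * real (a - 1)))" for z :: real
  by (induction b) auto

text \<open>The exponential decreases in \<open>g\<close> and so has no nonnegative increments.
  After symmetrisation it is cosh of a difference, at most the product of two hyperbolic cosines,
  which separates \<open>g\<close> from \<open>h\<close> and is increasing. The condition
  \<open>4 * w j \<le> x * real j\<close> leaves half of the geometric decay.\<close>

lemma mgf_codes_le:
  fixes w :: "nat \<Rightarrow> real"
  assumes ratio: "\<And>N. real (nparts N) \<le> R * exp (x * (real N - real n))"
    and x: "0 < x" and w: "\<And>j. 0 \<le> w j" "\<And>j. j \<in> {1..n} \<Longrightarrow> 4 * w j \<le> x * real j"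
  shows "(\<Sum>(d, g, h)\<in>codes n. exp (\<Sum>j=1..n. w j * (real (h j) - real (g j))))
    \<le> R * exp (8 * (\<Sum>j=1..n. (w j)\<^sup>2 / (x * real j)\<^sup>2))"
proof -
  define D where "D = (\<lambda>j a. if a = 0 then 1 else cosh (w j * real a) - cosh (w j * real (a - 1)))"
  have D: "0 \<le> D j a" for j a
    unfolding D_def using w(1)[of j] by (auto simp: mult_left_mono intro!: cosh_real_nonneg_le_iff[THEN iffD2])
  have R0: "0 \<le> R" using ratio by (rule ratio_bound_nonneg)
  have "(\<Sum>(d, g, h)\<in>codes n. exp (\<Sum>j=1..n. w j * (real (h j) - real (g j))))
     = (\<Sum>(d, g, h)\<in>codes n. \<Prod>j=1..n. exp (w j * (real (h j) - real (g j))))"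
    by (simp add: exp_sum)
  also have "\<dots> = (\<Sum>(d, g, h)\<in>codes n. \<Prod>j=1..n. (exp (w j * (real (h j) - real (g j))) + exp (w j * (real (g j) - real (h j)))) / 2)"
    using sum_codes_symmetrize[of "{1..n}" "\<lambda>j a b. exp (w j * (real b - real a))" n] by simp
  also have "\<dots> \<le> (\<Sum>(d, g, h)\<in>codes n. (\<Prod>j=1..n. \<Sum>a\<le>g j. D j a) * (\<Prod>j=1..n. \<Sum>a\<le>h j. D j a))"
  proof (intro sum_mono)
    fix p :: "nat \<times> (nat \<Rightarrow> nat) \<times> (nat \<Rightarrow> nat)"
    obtain d g h where P: "p = (d, g, h)" by (cases p) auto
    have "(\<Prod>j=1..n. (exp (w j * (real (h j) - real (g j))) + exp (w j * (real (g j) - real (h j)))) / 2)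
       \<le> (\<Prod>j=1..n. cosh (w j * real (g j)) * cosh (w j * real (h j)))"
    proof (intro prod_mono conjI)
      fix j
      have "(exp (w j * (real (h j) - real (g j))) + exp (w j * (real (g j) - real (h j)))) / 2 = cosh (w j * real (g j) - w j * real (h j))"
        by (simp add: cosh_def algebra_simps)
      also have "\<dots> \<le> cosh (w j * real (g j)) * cosh (w j * real (h j))"
        using w(1)[of j] by (simp add: cosh_diff)
      finally show "(exp (w j * (real (h j) - real (g j))) + exp (w j * (real (g j) - real (h j)))) / 2 \<le> cosh (w j * real (g j)) * cosh (w j * real (h j))" .
    qed simp
    also have "\<dots> = (\<Prod>j=1..n. \<Sum>a\<le>g j. D j a) * (\<Prod>j=1..n. \<Sum>a\<le>h j. D j a)"
      unfolding D_def cosh_eq_sum_increments[symmetric] by (rule prod.distrib)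
    finally show "(case p of (d, g, h) \<Rightarrow> \<Prod>j=1..n. (exp (w j * (real (h j) - real (g j))) + exp (w j * (real (g j) - real (h j)))) / 2)
       \<le> (case p of (d, g, h) \<Rightarrow> (\<Prod>j=1..n. \<Sum>a\<le>g j. D j a) * (\<Prod>j=1..n. \<Sum>a\<le>h j. D j a))"
      unfolding P by simp
  qed
  also have "\<dots> \<le> R * (\<Prod>j=1..n. \<Sum>a\<le>n. D j a * exp (- (x * real j * real a)))\<^sup>2"
    using ratio D by (rule sum_codes_prod_le)
  also have "\<dots> \<le> R * (\<Prod>j=1..n. exp (4 * ((w j)\<^sup>2 / (x * real j)\<^sup>2)))\<^sup>2"
  proof (intro mult_left_mono power_mono prod_mono conjI prod_nonneg ballI R0)
    fix j assume j: "j \<in> {1..n}"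
    have "(\<Sum>a\<le>n. D j a * exp (- (x * real j * real a))) \<le> 1 + 4 * (w j)\<^sup>2 / (x * real j)\<^sup>2"
      unfolding D_def using j x w by (intro sum_cosh_increments_le) auto
    also have "\<dots> \<le> exp (4 * ((w j)\<^sup>2 / (x * real j)\<^sup>2))"
      using exp_ge_add_one_self[of "4 * ((w j)\<^sup>2 / (x * real j)\<^sup>2)"] by simp
    finally show "(\<Sum>a\<le>n. D j a * exp (- (x * real j * real a))) \<le> exp (4 * ((w j)\<^sup>2 / (x * real j)\<^sup>2))" .
    show "0 \<le> (\<Sum>a\<le>n. D j a * exp (- (x * real j * real a)))" using D by (intro sum_nonneg) auto
    then show "0 \<le> (\<Sum>a\<le>n. D j a * exp (- (x * real j * real a)))" .
  qed
  also have "(\<Prod>j=1..n. exp (4 * ((w j)\<^sup>2 / (x * real j)\<^sup>2)))\<^sup>2 = exp (8 * (\<Sum>j=1..n. (w j)\<^sup>2 / (x * real j)\<^sup>2))"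
    by (simp add: exp_sum[symmetric] sum_distrib_left flip: exp_double)
  finally show ?thesis .
qed

text \<open>Chernoff's bound with parameter \<theta>.\<close>

lemma card_codes_tail_le:
  fixes w :: "nat \<Rightarrow> real"
  assumes ratio: "\<And>N. real (nparts N) \<le> R * exp (x * (real N - real n))"
    and "0 < x" "0 \<le> \<theta>" "\<And>j. 0 \<le> w j" "\<And>j. j \<in> {1..n} \<Longrightarrow> 4 * (\<theta> * w j) \<le> x * real j"
  shows "real (card {(d, g, h) \<in> codes n. E < (\<Sum>j=1..n. w j * (real (h j) - real (g j)))})
    \<le> R * exp (8 * (\<theta> / x)\<^sup>2 * (\<Sum>j=1..n. (w j / real j)\<^sup>2) - \<theta> * E)"
proof -
  define X where "X = (\<lambda>g h :: nat \<Rightarrow> nat. \<Sum>j=1..n. w j * (real (h j) - real (g j)))"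
  have "real (card {(d, g, h) \<in> codes n. E < X g h}) = (\<Sum>(d, g, h)\<in>codes n. of_bool (E < X g h))"
    by (rule real_card_codes)
  also have "\<dots> \<le> (\<Sum>(d, g, h)\<in>codes n. exp (- (\<theta> * E)) * exp (\<theta> * X g h))"
    using assms(3) by (intro sum_mono) (auto simp: mult_left_mono simp flip: exp_add)
  also have "\<dots> = exp (- (\<theta> * E)) * (\<Sum>(d, g, h)\<in>codes n. exp (\<Sum>j=1..n. \<theta> * w j * (real (h j) - real (g j))))"
    by (simp add: X_def sum_distrib_left case_prod_unfold mult_ac)
  also have "\<dots> \<le> exp (- (\<theta> * E)) * (R * exp (8 * (\<Sum>j=1..n. (\<theta> * w j)\<^sup>2 / (x * real j)\<^sup>2)))"
    using assms by (intro mult_left_mono mgf_codes_le) auto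
  also have "(\<Sum>j=1..n. (\<theta> * w j)\<^sup>2 / (x * real j)\<^sup>2) = (\<theta> / x)\<^sup>2 * (\<Sum>j=1..n. (w j / real j)\<^sup>2)"
    by (simp add: sum_distrib_left power_mult_distrib power_divide)
  finally show ?thesis by (simp add: X_def exp_diff exp_minus field_simps)
qed

section \<open>Codes with a small Durfee square or with many small pairs\<close>

lemma card_codes_small_size_le:
  "card {(d, g, h) \<in> codes n. d < D} \<le> D * (n + 1) ^ (2 * D)"
proof -
  define V where "V = grid {1..D} (\<lambda>_. n)"
  \<comment> \<open>Mere support and size of \<open>g\<close> and \<open>h\<close> are used. The
    resulting power of \<open>n\<close> is crude, but \<open>D\<close> will stay below n^(23/50), so
    it is negligible against exp of a multiple of \<surd>n.\<close>
  have "{(d, g, h) \<in> codes n. d < D} \<subseteq> {..<D} \<times> V \<times> V"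
  proof
    fix p assume p: "p \<in> {(d, g, h) \<in> codes n. d < D}"
    then obtain d g h where P: "p = (d, g, h)" "(d, g, h) \<in> codes n" "d < D" by auto
    have "g \<in> V" "h \<in> V"
      using P codes_part_le[OF P(2)] by (auto simp: V_def grid_def codes_def)
    then show "p \<in> {..<D} \<times> V \<times> V" using P by simp
  qed
  then have "card {(d, g, h) \<in> codes n. d < D} \<le> card ({..<D} \<times> V \<times> V)"
    by (intro card_mono) (auto simp: V_def)
  also have "\<dots> = D * (n + 1) ^ (2 * D)"
    by (simp add: card_cartesian_product V_def card_grid mult_2 power_add)
  finally show ?thesis .
qed

text \<open>Adding to \<open>g j\<close> any of the multiples 0, ..., q of \<open>t j\<close> is
  reversible, because \<open>g j\<close> is smaller than \<open>t j\<close> and the multiple is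
  recovered by division. Each code thus yields \<open>(q + 1) ^ card B\<close> codes of slightly
  larger partitions; the added columns fit since \<open>B\<close> lies below the Durfee
  side.\<close>

lemma card_codes_small_pairs_le:
  assumes "B \<subseteq> {1..D}" "\<And>j. j \<in> B \<Longrightarrow> 0 < t j"
  shows "(q + 1) ^ card B * card {(d, g, h) \<in> codes n. D \<le> d \<and> (\<forall>j\<in>B. g j + h j < t j)}
    \<le> (\<Sum>m\<le>q * (\<Sum>j\<in>B. j * t j). nparts (n + m))"
proof -
  define S where "S = {(d, g, h) \<in> codes n. D \<le> d \<and> (\<forall>j\<in>B. g j + h j < t j)}"
  define M where "M = q * (\<Sum>j\<in>B. j * t j)"
  define V where "V = grid B (\<lambda>_. q)"
  define \<phi> where "\<phi> = (\<lambda>((d, g, h), f). (d :: nat, \<lambda>j. g j + f j * t j, h :: nat \<Rightarrow> nat))"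
  have finB: "finite B" using assms(1) finite_subset by blast
  have finS: "finite S"
    by (rule finite_subset[OF _ finite_codes[of n]]) (auto simp: S_def)
  have img: "\<phi> ((d, g, h), f) \<in> (\<Union>m\<le>M. codes (n + m))" if S: "(d, g, h) \<in> S" and f: "f \<in> V" for d g h f
  proof -
    define m where "m = (\<Sum>j\<in>B. j * (f j * t j))"
    have "m \<le> (\<Sum>j\<in>B. q * (j * t j))"
      unfolding m_def using f by (intro sum_mono) (auto simp: V_def grid_def)
    then have m: "m \<le> M" by (simp add: M_def sum_distrib_left)
    have Bd: "B \<subseteq> {1..d}" using assms(1) S by (auto simp: S_def)
    have f0: "f j = 0" if "j \<notin> B" for j using f that by (auto simp: V_def grid_def)
    have "m = (\<Sum>j=1..d. j * (f j * t j))"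
      unfolding m_def using Bd f0 by (intro sum.mono_neutral_left) auto
    then have "d * d + (\<Sum>j=1..d. j * (g j + f j * t j + h j)) = n + m"
      using S by (auto simp: S_def codes_def algebra_simps sum.distrib)
    moreover have "f j = 0" if "j \<notin> {1..d}" for j using f0[of j] Bd that by blast
    ultimately have "\<phi> ((d, g, h), f) \<in> codes (n + m)"
      using S by (auto simp: \<phi>_def S_def codes_def)
    then show ?thesis using m by blast
  qed
  have "inj_on \<phi> (S \<times> V)"
  proof
    fix p p' assume p: "p \<in> S \<times> V" "p' \<in> S \<times> V" "\<phi> p = \<phi> p'"
    obtain d g h f d' g' h' f' where P: "p = ((d, g, h), f)" "p' = ((d', g', h'), f')" by (metis prod.exhaust)
    have eq: "d' = d" "h' = h" "g j + f j * t j = g' j + f' j * t j" for j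
      using p(3) unfolding P by (auto simp: \<phi>_def fun_eq_iff)
    have ff: "f j = f' j" for j
    proof (cases "j \<in> B")
      case True
      have less: "g j + h j < t j" "g' j + h j < t j" using p True eq unfolding P by (auto simp: S_def)
      have "f j = (g j + f j * t j) div t j" using less(1) by simp
      also have "\<dots> = f' j" unfolding eq(3) using less(2) by simp
      finally show ?thesis .
    qed (use p in \<open>auto simp: P V_def grid_def\<close>)
    then have "g j = g' j" for j using eq(3)[of j] by simp
    then show "p = p'" using ff eq unfolding P by (auto simp: fun_eq_iff)
  qed
  moreover have "\<phi> ` (S \<times> V) \<subseteq> (\<Union>m\<le>M. codes (n + m))" using img by auto
  ultimately have "card (S \<times> V) \<le> card (\<Union>m\<le>M. codes (n + m))"
    by (intro card_inj_on_le) auto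
  also have "\<dots> \<le> (\<Sum>m\<le>M. card (codes (n + m)))" by (intro card_UN_le) auto
  finally show ?thesis
    using finB by (simp add: card_cartesian_product V_def card_grid card_codes S_def M_def mult.commute)
qed

text \<open>A union bound over the sets \<open>B\<close> of small pairs with at least half the size
  of \<open>H\<close>. With q = 19 each \<open>B\<close> gains 20^|B| and loses at most e^|B|, a
  ratio below (4/25)^|B|, hence at most (2/5)^|H|; the number of sets is at most 2^|H|.\<close>

lemma card_codes_many_small_pairs_le:
  assumes ratio: "\<And>N. real (nparts N) \<le> R * exp (x * (real N - real n))"
    and x: "0 < x" and H: "H \<subseteq> {1..D}" and t: "\<And>j. j \<in> H \<Longrightarrow> 0 < t j \<and> 19 * x * (real j * real (t j)) \<le> 1"
  shows "real (card {(d, g, h) \<in> codes n. D \<le> d \<and> card H \<le> 2 * card {j \<in> H. g j + h j < t j}})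
    \<le> (real (card H) / x + 1) * R * (4 / 5) ^ card H"
proof -
  define S where "S = (\<lambda>B. {(d, g, h) \<in> codes n. D \<le> d \<and> (\<forall>j\<in>B. g j + h j < t j)})"
  have finH: "finite H" using H finite_subset by blast
  have R0: "0 \<le> R" using ratio by (rule ratio_bound_nonneg)
  have finS: "finite (S B)" for B
    by (rule finite_subset[OF _ finite_codes[of n]]) (auto simp: S_def)
  have S_le: "real (card (S B)) \<le> (real (card H) / x + 1) * R * (2 / 5) ^ card H"
    if B: "B \<subseteq> H" "card H \<le> 2 * card B" for B
  proof -
    have finB: "finite B" using B finH finite_subset by blast
    have cB: "card B \<le> card H" using B finH card_mono by blast
    define M where "M = 19 * (\<Sum>j\<in>B. j * t j)"
    have "x * real M = (\<Sum>j\<in>B. 19 * x * (real j * real (t j)))"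
      by (simp add: M_def sum_distrib_left mult_ac)
    also have "\<dots> \<le> (\<Sum>j\<in>B. 1)" using t B by (intro sum_mono) auto
    finally have xM: "x * real M \<le> real (card B)" by simp
    then have M: "real M \<le> real (card H) / x"
      using x cB by (simp add: pos_le_divide_eq mult.commute order_trans[OF _ of_nat_mono])
    have "20 ^ card B * card (S B) \<le> (\<Sum>m\<le>M. nparts (n + m))"
      unfolding S_def M_def using card_codes_small_pairs_le[of B D t 19 n] B H t by auto
    then have "real (20 ^ card B * card (S B)) \<le> real (\<Sum>m\<le>M. nparts (n + m))" by (rule of_nat_mono)
    then have "20 ^ card B * real (card (S B)) \<le> (\<Sum>m\<le>M. real (nparts (n + m)))" by simp
    also have "\<dots> \<le> (\<Sum>m\<le>M. R * exp (real (card B)))"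
    proof (intro sum_mono)
      fix m assume "m \<in> {..M}"
      then have "x * real m \<le> x * real M" using x by (intro mult_left_mono) auto
      then have "R * exp (x * real m) \<le> R * exp (real (card B))" using xM R0 by (intro mult_left_mono) auto
      then show "real (nparts (n + m)) \<le> R * exp (real (card B))" using ratio[of "n + m"] by simp
    qed
    also have "\<dots> = (real M + 1) * R * exp (real (card B))" by simp
    also have "\<dots> \<le> (real (card H) / x + 1) * R * exp (real (card B))"
      using M R0 by (intro mult_right_mono) auto
    also have "exp (real (card B)) = exp 1 ^ card B"
      by (simp flip: exp_of_nat_mult)
    also have "exp (1 :: real) ^ card B \<le> (16 / 5) ^ card B"
      using e_less_272 by (intro power_mono) auto
    also have "(16 / 5 :: real) ^ card B = 20 ^ card B * ((2 / 5)\<^sup>2) ^ card B"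
      by (simp add: power2_eq_square flip: power_mult_distrib)
    also have "((2 / 5 :: real)\<^sup>2) ^ card B \<le> (2 / 5) ^ card H"
      using B by (simp add: power_decreasing flip: power_mult)
    finally have "20 ^ card B * real (card (S B)) \<le> (real (card H) / x + 1) * R * (20 ^ card B * (2 / 5) ^ card H)"
      using R0 x by (simp add: mult_left_mono)
    then show ?thesis by (simp add: mult_ac)
  qed
  have "{(d, g, h) \<in> codes n. D \<le> d \<and> card H \<le> 2 * card {j \<in> H. g j + h j < t j}}
      \<subseteq> (\<Union>B\<in>{B \<in> Pow H. card H \<le> 2 * card B}. S B)"
  proof
    fix p assume p: "p \<in> {(d, g, h) \<in> codes n. D \<le> d \<and> card H \<le> 2 * card {j \<in> H. g j + h j < t j}}"
    obtain d g h where P: "p = (d, g, h)" by (cases p) auto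
    have "p \<in> S {j \<in> H. g j + h j < t j}" using p unfolding P by (auto simp: S_def)
    moreover have "{j \<in> H. g j + h j < t j} \<in> {B \<in> Pow H. card H \<le> 2 * card B}" using p unfolding P by auto
    ultimately show "p \<in> (\<Union>B\<in>{B \<in> Pow H. card H \<le> 2 * card B}. S B)" by (rule UN_I[rotated])
  qed
  then have "card {(d, g, h) \<in> codes n. D \<le> d \<and> card H \<le> 2 * card {j \<in> H. g j + h j < t j}}
      \<le> card (\<Union>B\<in>{B \<in> Pow H. card H \<le> 2 * card B}. S B)"
    using finS finH by (intro card_mono) auto
  also have "\<dots> \<le> (\<Sum>B\<in>{B \<in> Pow H. card H \<le> 2 * card B}. card (S B))"
    using finH by (intro card_UN_le) auto
  finally have "real (card {(d, g, h) \<in> codes n. D \<le> d \<and> card H \<le> 2 * card {j \<in> H. g j + h j < t j}})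
      \<le> real (\<Sum>B\<in>{B \<in> Pow H. card H \<le> 2 * card B}. card (S B))"
    by (rule of_nat_mono)
  also have "\<dots> = (\<Sum>B\<in>{B \<in> Pow H. card H \<le> 2 * card B}. real (card (S B)))"
    by (rule of_nat_sum)
  also have "\<dots> \<le> (\<Sum>B\<in>{B \<in> Pow H. card H \<le> 2 * card B}. (real (card H) / x + 1) * R * (2 / 5) ^ card H)"
    by (intro sum_mono S_le) auto
  also have "\<dots> \<le> (\<Sum>B\<in>Pow H. (real (card H) / x + 1) * R * (2 / 5) ^ card H)"
    using finH R0 x by (intro sum_mono2) auto
  also have "\<dots> = (real (card H) / x + 1) * R * (2 ^ card H * (2 / 5) ^ card H)"
    using finH by (simp add: card_Pow)
  also have "(2 :: real) ^ card H * (2 / 5) ^ card H = (4 / 5) ^ card H"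
    by (simp flip: power_mult_distrib)
  finally show ?thesis .
qed

text \<open>On a fibre of \<open>\<kappa>\<close>, given by \<open>d\<close> and the sums
  \<open>s\<close>, the function \<open>g\<close> runs through a full grid and determines
  \<open>h\<close>. How many coordinates are large depends on \<open>s\<close> only, and the block
  sums depend on disjoint sets of coordinates. Summation over fibres is exact, so no power of
  \<open>n\<close> is lost in front of \<open>q ^ M\<close>.\<close>

lemma card_codes_persistent_le:
  fixes w :: "nat \<Rightarrow> nat \<Rightarrow> real" and K :: "nat \<Rightarrow> nat"
  assumes q: "0 \<le> q" "\<And>m. m < M \<Longrightarrow> 1 / 2 + (E m / \<delta> + 1) / sqrt (real (N m) + 1) \<le> q"
    and B: "\<And>m. m < M \<Longrightarrow> B m \<subseteq> {1..D}" "disjoint_family_on B {..<M}"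
    and E: "0 < \<delta>" "\<And>m. m < M \<Longrightarrow> 0 \<le> E m"
  shows "real (card {(d, g, h) \<in> codes n. D \<le> d \<and> (\<forall>m<M.
      N m \<le> card {j \<in> B m. \<delta> \<le> 2 * w m j * real ((g j + h j + 1) div 2)} \<and>
      - E m \<le> (\<Sum>j\<in>B m. w m j * (real (h j) - real (g j))))}) \<le> q ^ M * real (nparts n)"
proof -
  define many where "many = (\<lambda>s. \<forall>m<M. N m \<le> card {j \<in> B m. \<delta> \<le> 2 * w m j * real ((s j + 1) div 2)})"
  define S where "S = {(d, g, h) \<in> codes n. D \<le> d \<and> many (\<lambda>j. g j + h j) \<and> (\<forall>m<M. - E m \<le> (\<Sum>j\<in>B m. w m j * (real (h j) - real (g j))))}"
  define \<kappa> where "\<kappa> = (\<lambda>(d :: nat, g, h). (d, \<lambda>j :: nat. g j + h j :: nat))"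
  define fib where "fib = (\<lambda>k. {p \<in> codes n. \<kappa> p = k})"
  have S_sub: "S \<subseteq> codes n" by (auto simp: S_def)
  have finS: "finite S" using S_sub finite_codes finite_subset by blast
  have fibre: "real (card {p \<in> S. \<kappa> p = k}) \<le> q ^ M * real (card (fib k))" if k: "k \<in> \<kappa> ` codes n" for k
  proof -
    obtain d0 g0 h0 where c0: "(d0, g0, h0) \<in> codes n" "k = \<kappa> (d0, g0, h0)" using k by auto
    define s where "s = (\<lambda>j. g0 j + h0 j)"
    have k_eq: "k = (d0, s)" using c0 by (simp add: \<kappa>_def s_def)
    have s0: "s j = 0" if "j \<notin> {1..d0}" for j using c0(1) that by (auto simp: s_def codes_def)
    have bij: "bij_betw (\<lambda>g. (d0, g, \<lambda>j. s j - g j)) (grid {1..d0} s) (fib k)"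
    proof (rule bij_betw_byWitness[where f' = "\<lambda>(d, g, h). g"])
      show "(\<lambda>g. (d0, g, \<lambda>j. s j - g j)) ` grid {1..d0} s \<subseteq> fib k"
      proof (intro subsetI, elim imageE)
        fix p g assume g: "g \<in> grid {1..d0} s" "p = (d0, g, \<lambda>j. s j - g j)"
        have le: "g j \<le> s j" for j using g(1) by (cases "j \<in> {1..d0}") (auto simp: grid_def)
        then have add: "g j + (s j - g j) = s j" for j by simp
        have "d0 * d0 + (\<Sum>j=1..d0. j * s j) = n" using c0(1) by (simp add: codes_def s_def)
        then have "p \<in> codes n" using g s0 by (auto simp: codes_def add grid_def)
        then show "p \<in> fib k" by (simp add: fib_def \<kappa>_def k_eq g(2) add)
      qed
      show "(\<lambda>(d, g, h). g) ` fib k \<subseteq> grid {1..d0} s"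
        by (auto simp: fib_def \<kappa>_def k_eq grid_def codes_def)
      have "s j - g j = h j" if "\<forall>j. g j + h j = s j" for g h j
        using that by (metis add_diff_cancel_left')
      then show "\<forall>p\<in>fib k. (d0, case p of (d, g, h) \<Rightarrow> g, \<lambda>j. s j - (case p of (d, g, h) \<Rightarrow> g) j) = p"
        by (auto simp: fib_def \<kappa>_def k_eq fun_eq_iff)
    qed auto
    have card_fib: "card (fib k) = card (grid {1..d0} s)" using bij_betw_same_card[OF bij] by simp
    show ?thesis
    proof (cases "D \<le> d0 \<and> many s")
      case False
      have empty: "{p \<in> S. \<kappa> p = k} = {}"
        using False by (auto simp: S_def \<kappa>_def k_eq)
      show ?thesis unfolding empty using q by simp
    next
      case True
      define Q where "Q = (\<lambda>m g. - E m \<le> (\<Sum>j\<in>B m. w m j * (real (s j) - 2 * real (g j))))"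
      have Bd: "B m \<subseteq> {1..d0}" if "m < M" for m using B(1)[OF that] True by auto
      have fst_bij: "inj_on (\<lambda>(d, g, h). g) (fib k)"
        by (auto simp: inj_on_def fib_def \<kappa>_def k_eq fun_eq_iff) (metis add_left_cancel)
      have "(\<lambda>(d, g, h). g) ` {p \<in> S. \<kappa> p = k} \<subseteq> {g \<in> grid {1..d0} s. \<forall>m<M. Q m (restrict0 (B m) g)}"
      proof (intro subsetI, elim imageE)
        fix g' p assume p: "p \<in> {p \<in> S. \<kappa> p = k}" "g' = (case p of (d, g, h) \<Rightarrow> g)"
        obtain d g h where P: "p = (d, g, h)" by (cases p) auto
        have d: "d = d0" and gh: "g j + h j = s j" for j using p unfolding P by (auto simp: \<kappa>_def k_eq fun_eq_iff)
        have "g j \<le> s j" "j \<notin> {1..d0} \<Longrightarrow> g j = 0" for j using gh[of j] s0[of j] by linarith+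
        then have "g \<in> grid {1..d0} s" unfolding grid_def by blast
        moreover have "Q m (restrict0 (B m) g)" if "m < M" for m
        proof -
          have "(\<Sum>j\<in>B m. w m j * (real (s j) - 2 * real (restrict0 (B m) g j))) = (\<Sum>j\<in>B m. w m j * (real (h j) - real (g j)))"
            by (intro sum.cong refl) (simp add: restrict0_def flip: gh)
          then show ?thesis using p that unfolding P Q_def by (auto simp: S_def)
        qed
        ultimately show "g' \<in> {g \<in> grid {1..d0} s. \<forall>m<M. Q m (restrict0 (B m) g)}" using p unfolding P by simp
      qed
      then have "card {p \<in> S. \<kappa> p = k} \<le> card {g \<in> grid {1..d0} s. \<forall>m<M. Q m (restrict0 (B m) g)}"
        using S_sub by (intro card_inj_on_le[where f = "\<lambda>(d, g, h). g"] inj_on_subset[OF fst_bij]) (auto simp: fib_def)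
      then have "real (card {p \<in> S. \<kappa> p = k}) \<le> real (card {g \<in> grid {1..d0} s. \<forall>m<M. Q m (restrict0 (B m) g)})" by simp
      also have "\<dots> \<le> q ^ M * real (card (grid {1..d0} s))"
      proof (rule card_independent_blocks_le)
        fix m assume m: "m < M"
        have "real (card {g \<in> grid (B m) s. Q m g}) \<le> (1 / 2 + (E m / \<delta> + 1) / sqrt (real (N m) + 1)) * real (card (grid (B m) s))"
          unfolding Q_def using True m E finite_subset[OF Bd[OF m]]
          by (intro card_grid_ge_neg_le) (auto simp: many_def)
        also have "\<dots> \<le> q * real (card (grid (B m) s))"
          using q(2)[OF m] by (intro mult_right_mono) auto
        finally show "real (card {g \<in> grid (B m) s. Q m g}) \<le> q * real (card (grid (B m) s))" .
      qed (use q Bd B in auto)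
      finally show ?thesis by (simp add: card_fib)
    qed
  qed
  have "(\<Sum>k\<in>\<kappa> ` codes n. \<Sum>p\<in>{p \<in> S. \<kappa> p = k}. 1 :: real) = (\<Sum>p\<in>S. 1)"
    using finS S_sub by (intro sum.group) auto
  then have "real (card S) = (\<Sum>k\<in>\<kappa> ` codes n. real (card {p \<in> S. \<kappa> p = k}))"
    by simp
  also have "\<dots> \<le> (\<Sum>k\<in>\<kappa> ` codes n. q ^ M * real (card (fib k)))"
    by (intro sum_mono fibre)
  also have "\<dots> = q ^ M * (\<Sum>k\<in>\<kappa> ` codes n. real (card (fib k)))"
    by (simp add: sum_distrib_left)
  also have "(\<Sum>k\<in>\<kappa> ` codes n. real (card (fib k))) = real (card (codes n))"
  proof -
    have "(\<Sum>k\<in>\<kappa> ` codes n. \<Sum>p\<in>{p \<in> codes n. \<kappa> p = k}. 1 :: real) = (\<Sum>p\<in>codes n. 1)"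
      by (intro sum.group) auto
    then show ?thesis by (simp add: fib_def)
  qed
  finally show ?thesis
    by (simp add: S_def many_def card_codes all_conj_distrib imp_conjR conj_ac)
qed

section \<open>Persistence across well separated scales\<close>

lemma sum_inverse_squares_tail_le:
  assumes "0 < b"
  shows "(\<Sum>j\<in>{b<..n}. 1 / (real j)\<^sup>2) \<le> 1 / real b"
proof (cases "b \<le> n")
  case True
  then obtain k where k: "n = b + k" using le_Suc_ex by blast
  have un: "{1..n} = {1..b} \<union> {b<..n}" using True by auto
  have "(\<Sum>j=1..n. 1 / (real j)\<^sup>2) = (\<Sum>j=1..b. 1 / (real j)\<^sup>2) + (\<Sum>j\<in>{b<..n}. 1 / (real j)\<^sup>2)"
    unfolding un by (rule sum.union_disjoint) auto
  moreover have "0 \<le> 1 / real (b + k)" by simp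
  ultimately show ?thesis
    using sum_inverse_squares_telescope[OF assms, of k] unfolding k by linarith
qed simp

text \<open>Up to \<open>a\<close> every index contributes 1, and beyond the block of ratio \<rho>^2
  the tail of K^2/j^2 contributes at most K^2/(a \<rho>^2). Taking K = a\<rho>, the geometric mean
  of the ends of the block, balances the two at \<open>a\<close>.\<close>

lemma off_block_weight_le:
  fixes a \<rho> n :: nat
  assumes "0 < a" "0 < \<rho>"
  shows "(\<Sum>j=1..n. ((if j \<in> {a<..a * \<rho> * \<rho>} then 0 else real (min j (a * \<rho>))) / real j)\<^sup>2) \<le> 2 * real a"
proof -
  define K where "K = a * \<rho>"
  define b where "b = K * \<rho>"
  have pos: "0 < K" "0 < b" using assms by (auto simp: K_def b_def)
  have "a * 1 \<le> a * \<rho>" using assms by (intro mult_le_mono2) auto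
  then have aK: "a \<le> K" by (simp add: K_def)
  have "K * 1 \<le> K * \<rho>" using assms by (intro mult_le_mono2) auto
  then have Kb: "K \<le> b" by (simp add: b_def)
  have "(\<Sum>j=1..n. ((if j \<in> {a<..b} then 0 else real (min j K)) / real j)\<^sup>2)
     \<le> (\<Sum>j=1..n. of_bool (j \<le> a) + of_bool (b < j) * ((real K)\<^sup>2 * (1 / (real j)\<^sup>2)))"
    using aK Kb by (intro sum_mono) (auto simp: power_divide)
  also have "\<dots> = (\<Sum>j=1..n. of_bool (j \<le> a)) + (\<Sum>j=1..n. of_bool (b < j) * ((real K)\<^sup>2 * (1 / (real j)\<^sup>2)))"
    by (rule sum.distrib)
  also have "(\<Sum>j=1..n. of_bool (j \<le> a) :: real) \<le> real a"
  proof -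
    have "(\<Sum>j=1..n. of_bool (j \<le> a) :: real) = real (card {j \<in> {1..n}. j \<le> a})"
      by (rule real_card_filter [symmetric]) simp
    also have "card {j \<in> {1..n}. j \<le> a} \<le> card {1..a}"
      by (intro card_mono) auto
    finally show ?thesis by simp
  qed
  also have "(\<Sum>j=1..n. of_bool (b < j) * ((real K)\<^sup>2 * (1 / (real j)\<^sup>2))) = (real K)\<^sup>2 * (\<Sum>j\<in>{b<..n}. 1 / (real j)\<^sup>2)"
    unfolding sum_distrib_left by (intro sum.mono_neutral_cong_right) auto
  also have "\<dots> \<le> (real K)\<^sup>2 * (1 / real b)"
    using pos by (intro mult_left_mono sum_inverse_squares_tail_le) auto
  also have "\<dots> = real a"
    using assms by (simp add: b_def K_def power2_eq_square)
  finally show ?thesis unfolding K_def b_def by simp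
qed

text \<open>A graphical code has a Durfee side below the top scale, or at some scale a large
  contribution from outside the block, or at some scale too few large pairs, or else survives at
  every scale with at least the required supply of large coordinates. The four summands bound these
  cases.\<close>

lemma card_graphical_codes_le:
  fixes \<rho> n M m0 :: nat and x r q R :: real
  defines "D \<equiv> \<rho> ^ (2 * (m0 + M))"
  assumes ratio: "\<And>N. real (nparts N) \<le> R * exp (x * (real N - real n))"
    and x: "0 < x" and \<rho>: "2 \<le> \<rho>" and r: "1 \<le> r" "r \<le> 8 * sqrt (real (\<rho> ^ (2 * m0)))"
    and D: "38 * x * real D \<le> 1" and q: "1 / 2 + 78 * r / sqrt (real \<rho>) \<le> q"
  shows "real (card {p \<in> codes n. graphical (decode p)})
    \<le> real (D * (n + 1) ^ (2 * D)) + real M * (R * exp (- (r\<^sup>2 / 64)))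
      + real M * ((real D / x + 1) * R * (4 / 5) ^ (\<rho> ^ (2 * m0))) + q ^ M * real (nparts n)"
proof -
  define a where "a = (\<lambda>m. \<rho> ^ (2 * (m0 + m)))"
  define K where "K = (\<lambda>m. a m * \<rho>)"
  define B where "B = (\<lambda>m. {a m<..a m * \<rho> * \<rho>})"
  define H where "H = (\<lambda>m. {a m<..K m})"
  define w where "w = (\<lambda>m j. real (min j (K m)))"
  define v where "v = (\<lambda>m j. if j \<in> B m then 0 else w m j)"
  \<comment> \<open>A constant times 1/x, the typical size of j(g_j + h_j). The value 38 is twice
    the 19 of the small-pair count, so \<delta> and \<open>D\<close> each use up half of the
    allowance there.\<close>
  define \<delta> where "\<delta> = 1 / (38 * x)"
  define E where "E = (\<lambda>m. r * sqrt (real (a m)) / x)"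
  define t where "t = (\<lambda>j :: nat. nat \<lceil>\<delta> / real j\<rceil>)"
  define N where "N = (\<lambda>m. card (H m) div 2)"
  have R0: "0 \<le> R" using ratio by (rule ratio_bound_nonneg)
  have \<delta>0: "\<delta> > 0" using x by (simp add: \<delta>_def)
  have a1: "1 \<le> a m" for m using \<rho> by (simp add: a_def)
  have a_Suc: "a m * \<rho> * \<rho> = a (Suc m)" for m by (simp add: a_def)
  have a_mono: "a m \<le> a m'" if "m \<le> m'" for m m' using that \<rho> by (simp add: a_def power_increasing)
  have aM: "a M = D" by (simp add: a_def D_def)
  have a_0: "\<rho> ^ (2 * m0) \<le> a m" for m using a_mono[of 0 m] by (simp add: a_def)
  have bD: "a m * \<rho> * \<rho> \<le> D" if "m < M" for m using a_mono[of "Suc m" M] that aM a_Suc by simp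
  have KD: "K m \<le> D" if "m < M" for m
  proof -
    have "K m \<le> K m * \<rho>" using \<rho> by simp
    then show ?thesis using bD[OF that] unfolding K_def by (rule order_trans)
  qed
  have B_sub: "B m \<subseteq> {1..D}" if "m < M" for m using bD[OF that] a1[of m] by (auto simp: B_def)
  have aK: "a m \<le> K m" "2 * a m \<le> K m" for m using \<rho> by (simp_all add: K_def)
  have Kb: "K m \<le> a m * \<rho> * \<rho>" for m using \<rho> by (simp add: K_def)
  have H_sub: "H m \<subseteq> B m" for m by (auto simp: H_def B_def intro: order_trans[OF _ Kb])
  have disj: "disjoint_family_on B {..<M}"
    unfolding disjoint_family_on_def
  proof (intro ballI impI)
    have "B m \<inter> B m' = {}" if "m < m'" for m m'
      using a_mono[of "Suc m" m'] that unfolding B_def a_Suc by auto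
    then show "B m \<inter> B m' = {}" if "m \<noteq> m'" for m m'
      using that by (metis Int_commute linorder_neqE_nat)
  qed
  have cardH: "card (H m) = K m - a m" "a m \<le> card (H m)" for m using aK[of m] by (auto simp: H_def)
  have t: "0 < t j" "19 * x * (real j * real (t j)) \<le> 1" if j: "j \<in> H m" and m: "m < M" for j m
  proof -
    have j0: "0 < j" using j by (simp add: H_def)
    have "0 < \<delta> / real j" using \<delta>0 j0 by simp
    then show "0 < t j" by (simp add: t_def)
    have "real (t j) \<le> \<delta> / real j + 1" using \<open>0 < \<delta> / real j\<close> unfolding t_def by linarith
    then have "real j * real (t j) \<le> real j * (\<delta> / real j + 1)" by (intro mult_left_mono) auto
    also have "\<dots> = \<delta> + real j" using j0 by (simp add: field_simps)
    also have "real j \<le> real D" using j KD[OF m] by (simp add: H_def)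
    finally have "19 * x * (real j * real (t j)) \<le> 19 * x * (\<delta> + real D)" using x by (intro mult_left_mono) auto
    also have "\<dots> = 1 / 2 + 38 * x * real D / 2" using x by (simp add: \<delta>_def field_simps)
    also have "\<dots> \<le> 1" using D by simp
    finally show "19 * x * (real j * real (t j)) \<le> 1" .
  qed
  define S1 where "S1 = {(d, g, h) \<in> codes n. d < D}"
  define S2 where "S2 = (\<lambda>m. {(d, g, h) \<in> codes n. E m < (\<Sum>j=1..n. v m j * (real (h j) - real (g j)))})"
  define S3 where "S3 = (\<lambda>m. {(d, g, h) \<in> codes n. D \<le> d \<and> card (H m) \<le> 2 * card {j \<in> H m. g j + h j < t j}})"
  define S4 where "S4 = {(d, g, h) \<in> codes n. D \<le> d \<and> (\<forall>m<M.
      N m \<le> card {j \<in> B m. \<delta> \<le> 2 * w m j * real ((g j + h j + 1) div 2)} \<and>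
      - E m \<le> (\<Sum>j\<in>B m. w m j * (real (h j) - real (g j))))}"
  have cover: "{p \<in> codes n. graphical (decode p)} \<subseteq> S1 \<union> (\<Union>m<M. S2 m) \<union> (\<Union>m<M. S3 m) \<union> S4"
  proof
    fix p assume p: "p \<in> {p \<in> codes n. graphical (decode p)}"
    obtain d g h where P: "p = (d, g, h)" by (cases p) auto
    have cod: "(d, g, h) \<in> codes n" and gr: "graphical (decode (d, g, h))" using p P by auto
    show "p \<in> S1 \<union> (\<Union>m<M. S2 m) \<union> (\<Union>m<M. S3 m) \<union> S4"
    proof (rule ccontr)
      assume "p \<notin> S1 \<union> (\<Union>m<M. S2 m) \<union> (\<Union>m<M. S3 m) \<union> S4"
      then have n1: "p \<notin> S1" and n2: "\<And>m. m < M \<Longrightarrow> p \<notin> S2 m" and n3: "\<And>m. m < M \<Longrightarrow> p \<notin> S3 m" and n4: "p \<notin> S4"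
        by auto
      have Dd: "D \<le> d" using n1 cod by (auto simp: S1_def P)
      have dn: "d \<le> n" using cod by (rule codes_size_le)
      have "N m \<le> card {j \<in> B m. \<delta> \<le> 2 * w m j * real ((g j + h j + 1) div 2)}" if m: "m < M" for m
      proof -
        have small: "2 * card {j \<in> H m. g j + h j < t j} < card (H m)"
          using n3[OF m] cod Dd by (auto simp: S3_def P)
        have "card ({j \<in> H m. g j + h j < t j} \<union> {j \<in> H m. \<not> g j + h j < t j})
            = card {j \<in> H m. g j + h j < t j} + card {j \<in> H m. \<not> g j + h j < t j}"
          by (rule card_Un_disjoint) (auto simp: H_def)
        moreover have "{j \<in> H m. g j + h j < t j} \<union> {j \<in> H m. \<not> g j + h j < t j} = H m" by blast
        ultimately have "N m \<le> card {j \<in> H m. \<not> g j + h j < t j}" using small by (simp add: N_def)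
        also have "\<dots> \<le> card {j \<in> B m. \<delta> \<le> 2 * w m j * real ((g j + h j + 1) div 2)}"
        proof (intro card_mono subsetI)
          fix j assume j: "j \<in> {j \<in> H m. \<not> g j + h j < t j}"
          have j0: "0 < j" "j \<le> K m" using j by (auto simp: H_def)
          have "\<delta> / real j \<le> real (t j)" unfolding t_def by (rule real_nat_ceiling_ge)
          also have "\<dots> \<le> real (g j + h j)" using j by simp
          also have "\<dots> \<le> 2 * real ((g j + h j + 1) div 2)" by linarith
          finally have "\<delta> \<le> 2 * real j * real ((g j + h j + 1) div 2)" using j0 by (simp add: field_simps)
          then show "j \<in> {j \<in> B m. \<delta> \<le> 2 * w m j * real ((g j + h j + 1) div 2)}"
            using j j0 H_sub[of m] by (auto simp: w_def)
        qed (simp add: B_def)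
        finally show ?thesis .
      qed
      moreover have "- E m \<le> (\<Sum>j\<in>B m. w m j * (real (h j) - real (g j)))" if m: "m < M" for m
      proof -
        have "0 < K m" using aK[of m] a1[of m] by linarith
        moreover have "K m \<le> d" using KD[OF m] Dd by linarith
        ultimately have "(\<Sum>j=1..d. min j (K m) * g j) \<le> (\<Sum>j=1..d. min j (K m) * h j)"
          using graphical_decode[OF gr, of "K m"] by linarith
        then have "real (\<Sum>j=1..d. min j (K m) * g j) \<le> real (\<Sum>j=1..d. min j (K m) * h j)" by (rule of_nat_mono)
        then have "0 \<le> (\<Sum>j=1..d. w m j * (real (h j) - real (g j)))"
          by (simp add: w_def right_diff_distrib sum_subtractf)
        also have "\<dots> = (\<Sum>j=1..n. w m j * (real (h j) - real (g j)))"
          using cod dn by (intro sum.mono_neutral_left) (auto simp: codes_def)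
        also have "\<dots> = (\<Sum>j=1..n. v m j * (real (h j) - real (g j))) + (\<Sum>j=1..n. if j \<in> B m then w m j * (real (h j) - real (g j)) else 0)"
          unfolding sum.distrib[symmetric] by (intro sum.cong refl) (simp add: v_def)
        also have "(\<Sum>j=1..n. if j \<in> B m then w m j * (real (h j) - real (g j)) else 0) = (\<Sum>j\<in>B m. w m j * (real (h j) - real (g j)))"
          using B_sub[OF m] Dd dn by (intro sum.mono_neutral_cong_right) auto
        finally show ?thesis using n2[OF m] cod by (auto simp: S2_def P)
      qed
      ultimately have "p \<in> S4" using cod Dd by (auto simp: S4_def P)
      then show False using n4 by contradiction
    qed
  qed
  have sub: "S1 \<subseteq> codes n" "S2 m \<subseteq> codes n" "S3 m \<subseteq> codes n" "S4 \<subseteq> codes n" for m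
    by (auto simp: S1_def S2_def S3_def S4_def)
  have fin: "finite S1" "finite (S2 m)" "finite (S3 m)" "finite S4" for m
    by (rule finite_subset[OF sub(1) finite_codes] finite_subset[OF sub(2) finite_codes]
        finite_subset[OF sub(3) finite_codes] finite_subset[OF sub(4) finite_codes])+
  have "real (card {p \<in> codes n. graphical (decode p)}) \<le> real (card (S1 \<union> (\<Union>m<M. S2 m) \<union> (\<Union>m<M. S3 m) \<union> S4))"
    using cover fin by (intro of_nat_mono card_mono) auto
  also have "\<dots> \<le> real (card S1 + (\<Sum>m<M. card (S2 m)) + (\<Sum>m<M. card (S3 m)) + card S4)"
    by (intro of_nat_mono order_trans[OF card_Un_le] add_mono card_UN_le) auto
  also have "\<dots> = real (card S1) + (\<Sum>m<M. real (card (S2 m))) + (\<Sum>m<M. real (card (S3 m))) + real (card S4)"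
    by simp
  also have "real (card S1) \<le> real (D * (n + 1) ^ (2 * D))"
    unfolding S1_def by (intro of_nat_mono card_codes_small_size_le)
  also have "(\<Sum>m<M. real (card (S2 m))) \<le> (\<Sum>m<M. R * exp (- (r\<^sup>2 / 64)))"
  proof (intro sum_mono)
    fix m assume "m \<in> {..<M}"
    define s where "s = sqrt (real (a m))"
    have s: "0 < s" "s\<^sup>2 = real (a m)" using a1[of m] by (auto simp: s_def)
    have "sqrt (real (\<rho> ^ (2 * m0))) \<le> s" unfolding s_def using a_0[of m] by (intro real_sqrt_le_mono of_nat_mono)
    then have rs: "r \<le> 8 * s" using r by linarith
    \<comment> \<open>The minimiser of 16 s^2 (\<theta>/x)^2 - \<theta> \<open>E m\<close>, with
      minimum -r^2/64. The hypothesis on \<open>r\<close> makes it admissible for the exponential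
      moment.\<close>
    define \<theta> where "\<theta> = x * r / (32 * s)"
    have \<theta>: "0 \<le> \<theta>" "4 * \<theta> \<le> x"
    proof -
      show "0 \<le> \<theta>" using x r s by (simp add: \<theta>_def)
      have "x * r \<le> x * (8 * s)" using rs x by (intro mult_left_mono) auto
      then show "4 * \<theta> \<le> x" using s by (simp add: \<theta>_def field_simps)
    qed
    have v: "0 \<le> v m j" "v m j \<le> real j" for j by (auto simp: v_def w_def)
    have "real (card (S2 m)) \<le> R * exp (8 * (\<theta> / x)\<^sup>2 * (\<Sum>j=1..n. (v m j / real j)\<^sup>2) - \<theta> * E m)"
      unfolding S2_def
    proof (rule card_codes_tail_le[OF ratio x \<theta>(1) v(1)])
      fix j
      have "4 * \<theta> * v m j \<le> x * real j" using \<theta> v[of j] x by (intro mult_mono) auto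
      then show "4 * (\<theta> * v m j) \<le> x * real j" by simp
    qed
    also have "\<dots> \<le> R * exp (- (r\<^sup>2 / 64))"
    proof (intro mult_left_mono R0)
      have "(\<Sum>j=1..n. (v m j / real j)\<^sup>2) \<le> 2 * real (a m)"
        unfolding v_def w_def B_def K_def using a1[of m] \<rho> by (intro off_block_weight_le) auto
      then have "8 * (\<theta> / x)\<^sup>2 * (\<Sum>j=1..n. (v m j / real j)\<^sup>2) \<le> 8 * (\<theta> / x)\<^sup>2 * (2 * s\<^sup>2)"
        unfolding s(2) by (intro mult_left_mono) auto
      also have "\<dots> = r\<^sup>2 / 64"
        using s(1) x by (simp add: \<theta>_def power_divide power_mult_distrib)
      also have "r\<^sup>2 / 64 - \<theta> * E m = - (r\<^sup>2 / 64)"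
        using s(1) x by (simp add: \<theta>_def E_def power2_eq_square flip: s_def)
      finally show "exp (8 * (\<theta> / x)\<^sup>2 * (\<Sum>j=1..n. (v m j / real j)\<^sup>2) - \<theta> * E m) \<le> exp (- (r\<^sup>2 / 64))" by simp
    qed
    finally show "real (card (S2 m)) \<le> R * exp (- (r\<^sup>2 / 64))" .
  qed
  also have "(\<Sum>m<M. real (card (S3 m))) \<le> (\<Sum>m<M. (real D / x + 1) * R * (4 / 5) ^ (\<rho> ^ (2 * m0)))"
  proof (intro sum_mono)
    fix m assume "m \<in> {..<M}"
    then have m: "m < M" by simp
    have "real (card (S3 m)) \<le> (real (card (H m)) / x + 1) * R * (4 / 5) ^ card (H m)"
      unfolding S3_def using H_sub[of m] B_sub[OF m] t[OF _ m] by (intro card_codes_many_small_pairs_le[OF ratio x]) auto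
    also have "\<dots> \<le> (real D / x + 1) * R * (4 / 5) ^ (\<rho> ^ (2 * m0))"
    proof (intro mult_mono power_decreasing add_mono divide_right_mono)
      show "\<rho> ^ (2 * m0) \<le> card (H m)" using a_0[of m] cardH(2)[of m] by linarith
      show "real (card (H m)) \<le> real D" using cardH(1)[of m] KD[OF m] by simp
    qed (use x R0 in auto)
    finally show "real (card (S3 m)) \<le> (real D / x + 1) * R * (4 / 5) ^ (\<rho> ^ (2 * m0))" .
  qed
  also have "real (card S4) \<le> q ^ M * real (nparts n)"
    unfolding S4_def
  proof (rule card_codes_persistent_le)
    show "0 \<le> q" using q r by (smt (verit) divide_nonneg_nonneg real_sqrt_ge_zero of_nat_0_le_iff)
    fix m assume m: "m < M"
    define s where "s = sqrt (real (a m))"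
    have s: "1 \<le> s" "s\<^sup>2 = real (a m)" using a1[of m] by (auto simp: s_def)
    have "E m / \<delta> = 38 * r * s" using x by (simp add: E_def \<delta>_def s_def)
    moreover have "38 * r * s + 1 \<le> 39 * r * s"
      using mult_mono[of 1 r 1 s] r s by simp
    ultimately have num: "E m / \<delta> + 1 \<le> 39 * r * s" by linarith
    \<comment> \<open>As \<open>K m\<close> is at least twice \<open>a m\<close>, at least about a
      quarter of \<open>K m\<close> coordinates are large. The factor \<open>s\<close> then cancels
      against that in \<open>E m\<close>, which makes the bound the same at every scale.\<close>
    have "s * sqrt (real \<rho>) / 2 = sqrt (real (K m) / 4)"
      by (simp add: K_def s_def real_sqrt_mult real_sqrt_divide)
    also have "\<dots> \<le> sqrt (real (N m) + 1)"
    proof (intro real_sqrt_le_mono)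
      have "K m \<le> 2 * card (H m)" using cardH(1)[of m] aK(2)[of m] by linarith
      moreover have "card (H m) \<le> 2 * N m + 1" by (simp add: N_def)
      ultimately show "real (K m) / 4 \<le> real (N m) + 1" by linarith
    qed
    finally have den: "s * sqrt (real \<rho>) / 2 \<le> sqrt (real (N m) + 1)" .
    have "(E m / \<delta> + 1) / sqrt (real (N m) + 1) \<le> 39 * r * s / (s * sqrt (real \<rho>) / 2)"
      using num den s r \<rho> by (intro frac_le) auto
    also have "\<dots> = 78 * r / sqrt (real \<rho>)" using s \<rho> by (simp add: field_simps)
    finally show "1 / 2 + (E m / \<delta> + 1) / sqrt (real (N m) + 1) \<le> q" using q by linarith
    show "0 \<le> E m" using r x by (simp add: E_def)
    show "B m \<subseteq> {1..D}" using m by (rule B_sub)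
  qed (use disj \<delta>0 in auto)
  finally show ?thesis by simp
qed

section \<open>From counts to probabilities, and the choice of parameters\<close>

lemma prob_graphical_eq: "prob_graphical n = real (card {p \<in> codes n. graphical (decode p)}) / real (nparts n)"
proof -
  have "prob_graphical n = real (card (partitions_of n \<inter> {xs. graphical xs})) / real (card (partitions_of n))"
    unfolding prob_graphical_def by (rule measure_pmf_of_set[OF partitions_of_nonempty finite_partitions_of])
  also have "card (partitions_of n \<inter> {xs. graphical xs}) = card {p \<in> codes n. graphical (decode p)}"
  proof -
    have img: "decode ` {p \<in> codes n. graphical (decode p)} = partitions_of n \<inter> {xs. graphical xs}"
      using bij_betw_decode[of n] by (auto simp: bij_betw_def)
    show ?thesis unfolding img[symmetric]
      by (rule card_image, rule inj_on_subset[OF inj_on_decode]) auto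
  qed
  finally show ?thesis unfolding nparts_def .
qed

lemma prob_graphical_le:
  fixes \<rho> n M m0 A :: nat and r q c :: real
  defines "D \<equiv> \<rho> ^ (2 * (m0 + M))"
  assumes n: "0 < n" and c: "0 < c"
    and ratio: "\<And>N. real (nparts N) \<le> c * real n ^ A * real (nparts n) * exp (hr_rate n * (real N - real n))"
    and \<rho>: "2 \<le> \<rho>" and r: "1 \<le> r" "r \<le> 8 * sqrt (real (\<rho> ^ (2 * m0)))"
    and D: "38 * hr_rate n * real D \<le> 1" and q: "1 / 2 + 78 * r / sqrt (real \<rho>) \<le> q"
  shows "prob_graphical n \<le> c * real n ^ A * (real (D * (n + 1) ^ (2 * D)) * exp (- (hr_rate n * real n))
      + real M * exp (- (r\<^sup>2 / 64)) + real M * (real D / hr_rate n + 1) * (4 / 5) ^ (\<rho> ^ (2 * m0))) + q ^ M"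
proof -
  define P where "P = real (nparts n)"
  define C where "C = c * real n ^ A"
  have P: "0 < P" using nparts_pos[of n] by (simp add: P_def)
  \<comment> \<open>At N = 0 the ratio bound becomes a lower bound for \<open>nparts n\<close>,
    against which the crude count of small Durfee squares is measured.\<close>
  have "1 \<le> real (nparts 0)" using nparts_pos[of 0] by simp
  also have "\<dots> \<le> C * P * exp (- (hr_rate n * real n))"
    using ratio[of 0] by (simp add: C_def P_def)
  finally have one: "1 \<le> C * P * exp (- (hr_rate n * real n))" .
  have ratio': "real (nparts N) \<le> C * P * exp (hr_rate n * (real N - real n))" for N
    using ratio[of N] unfolding C_def P_def .
  have "real (card {p \<in> codes n. graphical (decode p)})
     \<le> real (D * (n + 1) ^ (2 * D)) + real M * (C * P * exp (- (r\<^sup>2 / 64)))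
      + real M * ((real D / hr_rate n + 1) * (C * P) * (4 / 5) ^ (\<rho> ^ (2 * m0))) + q ^ M * real (nparts n)"
    unfolding D_def by (rule card_graphical_codes_le[OF ratio' hr_rate_pos[OF n] \<rho> r D[unfolded D_def] q])
  also have "real (D * (n + 1) ^ (2 * D)) = real (D * (n + 1) ^ (2 * D)) * 1" by simp
  also have "real (D * (n + 1) ^ (2 * D)) * 1 \<le> real (D * (n + 1) ^ (2 * D)) * (C * P * exp (- (hr_rate n * real n)))"
    using one by (intro mult_left_mono) auto
  finally have "real (card {p \<in> codes n. graphical (decode p)})
     \<le> (C * (real (D * (n + 1) ^ (2 * D)) * exp (- (hr_rate n * real n))
      + real M * exp (- (r\<^sup>2 / 64)) + real M * (real D / hr_rate n + 1) * (4 / 5) ^ (\<rho> ^ (2 * m0))) + q ^ M) * P"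
    unfolding P_def[symmetric] distrib_left distrib_right by (simp only: mult_ac order_refl)
  then show ?thesis
    unfolding prob_graphical_eq P_def[symmetric] C_def[symmetric] using P by (simp add: pos_divide_le_eq)
qed

text \<open>The number 13/25 is the survival bound 1/2 + 1/50 per scale. Four squarings starting
  from e^(1/25) give the estimate e^(16/25) \<le> 25/13.\<close>

lemma exp_neg_16_25: "13 / 25 \<le> exp (- (16 / 25) :: real)"
proof -
  have double: "exp (2 * z) \<le> b'" if "exp z \<le> b" "b\<^sup>2 \<le> b'" for z b b' :: real
  proof -
    have "exp (2 * z) = (exp z)\<^sup>2" by (rule exp_double)
    also have "\<dots> \<le> b\<^sup>2" using that by (intro power_mono) auto
    finally show ?thesis using that by linarith
  qed
  have "exp (1 / 25 :: real) \<le> 1 + 1 / 25 + (1 / 25)\<^sup>2"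
    by (rule exp_bound) auto
  then have "exp (1 / 25 :: real) \<le> 1.0416" by (simp add: power2_eq_square)
  from double[OF this, of "1.085"] have "exp (2 / 25 :: real) \<le> 1.085" by (simp add: power2_eq_square)
  from double[OF this, of "1.1773"] have "exp (4 / 25 :: real) \<le> 1.1773" by (simp add: power2_eq_square)
  from double[OF this, of "1.3861"] have "exp (8 / 25 :: real) \<le> 1.3861" by (simp add: power2_eq_square)
  from double[OF this, of "25 / 13"] have "exp (16 / 25 :: real) \<le> 25 / 13" by (simp add: power2_eq_square)
  then show ?thesis by (simp add: exp_minus field_simps)
qed

lemma prob_graphical_le_explicit:
  fixes n A :: nat and c :: real
  defines "L \<equiv> ln (real n)"
  assumes n: "0 < n" and c: "0 < c" "c \<le> real n" "c * L \<le> real n"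
    and ratio: "\<And>N. real (nparts N) \<le> c * real n ^ A * real (nparts n) * exp (hr_rate n * (real N - real n))"
    and L: "2 \<le> L" "L \<le> real n" "(real A + 2) * L \<le> exp (L / 100)"
    and a1: "(9 / 40) * L / ((5 / 4) * ln L + ln 2) \<ge> 3"
    and a2: "78 * (8 * sqrt ((real A + 2) * L)) / (L powr (5 / 8)) \<le> (1 / 50)"
    and a3: "38 * hr_rate n * exp ((23 / 50) * L) \<le> 1"
    and a4: "exp ((23 / 50) * L) / hr_rate n + 1 \<le> real n"
    and a5: "(real A + 3) * L + 2 * exp ((23 / 50) * L) * ln (real n + 1) \<le> hr_rate n * real n"
    and a6: "(real A + 4) * L \<le> exp (L / 100) / 5"
  shows "prob_graphical n \<le> 3 / real n + exp ((32 / 25) - (18 / 125) * L / ((5 / 4) * ln L + ln 2))"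
proof -
  \<comment> \<open>With \<open>r\<close> of order \<surd>L, the Littlewood-Offord error
    r/\<surd>\<rho> has order L^(1/2 - 5/8) and tends to 0.\<close>
  define \<rho> where "\<rho> = nat \<lceil>L powr (5 / 4)\<rceil>"
  define l where "l = ln (real \<rho>)"
  \<comment> \<open>The lowest scale is at least n^(1/100), so that (4/5)^a0 is smaller than any
    power of \<open>n\<close>.\<close>
  define m0 where "m0 = nat \<lceil>(1 / 200) * L / l\<rceil>"
  \<comment> \<open>The top scale is at most n^(23/50), below \<surd>n by a margin that absorbs
    logarithms. Since 23/100 = 1/200 + 9/40, about (9/40)L/l scales remain, and the two roundings
    cost at most 2 of them.\<close>
  define M where "M = nat \<lfloor>(23 / 100) * L / l\<rfloor> - m0"
  define D where "D = \<rho> ^ (2 * (m0 + M))"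
  define a0 where "a0 = \<rho> ^ (2 * m0)"
  \<comment> \<open>Chosen so that the tail exp(-r^2/64) equals n^(-(A+2)).\<close>
  define r where "r = 8 * sqrt ((real A + 2) * L)"
  define x where "x = hr_rate n"
  have x: "0 < x" using n by (simp add: x_def hr_rate_pos)
  have eL: "exp L = real n" using n by (simp add: L_def)
  have lnL: "0 < ln L" using L by simp
  have Lp: "2 \<le> L powr (5 / 4)"
  proof -
    have "2 \<le> L powr 1" using L by simp
    also have "\<dots> \<le> L powr (5 / 4)" using L by (intro powr_mono) auto
    finally show ?thesis .
  qed
  have \<rho>_ge: "L powr (5 / 4) \<le> real \<rho>" unfolding \<rho>_def by (rule real_nat_ceiling_ge)
  have \<rho>2: "2 \<le> \<rho>" using \<rho>_ge Lp by linarith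
  have \<rho>_le: "real \<rho> \<le> 2 * L powr (5 / 4)" unfolding \<rho>_def using Lp by linarith
  have "ln (L powr (5 / 4)) \<le> l" unfolding l_def using \<rho>_ge Lp by (subst ln_le_cancel_iff; linarith)
  then have l_ge: "(5 / 4) * ln L \<le> l" by (simp only: ln_powr)
  have "0 < (5 / 4) * ln L" using lnL by (intro mult_pos_pos) auto
  then have l0: "0 < l" using l_ge by (rule less_le_trans)
  have "l \<le> ln (2 * L powr (5 / 4))" unfolding l_def using \<rho>_le \<rho>_ge Lp by (subst ln_le_cancel_iff; linarith)
  also have "\<dots> = ln 2 + (5 / 4) * ln L" using L(1) by (subst ln_mult_pos) (simp_all only: ln_powr, simp_all)
  finally have l_le: "l \<le> (5 / 4) * ln L + ln 2" by linarith
  have l_half: "(23 / 100) \<le> l"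
  proof -
    have "ln 2 \<le> l" unfolding l_def using \<rho>2 by simp
    moreover have "(1 / 2 :: real) \<le> ln 2" using ln2_ge_two_thirds by linarith
    ultimately show ?thesis by linarith
  qed
  have "(9 / 40) * L / ((5 / 4) * ln L + ln 2) \<le> (9 / 40) * L / l"
    using L l_le l0 by (intro divide_left_mono) auto
  then have big: "3 \<le> (9 / 40) * L / l" using a1 by linarith
  have m0_ge: "(1 / 200) * L / l \<le> real m0" unfolding m0_def by (rule real_nat_ceiling_ge)
  have m0_le: "real m0 \<le> (1 / 200) * L / l + 1" unfolding m0_def using L l0 by (simp add: ceiling_correct order_less_imp_le)
  have fl: "(23 / 100) * L / l - 1 \<le> real (nat \<lfloor>(23 / 100) * L / l\<rfloor>)" "real (nat \<lfloor>(23 / 100) * L / l\<rfloor>) \<le> (23 / 100) * L / l"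
    using L l0 by (linarith, intro of_nat_floor, simp)
  have split: "(23 / 100) * L / l = (1 / 200) * L / l + (9 / 40) * L / l" by (simp add: add_divide_distrib[symmetric])
  have "real m0 \<le> real (nat \<lfloor>(23 / 100) * L / l\<rfloor>)" using m0_le fl big split by linarith
  then have m0M: "m0 + M = nat \<lfloor>(23 / 100) * L / l\<rfloor>" "real M = real (nat \<lfloor>(23 / 100) * L / l\<rfloor>) - real m0"
    by (auto simp: M_def)
  have M_ge: "(9 / 40) * L / l - 2 \<le> real M" using m0M(2) m0_le fl split by linarith
  have "real M \<le> (23 / 100) * L / l" using m0M(2) fl by linarith
  also have "\<dots> \<le> (23 / 100) * L / (23 / 100)" using l_half L by (intro divide_left_mono) auto
  finally have M_le: "real M \<le> L" by simp
  have \<rho>_pow: "real (\<rho> ^ k) = exp (real k * l)" for k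
    using \<rho>2 by (simp add: l_def exp_of_nat_mult)
  have D_le: "real D \<le> exp ((23 / 50) * L)"
  proof -
    have "real (2 * (m0 + M)) * l \<le> 2 * ((23 / 100) * L / l) * l"
      using fl l0 unfolding m0M(1) by (intro mult_right_mono) auto
    also have "\<dots> = (23 / 50) * L" using l0 by simp
    finally show ?thesis unfolding D_def \<rho>_pow by simp
  qed
  have a0_ge: "exp (L / 100) \<le> real a0"
  proof -
    have "L / 100 = 2 * ((1 / 200) * L / l) * l" using l0 by simp
    also have "\<dots> \<le> real (2 * m0) * l" using m0_ge l0 by (intro mult_right_mono) auto
    finally show ?thesis unfolding a0_def \<rho>_pow by simp
  qed
  have AL: "1 \<le> (real A + 2) * L"
    using mult_mono[of 1 "real A + 2" 1 L] L by simp
  have "prob_graphical n \<le> c * real n ^ A * (real (D * (n + 1) ^ (2 * D)) * exp (- (x * real n))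
      + real M * exp (- (r\<^sup>2 / 64)) + real M * (real D / x + 1) * (4 / 5) ^ a0) + (13 / 25) ^ M"
    unfolding D_def x_def a0_def
  proof (rule prob_graphical_le[OF n c(1) ratio \<rho>2])
    have "1 \<le> sqrt ((real A + 2) * L)" using AL by simp
    then show "1 \<le> r" unfolding r_def by linarith
    show "r \<le> 8 * sqrt (real (\<rho> ^ (2 * m0)))"
      unfolding r_def a0_def[symmetric] using L(3) a0_ge by simp
    have "38 * x * real D \<le> 38 * x * exp ((23 / 50) * L)" using D_le x by (intro mult_left_mono) auto
    then show "38 * hr_rate n * real (\<rho> ^ (2 * (m0 + M))) \<le> 1" using a3 by (simp add: x_def D_def)
    have "L powr (5 / 8) = sqrt (L powr (5 / 4))" using L by (simp add: powr_half_sqrt[symmetric] powr_powr)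
    also have "\<dots> \<le> sqrt (real \<rho>)" using \<rho>_ge by simp
    finally have "78 * r / sqrt (real \<rho>) \<le> 78 * r / (L powr (5 / 8))"
      using L AL \<rho>2 by (intro divide_left_mono) (auto simp: r_def)
    then show "1 / 2 + 78 * r / sqrt (real \<rho>) \<le> 13 / 25" using a2 by (simp add: r_def)
  qed
  also have "\<dots> \<le> 3 / real n + exp ((32 / 25) - (18 / 125) * L / ((5 / 4) * ln L + ln 2))"
  proof -
    define C where "C = c * real n ^ A"
    have nA: "real n ^ k = exp (real k * L)" for k by (simp add: exp_of_nat_mult eL)
    have C: "0 \<le> C" "C \<le> exp ((real A + 1) * L)"
    proof -
      show "0 \<le> C" using c by (simp add: C_def)
      have "C \<le> real n * real n ^ A" unfolding C_def using c by (intro mult_right_mono) auto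
      also have "\<dots> = exp ((real A + 1) * L)" using nA[of "Suc A"] by (simp add: algebra_simps)
      finally show "C \<le> exp ((real A + 1) * L)" .
    qed
    have inv: "1 / real n = exp (- L)" by (simp add: exp_minus eL inverse_eq_divide)
    have "C * (real (D * (n + 1) ^ (2 * D)) * exp (- (x * real n))) \<le> 1 / real n"
    proof -
      have "real ((n + 1) ^ (2 * D)) = exp (real (2 * D) * ln (real n + 1))"
        unfolding exp_of_nat_mult by (simp add: add.commute)
      also have "\<dots> \<le> exp (2 * exp ((23 / 50) * L) * ln (real n + 1))"
        using D_le by (intro exp_mono mult_right_mono) auto
      finally have pw: "real ((n + 1) ^ (2 * D)) \<le> exp (2 * exp ((23 / 50) * L) * ln (real n + 1))" .
      have "real D \<le> exp L" using D_le L by (intro order_trans[OF D_le]) simp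
      then have "C * (real (D * (n + 1) ^ (2 * D)) * exp (- (x * real n)))
        \<le> exp ((real A + 1) * L) * (exp L * exp (2 * exp ((23 / 50) * L) * ln (real n + 1)) * exp (- (x * real n)))"
        unfolding of_nat_mult using C pw by (intro mult_mono) auto
      also have "\<dots> = exp ((real A + 2) * L + 2 * exp ((23 / 50) * L) * ln (real n + 1) - x * real n)"
        by (simp add: algebra_simps flip: exp_add)
      also have "\<dots> \<le> exp (- L)" using a5 by (simp add: x_def algebra_simps)
      finally show ?thesis by (simp add: inv)
    qed
    moreover have "C * (real M * exp (- (r\<^sup>2 / 64))) \<le> 1 / real n"
    proof -
      have "r\<^sup>2 / 64 = (real A + 2) * L" using AL by (simp add: r_def power_mult_distrib)
      then have "C * (real M * exp (- (r\<^sup>2 / 64))) \<le> c * real n ^ A * (L * exp (- ((real A + 2) * L)))"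
        unfolding C_def using M_le c by (intro mult_left_mono mult_right_mono) auto
      also have "\<dots> = c * L * exp (- (2 * L))"
        unfolding nA by (simp add: algebra_simps flip: exp_add)
      also have "\<dots> = c * L * (1 / real n * (1 / real n))" unfolding inv by (simp flip: exp_add)
      also have "\<dots> \<le> real n * (1 / real n * (1 / real n))" using c(3) by (intro mult_right_mono) auto
      finally show ?thesis using n by simp
    qed
    moreover have "C * (real M * (real D / x + 1) * (4 / 5) ^ a0) \<le> 1 / real n"
    proof -
      have "real D / x + 1 \<le> exp ((23 / 50) * L) / x + 1" using D_le x by (intro add_right_mono divide_right_mono) auto
      then have Dx: "real D / x + 1 \<le> exp L" using a4 eL by (simp add: x_def)
      have M_exp: "real M \<le> exp L" using M_le L(2) eL by simp
      have "(4 / 5 :: real) ^ a0 \<le> exp (- (1 / 5)) ^ a0"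
        using exp_ge_add_one_self[of "- (1 / 5) :: real"] by (intro power_mono) auto
      also have "\<dots> = exp (real a0 * (- (1 / 5)))" by (rule exp_of_nat_mult [symmetric])
      also have "\<dots> \<le> exp (- ((real A + 4) * L))" using a6 a0_ge by simp
      finally have "C * (real M * (real D / x + 1) * (4 / 5) ^ a0) \<le> exp ((real A + 1) * L) * (exp L * exp L * exp (- ((real A + 4) * L)))"
        using C M_exp Dx x by (intro mult_mono) auto
      also have "\<dots> = exp (- L)" by (simp add: algebra_simps flip: exp_add)
      finally show ?thesis by (simp add: inv)
    qed
    moreover have "(13 / 25 :: real) ^ M \<le> exp ((32 / 25) - (18 / 125) * L / ((5 / 4) * ln L + ln 2))"
    proof -
      have "(13 / 25 :: real) ^ M \<le> exp (- (16 / 25)) ^ M"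
        using exp_neg_16_25 by (intro power_mono) auto
      also have "\<dots> = exp (real M * (- (16 / 25)))" by (rule exp_of_nat_mult [symmetric])
      also have "\<dots> \<le> exp ((32 / 25) - (18 / 125) * L / ((5 / 4) * ln L + ln 2))"
      proof (rule exp_mono)
        have "(9 / 40) * L / ((5 / 4) * ln L + ln 2) - 2 \<le> real M"
          using M_ge \<open>(9 / 40) * L / ((5 / 4) * ln L + ln 2) \<le> (9 / 40) * L / l\<close> by linarith
        moreover have "(9 / 40) * L / ((5 / 4) * ln L + ln 2) = (9 / 40) * (L / ((5 / 4) * ln L + ln 2))"
          "(18 / 125) * L / ((5 / 4) * ln L + ln 2) = (18 / 125) * (L / ((5 / 4) * ln L + ln 2))"
          by (rule times_divide_eq_right [symmetric])+
        ultimately show "real M * (- (16 / 25)) \<le> (32 / 25) - (18 / 125) * L / ((5 / 4) * ln L + ln 2)" by linarith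
      qed
      finally show ?thesis .
    qed
    ultimately show ?thesis unfolding C_def[symmetric] distrib_left by linarith
  qed
  finally show ?thesis .
qed

theorem theorem3p1:
  shows "\<forall>\<^sub>F n :: nat in sequentially.
           prob_graphical n \<le> exp (- (0.11 * ln (real n) / ln (ln (real n))))"
proof -
  obtain A :: nat and c :: real where c: "0 < c"
    and ratio: "\<And>n N. 0 < n \<Longrightarrow> real (nparts N) \<le> c * real n ^ A * real (nparts n) * exp (hr_rate n * (real N - real n))"
    by (rule nparts_ratio) blast
  \<comment> \<open>\<open>C\<close> and \<open>a\<close> stand for the constants as plain
    parameters of known sign, which is all that the asymptotic comparisons need.\<close>
  define C where "C = hr_const"
  define a where "a = real A"
  have C: "C > 0" by (simp add: C_def hr_const_pos)
  have a: "a \<ge> 0" by (simp add: a_def)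
  have "\<forall>\<^sub>F n :: nat in sequentially. 0 < n" by real_asymp
  moreover have "\<forall>\<^sub>F n :: nat in sequentially. c \<le> real n" by real_asymp
  moreover have "\<forall>\<^sub>F n :: nat in sequentially. c * ln (real n) \<le> real n" by real_asymp
  moreover have "\<forall>\<^sub>F n :: nat in sequentially. 2 \<le> ln (real n)" by real_asymp
  moreover have "\<forall>\<^sub>F n :: nat in sequentially. ln (real n) \<le> real n" by real_asymp
  moreover have "\<forall>\<^sub>F n :: nat in sequentially. (a + 2) * ln (real n) \<le> exp (ln (real n) / 100)" by real_asymp
  moreover have "\<forall>\<^sub>F n :: nat in sequentially. (9 / 40) * ln (real n) / ((5 / 4) * ln (ln (real n)) + ln 2) \<ge> 3" by real_asymp
  moreover have "\<forall>\<^sub>F n :: nat in sequentially. 78 * (8 * sqrt ((a + 2) * ln (real n))) / (ln (real n) powr (5 / 8)) \<le> (1 / 50)"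
    using a by real_asymp
  moreover have "\<forall>\<^sub>F n :: nat in sequentially. 38 * (C / (2 * sqrt (real n))) * exp ((23 / 50) * ln (real n)) \<le> 1"
    using C by real_asymp
  moreover have "\<forall>\<^sub>F n :: nat in sequentially. exp ((23 / 50) * ln (real n)) / (C / (2 * sqrt (real n))) + 1 \<le> real n"
    using C by real_asymp
  moreover have "\<forall>\<^sub>F n :: nat in sequentially. (a + 3) * ln (real n) + 2 * exp ((23 / 50) * ln (real n)) * ln (real n + 1) \<le> C / (2 * sqrt (real n)) * real n"
    using C a by real_asymp
  moreover have "\<forall>\<^sub>F n :: nat in sequentially. (a + 4) * ln (real n) \<le> exp (ln (real n) / 100) / 5" by real_asymp
  moreover have "\<forall>\<^sub>F n :: nat in sequentially. 3 * exp (- ln (real n)) \<le> 1 / 2 * exp (- (0.11 * ln (real n) / ln (ln (real n))))"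
    by real_asymp
  \<comment> \<open>The leading constant is (16/25)(9/40)/(5/4) = 0.1152; its excess over 0.11
    absorbs the term \<open>ln 2\<close>, the two lost scales and the factor 1/2.\<close>
  moreover have "\<forall>\<^sub>F n :: nat in sequentially. exp ((32 / 25) - (18 / 125) * ln (real n) / ((5 / 4) * ln (ln (real n)) + ln 2)) \<le> 1 / 2 * exp (- (0.11 * ln (real n) / ln (ln (real n))))"
    by real_asymp
  ultimately show ?thesis
  proof eventually_elim
    case (elim n)
    have "prob_graphical n \<le> 3 / real n + exp ((32 / 25) - (18 / 125) * ln (real n) / ((5 / 4) * ln (ln (real n)) + ln 2))"
      using elim c ratio[OF elim(1)] unfolding a_def C_def
      by (intro prob_graphical_le_explicit[where c = c and A = A]) (simp_all only: hr_rate_def)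
    moreover have "3 / real n = 3 * exp (- ln (real n))"
      using elim(1) by (simp add: exp_minus divide_inverse)
    ultimately show ?case using elim(13,14) by linarith
  qed
qed

end
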